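(* There exist $2^{\aleph_0}$ pairwise non-quasi-isometric, finitely generated, torsion-free groups $G$, each with a finite generating set $\mathcal S$, such that: - every non-trivial cyclic subgroup of $G$ is strongly contracting in $\mathrm{Cay}(G,\mathcal S)$; - consequently, $G$ has the HEC property.
   Context: Cayley graphs carry the graph metric. A subset $Y$ is strongly contracting if there is a constant $C$ with $d(x,x')\le d(x,Y)\Rightarrow\mathrm{diam}(\pi(x)\cup\pi(x'))\le C$, where $\pi(x)=\{y\in Y:d(x,y)=d(x,Y)\}$. HEC property. The elementary closure $E(g)$ of $g$ is the subgroup generated by all virtually cyclic subgroups containing $g$. A group has the hyperbolically embedded cycles (HEC) property if, for every infinite order element $g$, the subgroup $E(g)$ is virtually cyclic and hyperbolically embedded. A subgroup $H\le G$ is hyperbolically embedded if there is $\mathcal T\subseteq G$ satisfying the following. Let $Z=\mathrm{Cay}(G,H\sqcup\mathcal T)$ (elements of $H\cap\mathcal T$ giving double edges). Let $\hat d$ on $H$ be the length of shortest paths in $Z$ avoiding the edges of $\mathrm{Cay}(H,H)$ ($\infty$ if none). The requirements are: - $H\sqcup\mathcal T$ generates $G$; - $Z$ is Gromov hyperbolic; - $\hat d$-balls in $H$ are finite. *)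

theory Defs
  imports "HOL-Algebra.Algebra" "HOL-Library.Extended_Nat"
begin

definition cay_dist :: "('a,'b) monoid_scheme \<Rightarrow> 'a set \<Rightarrow> 'a \<Rightarrow> 'a \<Rightarrow> nat" where
  "cay_dist G A x y = (LEAST n. \<exists>ws. length ws = n \<and> set ws \<subseteq> A \<union> (m_inv G) ` A
       \<and> x \<otimes>\<^bsub>G\<^esub> foldr (monoid.mult G) ws (monoid.one G) = y)"

definition set_dist :: "('a,'b) monoid_scheme \<Rightarrow> 'a set \<Rightarrow> 'a \<Rightarrow> 'a set \<Rightarrow> nat" where
  "set_dist G A x Y = Inf ((\<lambda>y. cay_dist G A x y) ` Y)"

definition closest_proj :: "('a,'b) monoid_scheme \<Rightarrow> 'a set \<Rightarrow> 'a set \<Rightarrow> 'a \<Rightarrow> 'a set" where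
  "closest_proj G A Y x = {y \<in> Y. cay_dist G A x y = set_dist G A x Y}"

definition strongly_contracting :: "('a,'b) monoid_scheme \<Rightarrow> 'a set \<Rightarrow> 'a set \<Rightarrow> bool" where
  "strongly_contracting G A Y \<longleftrightarrow> (\<exists>C::real. \<forall>x\<in>carrier G. \<forall>x'\<in>carrier G.
      cay_dist G A x x' \<le> set_dist G A x Y \<longrightarrow>
      (\<forall>a\<in>closest_proj G A Y x \<union> closest_proj G A Y x'.
        \<forall>b\<in>closest_proj G A Y x \<union> closest_proj G A Y x'. real (cay_dist G A a b) \<le> C))"

definition quasi_isometric ::
  "('a,'b) monoid_scheme \<Rightarrow> 'a set \<Rightarrow> ('c,'d) monoid_scheme \<Rightarrow> 'c set \<Rightarrow> bool" where
  "quasi_isometric G1 S1 G2 S2 \<longleftrightarrow> (\<exists>f \<in> carrier G1 \<rightarrow> carrier G2. \<exists>L::real. \<exists>c::real.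
      L \<ge> 1 \<and> c \<ge> 0 \<and>
      (\<forall>x\<in>carrier G1. \<forall>y\<in>carrier G1.
         real (cay_dist G1 S1 x y) / L - c \<le> real (cay_dist G2 S2 (f x) (f y)) \<and>
         real (cay_dist G2 S2 (f x) (f y)) \<le> L * real (cay_dist G1 S1 x y) + c) \<and>
      (\<forall>z\<in>carrier G2. \<exists>x\<in>carrier G1. real (cay_dist G2 S2 z (f x)) \<le> c))"

definition gromov_hyperbolic :: "'a set \<Rightarrow> ('a \<Rightarrow> 'a \<Rightarrow> real) \<Rightarrow> bool" where
  "gromov_hyperbolic V D \<longleftrightarrow> (\<exists>del::real. \<forall>x\<in>V. \<forall>y\<in>V. \<forall>z\<in>V. \<forall>w\<in>V.
      (D x w + D y w - D x y) / 2 \<ge>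
        min ((D x w + D z w - D x z) / 2) ((D y w + D z w - D y z) / 2) - del)"

text \<open>Edges of Z = Cay(G, H \<squnion> T) are labelled by Inl h (h in H) or Inr t (t in T);
  the boolean gives the direction (multiply by the label or by its inverse).\<close>
definition step_val :: "('a,'b) monoid_scheme \<Rightarrow> ('a + 'a) \<times> bool \<Rightarrow> 'a" where
  "step_val G s = (let e = case_sum id id (fst s) in if snd s then e else inv\<^bsub>G\<^esub> e)"

primrec walk_end :: "('a,'b) monoid_scheme \<Rightarrow> 'a \<Rightarrow> (('a + 'a) \<times> bool) list \<Rightarrow> 'a" where
  "walk_end G x [] = x"
| "walk_end G x (s # ss) = walk_end G (x \<otimes>\<^bsub>G\<^esub> step_val G s) ss"

text \<open>A walk avoids the edges of Cay(H,H): an H-labelled edge lies in Cay(H,H) exactly when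
  its endpoints lie in H.\<close>
primrec avoids_HH :: "('a,'b) monoid_scheme \<Rightarrow> 'a set \<Rightarrow> 'a \<Rightarrow> (('a + 'a) \<times> bool) list \<Rightarrow> bool" where
  "avoids_HH G H x [] = True"
| "avoids_HH G H x (s # ss) =
     ((isl (fst s) \<longrightarrow> x \<notin> H) \<and> avoids_HH G H (x \<otimes>\<^bsub>G\<^esub> step_val G s) ss)"

definition labels_ok :: "'a set \<Rightarrow> 'a set \<Rightarrow> (('a + 'a) \<times> bool) list \<Rightarrow> bool" where
  "labels_ok H T ss \<longleftrightarrow> (\<forall>s\<in>set ss. case fst s of Inl h \<Rightarrow> h \<in> H | Inr t \<Rightarrow> t \<in> T)"

definition hat_dist :: "('a,'b) monoid_scheme \<Rightarrow> 'a set \<Rightarrow> 'a set \<Rightarrow> 'a \<Rightarrow> 'a \<Rightarrow> enat" where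
  "hat_dist G H T x y = (INF ss \<in> {ss. labels_ok H T ss \<and> avoids_HH G H x ss \<and> walk_end G x ss = y}.
      enat (length ss))"

definition hyperbolically_embedded :: "('a,'b) monoid_scheme \<Rightarrow> 'a set \<Rightarrow> bool" where
  "hyperbolically_embedded G H \<longleftrightarrow> subgroup H G \<and>
     (\<exists>T \<subseteq> carrier G. generate G (H \<union> T) = carrier G \<and>
        gromov_hyperbolic (carrier G) (\<lambda>x y. real (cay_dist G (H \<union> T) x y)) \<and>
        (\<forall>h0\<in>H. \<forall>r::nat. finite {h \<in> H. hat_dist G H T h0 h \<le> enat r}))"

definition virtually_cyclic :: "('a,'b) monoid_scheme \<Rightarrow> 'a set \<Rightarrow> bool" where
  "virtually_cyclic G K \<longleftrightarrow> subgroup K G \<and>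
     (\<exists>c\<in>K. finite {generate G {c} #>\<^bsub>G\<^esub> k | k. k \<in> K})"

definition elementary_closure :: "('a,'b) monoid_scheme \<Rightarrow> 'a \<Rightarrow> 'a set" where
  "elementary_closure G g = generate G (\<Union>{K. virtually_cyclic G K \<and> g \<in> K})"

definition infinite_order :: "('a,'b) monoid_scheme \<Rightarrow> 'a \<Rightarrow> bool" where
  "infinite_order G g \<longleftrightarrow> (\<forall>n::nat. n > 0 \<longrightarrow> g [^]\<^bsub>G\<^esub> n \<noteq> \<one>\<^bsub>G\<^esub>)"

definition HEC :: "('a,'b) monoid_scheme \<Rightarrow> bool" where
  "HEC G \<longleftrightarrow> (\<forall>g\<in>carrier G. infinite_order G g \<longrightarrow>
      virtually_cyclic G (elementary_closure G g) \<and>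
      hyperbolically_embedded G (elementary_closure G g))"

definition torsion_free :: "('a,'b) monoid_scheme \<Rightarrow> bool" where
  "torsion_free G \<longleftrightarrow> (\<forall>g\<in>carrier G. g \<noteq> \<one>\<^bsub>G\<^esub> \<longrightarrow> infinite_order G g)"

end

theory Submission
  imports Defs "HOL-Library.Sublist"
begin

text \<open>For a set I of natural numbers let A be the subgroup of a free group F formed by the labels of
  the loops at 0 in a labelled integer line to which a rung from - l n to l n is added for each n in I,
  where l grows factorially; the group is the double of F along A. Two long paths in the graph with equal
  labels coincide, and this makes every non-trivial element g of the double
  have an axis of nested half-spaces: a half-space E with g E inside E whose translates are nested,
  finitely many of them separating two given points, and whose powers g^n E are reached from outside E
  only through a bounded neighbourhood of the axis. Such an element is strongly contracting, its
  elementary closure is its commensurator, and the pairs of points separated by few translates of E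
  give a relative generating set whose Cayley graph has the bottleneck property, hence is hyperbolic.

  A rung n in I yields a relation of length 4 l n + 2, which is not a consequence of the relations
  shorter than l n. If n is not in J, the relations up to length l (n + 1) of the group of J are
  consequences of those of length at most 4 l (n - 1) + 2, and l (n + 1) / l n and l n / l (n - 1) tend to
  infinity; hence a quasi-isometry from the group of I to that of J forces I - J to be finite.\<close>

section \<open>Word metrics and bottlenecks\<close>

text \<open>The double is studied as a subgroup of index two in the amalgam of F with A x Z/2 along
  A, where the generator t of order two commutes with A and conjugation by t exchanges the two
  copies of F. That amalgam is the semidirect product of F with the free product of groups of order
  two indexed by the cosets of A, so its elements are reduced lists of cosets together with a point
  of F. With t of length zero, word length becomes the cost of the cheapest path in the tree of F
  that visits the listed cosets in order. The obstacle is the elements conjugate into F: their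
  half-spaces must be grown from half-trees of F, and a coset that meets both sides of a half-tree
  leaks between them. An axis survives because only a single coset can leak along it, and this is
  what the labelling provides: the parity of the 2-adic valuation prevents long repetitions on the
  line, the sign in the labels prevents two rungs from being exchanged, and the fast growth of the
  rungs makes their differences distinct.\<close>

locale generated_group = group G for G (structure) +
  fixes S :: "'a set"
  assumes S_carrier: "S \<subseteq> carrier G"
    and S_generates: "generate G S = carrier G"
begin

definition letters :: "'a set" where "letters = S \<union> m_inv G ` S"

definition wprod :: "'a list \<Rightarrow> 'a" where "wprod ws = foldr (\<otimes>) ws \<one>"

lemma wprod_simps [simp]: "wprod [] = \<one>" "wprod (a # ws) = a \<otimes> wprod ws"
  by (simp_all add: wprod_def)

abbreviation d :: "'a \<Rightarrow> 'a \<Rightarrow> nat" where "d \<equiv> cay_dist G S"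

lemma letters_carrier: "letters \<subseteq> carrier G"
  using S_carrier by (auto simp: letters_def)

lemma letters_inv: "a \<in> letters \<Longrightarrow> inv a \<in> letters"
  using S_carrier by (auto simp: letters_def)

lemma wprod_closed [simp]: "set ws \<subseteq> carrier G \<Longrightarrow> wprod ws \<in> carrier G"
  by (induction ws) auto

lemma wprod_append:
  "set us \<subseteq> carrier G \<Longrightarrow> set vs \<subseteq> carrier G \<Longrightarrow> wprod (us @ vs) = wprod us \<otimes> wprod vs"
  by (induction us) (auto simp: m_assoc)

lemma wprod_rev_inv:
  "set ws \<subseteq> carrier G \<Longrightarrow> wprod (rev (map (m_inv G) ws)) = inv (wprod ws)"
proof (induction ws)
  case (Cons a ws)
  have "set (rev (map (m_inv G) ws)) \<subseteq> carrier G" using Cons.prems by auto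
  then show ?case using Cons by (simp add: wprod_append inv_mult_group)
qed simp

lemma ex_word:
  assumes "x \<in> carrier G"
  shows "\<exists>ws. set ws \<subseteq> letters \<and> wprod ws = x"
proof -
  have "x \<in> generate G S" using assms S_generates by simp
  then show ?thesis
  proof induction
    case one
    show ?case by (rule exI[of _ "[]"]) simp
  next
    case (incl h)
    then show ?case using S_carrier by (intro exI[of _ "[h]"]) (auto simp: letters_def)
  next
    case (inv h)
    then show ?case using S_carrier by (intro exI[of _ "[inv h]"]) (auto simp: letters_def)
  next
    case (eng h1 h2)
    then obtain u v where "set u \<subseteq> letters" "wprod u = h1" "set v \<subseteq> letters" "wprod v = h2"
      by blast
    moreover have "wprod (u @ v) = wprod u \<otimes> wprod v"
      using calculation letters_carrier by (intro wprod_append) (auto dest: subsetD)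
    ultimately show ?case by (intro exI[of _ "u @ v"]) auto
  qed
qed

lemma d_Least:
  "d x y = (LEAST n. \<exists>ws. length ws = n \<and> set ws \<subseteq> letters \<and> x \<otimes> wprod ws = y)"
  by (simp add: cay_dist_def wprod_def letters_def)

lemma d_word:
  assumes "x \<in> carrier G" "y \<in> carrier G"
  obtains ws where "length ws = d x y" "set ws \<subseteq> letters" "x \<otimes> wprod ws = y"
proof -
  obtain vs where vs: "set vs \<subseteq> letters" "wprod vs = inv x \<otimes> y"
    using ex_word[of "inv x \<otimes> y"] assms by auto
  have "x \<otimes> wprod vs = y" using assms vs by (simp add: m_assoc[symmetric])
  then have "\<exists>n ws. length ws = n \<and> set ws \<subseteq> letters \<and> x \<otimes> wprod ws = y"
    using vs(1) by (intro exI[of _ "length vs"] exI[of _ vs]) simp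
  from LeastI_ex[OF this] obtain ws
    where "length ws = d x y" "set ws \<subseteq> letters" "x \<otimes> wprod ws = y"
    unfolding d_Least by (elim exE conjE)
  then show ?thesis by (rule that)
qed

lemma d_le_word:
  "set ws \<subseteq> letters \<Longrightarrow> x \<otimes> wprod ws = y \<Longrightarrow> d x y \<le> length ws"
  unfolding d_Least by (rule Least_le) auto

lemma d_translate:
  assumes "a \<in> carrier G" "x \<in> carrier G" "y \<in> carrier G"
  shows "d (a \<otimes> x) (a \<otimes> y) = d x y"
proof -
  have "(a \<otimes> x) \<otimes> wprod ws = a \<otimes> y \<longleftrightarrow> x \<otimes> wprod ws = y" if "set ws \<subseteq> letters" for ws
  proof -
    have "wprod ws \<in> carrier G" using that letters_carrier by (intro wprod_closed) blast
    then show ?thesis using assms by (simp add: m_assoc)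
  qed
  then have "(\<exists>ws. length ws = n \<and> set ws \<subseteq> letters \<and> (a \<otimes> x) \<otimes> wprod ws = a \<otimes> y) \<longleftrightarrow>
      (\<exists>ws. length ws = n \<and> set ws \<subseteq> letters \<and> x \<otimes> wprod ws = y)" for n
    by blast
  then show ?thesis unfolding d_Least by presburger
qed

lemma d_self [simp]: "x \<in> carrier G \<Longrightarrow> d x x = 0"
  using d_le_word[of "[]" x x] by simp

lemma d_triangle:
  assumes "x \<in> carrier G" "y \<in> carrier G" "z \<in> carrier G"
  shows "d x z \<le> d x y + d y z"
proof -
  obtain u where u: "length u = d x y" "set u \<subseteq> letters" "x \<otimes> wprod u = y"
    by (rule d_word[OF assms(1,2)])
  obtain v where v: "length v = d y z" "set v \<subseteq> letters" "y \<otimes> wprod v = z"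
    by (rule d_word[OF assms(2,3)])
  have c: "set u \<subseteq> carrier G" "set v \<subseteq> carrier G" using u v letters_carrier by blast+
  have "x \<otimes> wprod (u @ v) = z" using assms u v c by (simp only: wprod_append m_assoc[symmetric] wprod_closed)
  then show ?thesis using d_le_word[of "u @ v" x z] u v by simp
qed

lemma d_sym_le:
  assumes "x \<in> carrier G" "y \<in> carrier G"
  shows "d y x \<le> d x y"
proof -
  obtain u where u: "length u = d x y" "set u \<subseteq> letters" "x \<otimes> wprod u = y"
    by (rule d_word[OF assms(1,2)])
  have c: "set u \<subseteq> carrier G" using u letters_carrier by blast
  have "y \<otimes> inv (wprod u) = x"
    using assms u(3)[symmetric] c by (simp add: m_assoc)
  then have "y \<otimes> wprod (rev (map (m_inv G) u)) = x"
    using wprod_rev_inv[OF c] by simp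
  moreover have "set (rev (map (m_inv G) u)) \<subseteq> letters" using u letters_inv by auto
  ultimately show ?thesis using d_le_word[of "rev (map (m_inv G) u)" y x] u by simp
qed

lemma d_sym: "x \<in> carrier G \<Longrightarrow> y \<in> carrier G \<Longrightarrow> d x y = d y x"
  using d_sym_le by (simp add: le_antisym)

lemma d_one: "x \<in> carrier G \<Longrightarrow> y \<in> carrier G \<Longrightarrow> d x y = d \<one> (inv x \<otimes> y)"
  using d_translate[of "inv x" x y] by simp

lemma d_step: "x \<in> carrier G \<Longrightarrow> s \<in> letters \<Longrightarrow> d x (x \<otimes> s) \<le> 1"
  using d_le_word[of "[s]" x "x \<otimes> s"] letters_carrier by auto

lemma ex_geodesic:
  assumes "x \<in> carrier G" "y \<in> carrier G"
  obtains p where "p 0 = x" "p (d x y) = y" "\<And>i. p i \<in> carrier G"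
    "\<And>i. i < d x y \<Longrightarrow> \<exists>s\<in>letters. p (Suc i) = p i \<otimes> s"
proof -
  obtain u where u: "length u = d x y" "set u \<subseteq> letters" "x \<otimes> wprod u = y"
    by (rule d_word[OF assms(1,2)])
  have c: "set u \<subseteq> carrier G" using u letters_carrier by blast
  have ct: "set (take i u) \<subseteq> carrier G" for i using c by (meson dual_order.trans set_take_subset)
  define p where "p i = x \<otimes> wprod (take i u)" for i
  have "\<exists>s\<in>letters. p (Suc i) = p i \<otimes> s" if "i < d x y" for i
  proof (rule bexI[of _ "u ! i"])
    have i: "i < length u" using that u by simp
    show "u ! i \<in> letters" using u(2) i nth_mem by blast
    have ui: "u ! i \<in> carrier G" using c i nth_mem by blast
    have "wprod (take (Suc i) u) = wprod (take i u) \<otimes> (u ! i)"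
      using i ui ct by (simp add: take_Suc_conv_app_nth wprod_append)
    then show "p (Suc i) = p i \<otimes> (u ! i)"
      unfolding p_def using assms ui ct by (simp add: m_assoc)
  qed
  moreover have "p 0 = x" "p (d x y) = y" using assms u by (simp_all add: p_def)
  moreover have "p i \<in> carrier G" for i using assms ct by (simp add: p_def)
  ultimately show ?thesis using that by blast
qed

lemma finite_ball:
  assumes "finite S" "x \<in> carrier G"
  shows "finite {y \<in> carrier G. d x y \<le> n}"
proof -
  have "finite letters" using assms by (simp add: letters_def)
  then have fin: "finite {ws. set ws \<subseteq> letters \<and> length ws \<le> n}"
    using finite_lists_length_le by blast
  have "{y \<in> carrier G. d x y \<le> n} \<subseteq> (\<lambda>ws. x \<otimes> wprod ws) ` {ws. set ws \<subseteq> letters \<and> length ws \<le> n}"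
  proof
    fix y assume "y \<in> {y \<in> carrier G. d x y \<le> n}"
    then have y: "y \<in> carrier G" "d x y \<le> n" by auto
    then obtain u where "length u = d x y" "set u \<subseteq> letters" "x \<otimes> wprod u = y"
      using d_word assms(2) by metis
    then show "y \<in> (\<lambda>ws. x \<otimes> wprod ws) ` {ws. set ws \<subseteq> letters \<and> length ws \<le> n}" using y by force
  qed
  then show ?thesis using fin finite_subset by blast
qed

end

section \<open>Bottleneck criterion for Gromov hyperbolicity\<close>

lemma discrete_ivt:
  fixes j :: "nat \<Rightarrow> nat"
  assumes "j 0 = 0" "j N = n" "\<And>i. i < N \<Longrightarrow> j (Suc i) \<le> j i + K" "a \<le> n"
  shows "\<exists>i\<le>N. a \<le> j i \<and> j i \<le> a + K"
proof -
  define i where "i = (LEAST i. a \<le> j i)"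
  have i: "a \<le> j i" "i \<le> N" using assms unfolding i_def by (auto intro: LeastI Least_le)
  show ?thesis
  proof (cases i)
    case 0
    then show ?thesis using i assms by auto
  next
    case (Suc i')
    have "\<not> a \<le> j i'" using Suc not_less_Least[of i' "\<lambda>i. a \<le> j i"] unfolding i_def by auto
    then show ?thesis using i Suc assms(3)[of i'] by (intro exI[of _ i]) auto
  qed
qed

context generated_group
begin

definition path :: "(nat \<Rightarrow> 'a) \<Rightarrow> nat \<Rightarrow> bool" where
  "path w n \<longleftrightarrow> w 0 \<in> carrier G \<and> (\<forall>j<n. \<exists>s\<in>letters. w (Suc j) = w j \<otimes> s)"

lemma path_step: "path w n \<Longrightarrow> j < n \<Longrightarrow> \<exists>s\<in>letters. w (Suc j) = w j \<otimes> s"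
  by (simp add: path_def)

lemma path_closed: "path w n \<Longrightarrow> j \<le> n \<Longrightarrow> w j \<in> carrier G"
proof (induction j)
  case (Suc j)
  then obtain s where "s \<in> letters" "w (Suc j) = w j \<otimes> s" using path_step[of w n j] by auto
  then show ?case using Suc letters_carrier by auto
qed (auto simp: path_def)

lemma path_dist: "path w n \<Longrightarrow> i \<le> j \<Longrightarrow> j \<le> n \<Longrightarrow> d (w i) (w j) \<le> j - i"
proof (induction j)
  case (Suc j)
  show ?case
  proof (cases "i = Suc j")
    case False
    then have ij: "i \<le> j" using Suc by simp
    obtain s where s: "s \<in> letters" "w (Suc j) = w j \<otimes> s" using Suc.prems path_step[of w n j] by auto
    have c: "w i \<in> carrier G" "w j \<in> carrier G" "w (Suc j) \<in> carrier G"
      using Suc.prems path_closed ij by auto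
    have "d (w i) (w j) \<le> j - i" using Suc ij by simp
    moreover have "d (w j) (w (Suc j)) \<le> 1" using s c d_step by simp
    ultimately show ?thesis using d_triangle[OF c] ij by linarith
  qed (use Suc path_closed in auto)
qed (auto simp: path_closed)

definition geod :: "'a \<Rightarrow> 'a \<Rightarrow> (nat \<Rightarrow> 'a) \<Rightarrow> bool" where
  "geod x y p \<longleftrightarrow> path p (d x y) \<and> p 0 = x \<and> p (d x y) = y"

lemma ex_geod:
  assumes "x \<in> carrier G" "y \<in> carrier G"
  obtains p where "geod x y p"
  using ex_geodesic[OF assms] assms unfolding geod_def path_def by metis

lemma geod_closed:
  assumes "geod x y p"
  shows "x \<in> carrier G" "y \<in> carrier G" "i \<le> d x y \<Longrightarrow> p i \<in> carrier G"
proof -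
  have p: "path p (d x y)" "p 0 = x" "p (d x y) = y" using assms unfolding geod_def by auto
  show "x \<in> carrier G" using path_closed[OF p(1), of 0] p(2) by simp
  show "y \<in> carrier G" using path_closed[OF p(1), of "d x y"] p(3) by simp
  show "p i \<in> carrier G" if "i \<le> d x y" using path_closed[OF p(1) that] .
qed

lemma geod_dist:
  assumes "geod x y p" "i \<le> j" "j \<le> d x y"
  shows "d (p i) (p j) = j - i"
proof -
  have p: "path p (d x y)" "p 0 = x" "p (d x y) = y" using assms unfolding geod_def by auto
  have c: "x \<in> carrier G" "y \<in> carrier G" "p i \<in> carrier G" "p j \<in> carrier G"
    using geod_closed[OF assms(1)] assms(2,3) by simp_all
  have "d x (p i) \<le> i" "d (p i) (p j) \<le> j - i" "d (p j) y \<le> d x y - j"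
    using path_dist[OF p(1), of 0 i] path_dist[OF p(1), of i j] path_dist[OF p(1), of j "d x y"]
      p(2,3) assms(2,3) by simp_all
  moreover have "d x y \<le> d x (p i) + d (p i) y" "d (p i) y \<le> d (p i) (p j) + d (p j) y"
    using d_triangle c by auto
  ultimately show ?thesis using assms by linarith
qed

lemma path_concat:
  assumes "path u m" "path v n" "u m = v 0"
  shows "path (\<lambda>i. if i < m then u i else v (i - m)) (m + n)"
  unfolding path_def
proof (intro conjI allI impI)
  show "(if 0 < m then u 0 else v (0 - m)) \<in> carrier G" using assms unfolding path_def by auto
  fix j assume j: "j < m + n"
  show "\<exists>s\<in>letters. (if Suc j < m then u (Suc j) else v (Suc j - m)) = (if j < m then u j else v (j - m)) \<otimes> s"
  proof (cases "j < m")
    case True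
    then have "(if Suc j < m then u (Suc j) else v (Suc j - m)) = u (Suc j)"
      using assms(3) by (cases "Suc j = m") auto
    then show ?thesis using True assms(1) unfolding path_def by auto
  next
    case False
    then show ?thesis using j assms(2) unfolding path_def by (auto simp: Suc_diff_le)
  qed
qed

text \<open>A discrete form of Manning's bottleneck property: every path from x to y comes within D
  of each point of the chain \<open>m\<close>. The chain need not be a geodesic.\<close>

definition bottlenecks :: "nat \<Rightarrow> 'a \<Rightarrow> 'a \<Rightarrow> (nat \<Rightarrow> 'a) \<Rightarrow> nat \<Rightarrow> bool" where
  "bottlenecks D x y m N \<longleftrightarrow> m 0 = x \<and> m N = y \<and> (\<forall>i\<le>N. m i \<in> carrier G) \<and>
     (\<forall>i<N. d (m i) (m (Suc i)) \<le> 1) \<and>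
     (\<forall>w n. path w n \<longrightarrow> w 0 = x \<longrightarrow> w n = y \<longrightarrow> (\<forall>i\<le>N. \<exists>j\<le>n. d (m i) (w j) \<le> D))"

text \<open>Every point of a geodesic is close to the chain and hence to every path with the same
  ends. Applied to the concatenation of the other two sides of a triangle this gives slim triangles;
  the four-point condition follows by comparing Gromov products with distances to geodesics.\<close>

lemma bottleneck_hyperbolic:
  fixes D :: nat
  assumes D: "\<And>x y. x \<in> carrier G \<Longrightarrow> y \<in> carrier G \<Longrightarrow> \<exists>m N. bottlenecks D x y m N"
  shows "gromov_hyperbolic (carrier G) (\<lambda>x y. real (d x y))"
proof -
  have thin: "\<exists>j\<le>n. d (p a) (w j) \<le> 4 * D + 1"
    if p: "geod x y p" and a: "a \<le> d x y" and w: "path w n" "w 0 = x" "w n = y" for x y p a w n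
  proof -
    have pp: "path p (d x y)" "p 0 = x" "p (d x y) = y" using p unfolding geod_def by auto
    have c: "x \<in> carrier G" "y \<in> carrier G" using geod_closed[OF p] by auto
    obtain m N where mN: "bottlenecks D x y m N" using D[OF c] by blast
    have m: "m 0 = x" "m N = y" "\<And>i. i \<le> N \<Longrightarrow> m i \<in> carrier G"
      "\<And>i. i < N \<Longrightarrow> d (m i) (m (Suc i)) \<le> 1"
      "\<And>w n i. path w n \<Longrightarrow> w 0 = x \<Longrightarrow> w n = y \<Longrightarrow> i \<le> N \<Longrightarrow> \<exists>j\<le>n. d (m i) (w j) \<le> D"
      using mN unfolding bottlenecks_def by simp_all
    \<comment> \<open>The two ends of the chain are matched with the two ends of the geodesic, so
      that the discrete intermediate value argument reaches every index \<open>a\<close>.\<close>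
    have "\<exists>j\<le>d x y. d (m i) (p j) \<le> D \<and> (i = 0 \<longrightarrow> j = 0) \<and> (i = N \<longrightarrow> j = d x y)" if "i \<le> N" for i
    proof -
      consider "i = 0" "N = 0" | "i = 0" "N \<noteq> 0" | "i = N" "N \<noteq> 0" | "i \<noteq> 0" "i \<noteq> N" by auto
      then show ?thesis
      proof cases
        case 1
        then have "x = y" using m by simp
        then show ?thesis using 1 m pp c by (intro exI[of _ 0]) auto
      next
        case 2
        then show ?thesis using m pp c by (intro exI[of _ 0]) auto
      next
        case 3
        then show ?thesis using m pp c by (intro exI[of _ "d x y"]) auto
      next
        case 4
        then show ?thesis using m(5)[OF pp that] by auto
      qed
    qed
    then obtain j where j: "\<And>i. i \<le> N \<Longrightarrow> j i \<le> d x y \<and> d (m i) (p (j i)) \<le> D"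
      "j 0 = 0" "j N = d x y" by (metis le_refl zero_le)
    have step: "j (Suc i) \<le> j i + (2 * D + 1)" if "i < N" for i
    proof (cases "j i \<le> j (Suc i)")
      case True
      have cc: "p (j i) \<in> carrier G" "p (j (Suc i)) \<in> carrier G" "m i \<in> carrier G" "m (Suc i) \<in> carrier G"
        using path_closed[OF pp(1)] j that m(3) by auto
      have "j (Suc i) - j i = d (p (j i)) (p (j (Suc i)))" using geod_dist[OF p True] j that by simp
      also have "\<dots> \<le> d (p (j i)) (m i) + (d (m i) (m (Suc i)) + d (m (Suc i)) (p (j (Suc i))))"
        using d_triangle cc by (meson add_left_mono le_trans)
      also have "\<dots> \<le> D + (1 + D)"
        using j(1)[of i] j(1)[of "Suc i"] that m(4)[OF that] d_sym cc by (intro add_mono) auto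
      finally show ?thesis by simp
    qed simp
    obtain i where i: "i \<le> N" "a \<le> j i" "j i \<le> a + (2 * D + 1)"
      using discrete_ivt[of j N "d x y" "2 * D + 1" a] j step a by blast
    obtain k where k: "k \<le> n" "d (m i) (w k) \<le> D" using m(5)[OF w i(1)] by blast
    have cc: "p a \<in> carrier G" "p (j i) \<in> carrier G" "m i \<in> carrier G" "w k \<in> carrier G"
      using path_closed[OF pp(1)] path_closed[OF w(1)] k j i a m(3) by auto
    have "d (p a) (w k) \<le> d (p a) (p (j i)) + (d (p (j i)) (m i) + d (m i) (w k))"
      using d_triangle cc by (meson add_left_mono le_trans)
    also have "\<dots> \<le> (2 * D + 1) + (D + D)"
      using geod_dist[OF p i(2)] j i k d_sym cc by (intro add_mono) auto
    finally show ?thesis using k by (intro exI[of _ k]) auto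
  qed
  \<comment> \<open>\<open>2 * D + 1\<close> for the gap between consecutive matched indices, and D
    twice for passing through a chain point.\<close>
  define E where "E = 4 * D + 1"
  have slim: "(\<exists>b\<le>d x z. d (p a) (q b) \<le> E) \<or> (\<exists>b\<le>d z y. d (p a) (r b) \<le> E)"
    if p: "geod x y p" and q: "geod x z q" and r: "geod z y r" and a: "a \<le> d x y" for x y z p q r a
  proof -
    let ?w = "\<lambda>i. if i < d x z then q i else r (i - d x z)"
    have w: "path ?w (d x z + d z y)" using q r unfolding geod_def by (intro path_concat) auto
    have w0: "?w 0 = x" using q r unfolding geod_def by (cases "d x z = 0") auto
    have w1: "?w (d x z + d z y) = y" using r unfolding geod_def by auto
    obtain j where j: "j \<le> d x z + d z y" "d (p a) (?w j) \<le> E"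
      using thin[OF p a w w0 w1] unfolding E_def by blast
    show ?thesis
    proof (cases "j < d x z")
      case True
      then show ?thesis using j by (intro disjI1 exI[of _ j]) auto
    next
      case False
      then show ?thesis using j by (intro disjI2 exI[of _ "j - d x z"]) auto
    qed
  qed
  have point: "d x (p a) + d (p a) y = d x y \<and> p a \<in> carrier G \<and> x \<in> carrier G \<and> y \<in> carrier G"
    if p: "geod x y p" and a: "a \<le> d x y" for x y p a
  proof -
    have pp: "p 0 = x" "p (d x y) = y" using p unfolding geod_def by auto
    show ?thesis using geod_dist[OF p, of 0 a] geod_dist[OF p, of a "d x y"] pp a
        geod_closed[OF p] by simp
  qed
  \<comment> \<open>\<open>far\<close> and \<open>near\<close> say that the Gromov product at
    \<open>w\<close> and the distance from \<open>w\<close> to the geodesic agree up to an additive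
    constant. For \<open>near\<close> the point is taken where the geodesic changes from being close
    to one remaining side to being close to the other.\<close>
  have far: "real (d x w) + d y w - d x y \<le> 2 * real (d (p a) w)"
    if p: "geod x y p" and a: "a \<le> d x y" and w: "w \<in> carrier G" for x y p a w
  proof -
    have c: "d x (p a) + d (p a) y = d x y" "p a \<in> carrier G" "x \<in> carrier G" "y \<in> carrier G"
      using point[OF p a] by auto
    have "d x w \<le> d x (p a) + d (p a) w" "d y w \<le> d (p a) y + d (p a) w"
      using d_triangle[of x "p a" w] d_triangle[of y "p a" w] d_sym[of "p a" y] c w by auto
    then show ?thesis using c by linarith
  qed
  have near: "\<exists>a\<le>d x y. 2 * real (d (p a) w) \<le> real (d x w) + d y w - d x y + 4 * real E + 4"
    if p: "geod x y p" and w: "w \<in> carrier G" for x y p w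
  proof -
    have c: "x \<in> carrier G" "y \<in> carrier G" using point[OF p, of 0] by auto
    obtain q where q: "geod x w q" using ex_geod[OF c(1) w] .
    obtain r where r: "geod w y r" using ex_geod[OF w c(2)] .
    define A where "A a \<longleftrightarrow> (\<exists>b\<le>d x w. d (p a) (q b) \<le> E)" for a
    define B where "B a \<longleftrightarrow> (\<exists>b\<le>d w y. d (p a) (r b) \<le> E)" for a
    have AB: "A a \<or> B a" if "a \<le> d x y" for a
      using slim[OF p q r that] unfolding A_def B_def .
    have A0: "A 0" using p q c unfolding A_def geod_def by (intro exI[of _ 0]) auto
    have Bn: "B (d x y)" using p r c unfolding B_def geod_def by (intro exI[of _ "d w y"]) auto
    define b where "b = (LEAST b. B b)"
    have b: "B b" "b \<le> d x y" using Bn unfolding b_def by (auto intro: LeastI Least_le)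
    define a where "a = b - 1"
    have a: "a \<le> d x y" "b \<le> a + 1" "a \<le> b" using b unfolding a_def by auto
    have Aa: "A a"
    proof (cases b)
      case 0
      then show ?thesis using A0 a_def by simp
    next
      case (Suc b')
      have "\<not> B b'" using Suc not_less_Least[of b' B] unfolding b_def by auto
      then show ?thesis using AB[of b'] Suc b a_def by auto
    qed
    obtain s where s: "s \<le> d x w" "d (p a) (q s) \<le> E" using Aa unfolding A_def by blast
    obtain t where t: "t \<le> d w y" "d (p b) (r t) \<le> E" using b(1) unfolding B_def by blast
    have ca: "p a \<in> carrier G" "p b \<in> carrier G" "d x (p a) + d (p a) y = d x y"
      using point[OF p] a b by auto
    have cs: "q s \<in> carrier G" "d x (q s) + d (q s) w = d x w" using point[OF q s(1)] by auto
    have ct: "r t \<in> carrier G" "d w (r t) + d (r t) y = d w y" using point[OF r t(1)] by auto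
    have ab: "d (p a) (p b) \<le> 1" using geod_dist[OF p a(3) b(2)] a by simp
    have 1: "d x (p a) \<le> d x (q s) + E" "d (p a) w \<le> E + d (q s) w"
      using d_triangle[of x "q s" "p a"] d_triangle[of "p a" "q s" w] d_sym[of "q s" "p a"] s c ca cs w
      by auto
    have tt: "d (p a) (r t) \<le> E + 1"
      using d_triangle[of "p a" "p b" "r t"] ab t ca ct by auto
    have 2: "d (p a) y \<le> E + 1 + d (r t) y" "d (p a) w \<le> E + 1 + d w (r t)"
      using d_triangle[of "p a" "r t" y] d_triangle[of "p a" "r t" w] d_sym[of "r t" w] tt c ca ct w
      by auto
    have yw: "d y w = d w y" using d_sym c w by simp
    have "2 * d (p a) w + d x y \<le> d x w + d y w + 4 * E + 4"
    proof -
      have "d x (p a) + d (p a) w \<le> 2 * E + d x w" using 1 cs(2) by linarith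
      moreover have "d (p a) y + d (p a) w \<le> 2 * E + 2 + d w y" using 2 ct(2) by linarith
      ultimately show ?thesis using ca(3) yw by linarith
    qed
    then show ?thesis using a(1) by (intro exI[of _ a]) linarith
  qed
  show ?thesis
    unfolding gromov_hyperbolic_def
  proof (intro exI[of _ "3 * real E + 2"] ballI)
    fix x y z w assume c: "x \<in> carrier G" "y \<in> carrier G" "z \<in> carrier G" "w \<in> carrier G"
    obtain p where p: "geod x y p" using ex_geod c by blast
    obtain q where q: "geod x z q" using ex_geod c by blast
    obtain r where r: "geod z y r" using ex_geod c by blast
    obtain a where a: "a \<le> d x y" "2 * real (d (p a) w) \<le> real (d x w) + d y w - d x y + 4 * real E + 4"
      using near[OF p c(4)] by blast
    have pa: "p a \<in> carrier G" using point[OF p a(1)] by auto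
    have yz: "d y z = d z y" using d_sym c by simp
    from slim[OF p q r a(1)]
    show "min ((real (d x w) + real (d z w) - real (d x z)) / 2)
          ((real (d y w) + real (d z w) - real (d y z)) / 2) - (3 * real E + 2)
         \<le> (real (d x w) + real (d y w) - real (d x y)) / 2"
    proof
      assume "\<exists>b\<le>d x z. d (p a) (q b) \<le> E"
      then obtain b where b: "b \<le> d x z" "d (p a) (q b) \<le> E" by blast
      have qb: "q b \<in> carrier G" using point[OF q b(1)] by auto
      have "d (q b) w \<le> E + d (p a) w"
        using d_triangle[of "q b" "p a" w] d_sym[of "q b" "p a"] b qb pa c by simp
      then have "real (d x w) + d z w - d x z \<le> 2 * real E + 2 * real (d (p a) w)"
        using far[OF q b(1) c(4)] by linarith
      then have "(real (d x w) + d z w - d x z) / 2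
          \<le> (real (d x w) + d y w - d x y) / 2 + (3 * real E + 2)"
        using a(2) by (simp add: field_simps)
      then show ?thesis by linarith
    next
      assume "\<exists>b\<le>d z y. d (p a) (r b) \<le> E"
      then obtain b where b: "b \<le> d z y" "d (p a) (r b) \<le> E" by blast
      have rb: "r b \<in> carrier G" using point[OF r b(1)] by auto
      have "d (r b) w \<le> E + d (p a) w"
        using d_triangle[of "r b" "p a" w] d_sym[of "r b" "p a"] b rb pa c by simp
      then have "real (d z w) + d y w - d z y \<le> 2 * real E + 2 * real (d (p a) w)"
        using far[OF r b(1) c(4)] by linarith
      then have "(real (d y w) + d z w - d y z) / 2
          \<le> (real (d x w) + d y w - d x y) / 2 + (3 * real E + 2)"
        using a(2) yz by (simp add: field_simps)
      then show ?thesis by linarith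
    qed
  qed
qed

end

section \<open>Axes of nested half-spaces\<close>

context group begin

definition translate :: "'a \<Rightarrow> 'a set \<Rightarrow> 'a set" where
  "translate f E = {x \<in> carrier G. inv f \<otimes> x \<in> E}"

lemma translate_translate:
  assumes "f \<in> carrier G" "h \<in> carrier G"
  shows "translate f (translate h E) = translate (f \<otimes> h) E"
  using assms by (auto simp: translate_def inv_mult_group m_assoc)

lemma mem_translate_mult:
  assumes "f \<in> carrier G" "x \<in> carrier G"
  shows "f \<otimes> x \<in> translate f E \<longleftrightarrow> x \<in> E"
  using assms by (simp add: translate_def m_assoc[symmetric])

lemma translate_one: "E \<subseteq> carrier G \<Longrightarrow> translate \<one> E = E"
  by (auto simp: translate_def)

lemma translate_mono: "D \<subseteq> E \<Longrightarrow> translate f D \<subseteq> translate f E"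
  by (auto simp: translate_def)

end

text \<open>\<open>E\<close> is a half-space whose wall is crossed by the axis of \<open>g\<close>.
  The last assumption says that a path from the complement of \<open>E\<close> to its N-th translate
  may, up to \<open>C\<close>, be routed through the identity; the gap of N translates leaves room
  for walls that are themselves unbounded.\<close>

locale half_space_axis = generated_group +
  fixes g :: 'a and E :: "'a set" and N :: nat and C :: nat
  assumes finite_S: "finite S"
    and g_carrier [simp]: "g \<in> carrier G"
    and E_carrier: "E \<subseteq> carrier G"
    and shrink: "translate g E \<subset> E"
    and nested: "\<And>f. f \<in> carrier G \<Longrightarrow>
      translate f E \<subseteq> E \<or> E \<subseteq> translate f E \<or> translate f E \<inter> E = {} \<or> translate f E \<union> E = carrier G"
    and finite_separating: "\<And>x y. x \<in> carrier G \<Longrightarrow> y \<in> carrier G \<Longrightarrow>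
      finite {D. (\<exists>f\<in>carrier G. D = translate f E) \<and> (x \<in> D) \<noteq> (y \<in> D)}"
    and bottleneck: "\<And>x y. x \<in> carrier G \<Longrightarrow> y \<in> carrier G \<Longrightarrow> x \<notin> E \<Longrightarrow>
      y \<in> translate (g [^] N) E \<Longrightarrow> d x \<one> + d \<one> y \<le> d x y + C"
begin

abbreviation gp :: "int \<Rightarrow> 'a" where "gp i \<equiv> g [^] i"

definition Ei :: "int \<Rightarrow> 'a set" where "Ei i = translate (gp i) E"

lemma gp_add: "gp (i + j) = gp i \<otimes> gp j"
  by (simp add: int_pow_mult)

lemma gp_neg: "inv (gp i) = gp (- i)"
  by (simp add: int_pow_neg)

lemma gp_closed [simp]: "gp i \<in> carrier G" by simp

lemma gp_1 [simp]: "gp 1 = g" by (simp add: int_pow_1)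

lemma translate_Ei: "translate (gp i) (Ei j) = Ei (i + j)"
  by (simp add: Ei_def translate_translate gp_add)

lemma Ei_0: "Ei 0 = E"
  by (simp add: Ei_def translate_one E_carrier)

lemma mem_Ei: "x \<in> carrier G \<Longrightarrow> gp i \<otimes> x \<in> Ei j \<longleftrightarrow> x \<in> Ei (j - i)"
  using mem_translate_mult[of "gp i" x "Ei (j - i)"] by (simp add: translate_Ei)

lemma Ei_Suc: "Ei (i + 1) \<subseteq> Ei i"
proof -
  have "Ei (i + 1) = translate (gp i) (translate g E)"
    using translate_Ei[of i 1] by (simp add: Ei_def)
  also have "\<dots> \<subseteq> translate (gp i) E" using shrink by (intro translate_mono) auto
  finally show ?thesis by (simp add: Ei_def)
qed

lemma Ei_antimono: "i \<le> j \<Longrightarrow> Ei j \<subseteq> Ei i"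
proof (induction j rule: int_ge_induct)
  case (step j)
  then show ?case using Ei_Suc[of j] by blast
qed simp

lemma Ei_witness:
  obtains e where "e \<in> carrier G" "e \<in> Ei 0" "e \<notin> Ei 1"
proof -
  obtain e where "e \<in> E" "e \<notin> translate g E" using shrink by blast
  then show ?thesis using that[of e] E_carrier Ei_0 by (auto simp: Ei_def)
qed

lemma gp_inj: "gp i = gp j \<Longrightarrow> i = j"
proof (induction i j rule: linorder_wlog)
  case (le i j)
  have 1: "gp (j - i) = \<one>"
    using le.prems gp_add[of j "-i"] gp_add[of i "-i"] by simp
  have "Ei (j - i) = Ei 0" unfolding Ei_def 1 by simp
  show ?case
  proof (rule ccontr)
    assume "i \<noteq> j"
    then have "Ei (j - i) \<subseteq> Ei 1" using le by (intro Ei_antimono) simp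
    then show False using \<open>Ei (j - i) = Ei 0\<close> Ei_witness by auto
  qed
qed auto

lemma infinite_order_g: "infinite_order G g"
  unfolding infinite_order_def
proof (intro allI impI notI)
  fix n :: nat assume "n > 0" "g [^] n = \<one>"
  then have "gp (int n) = gp 0" by (simp add: int_pow_int)
  then show False using gp_inj \<open>n > 0\<close> by fastforce
qed

lemma d_gp: "d (gp i) (gp j) = d \<one> (gp (j - i))"
  using d_one[of "gp i" "gp j"] by (simp add: gp_neg gp_add[symmetric])

lemma pow_bound: "\<exists>K\<ge>0. \<forall>k. d \<one> (gp k) \<le> R \<longrightarrow> \<bar>k\<bar> \<le> K"
proof -
  have "finite (gp ` {k. d \<one> (gp k) \<le> R})"
    by (rule finite_subset[OF _ finite_ball[OF finite_S, of \<one> R]]) auto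
  moreover have "inj_on gp {k. d \<one> (gp k) \<le> R}" using gp_inj by (auto simp: inj_on_def)
  ultimately have fin: "finite {k. d \<one> (gp k) \<le> R}" using finite_imageD by blast
  have "\<bar>k\<bar> \<le> Max (insert 0 (abs ` {k. d \<one> (gp k) \<le> R}))" if "d \<one> (gp k) \<le> R" for k
    using that fin by (intro Max_ge) auto
  moreover have "0 \<le> Max (insert 0 (abs ` {k. d \<one> (gp k) \<le> R}))" using fin by (intro Max_ge) auto
  ultimately show ?thesis by blast
qed

lemma bottleneck_i:
  assumes "x \<in> carrier G" "y \<in> carrier G" "x \<notin> Ei i" "y \<in> Ei (i + int N)"
  shows "d x (gp i) + d (gp i) y \<le> d x y + C"
proof -
  let ?x = "gp (-i) \<otimes> x" and ?y = "gp (-i) \<otimes> y"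
  have c: "?x \<in> carrier G" "?y \<in> carrier G" using assms by auto
  have "?x \<notin> E" using assms mem_Ei[of x "-i" 0] by (simp add: Ei_0)
  moreover have "?y \<in> translate (g [^] N) E"
    using assms mem_Ei[of y "-i" "int N"] by (simp add: Ei_def int_pow_int add.commute)
  ultimately have "d ?x \<one> + d \<one> ?y \<le> d ?x ?y + C" using bottleneck c by blast
  moreover have "d ?x \<one> = d x (gp i)" "d \<one> ?y = d (gp i) y" "d ?x ?y = d x y"
    using d_translate[of "gp (-i)"] assms(1,2) gp_add[of "-i" i, symmetric]
    by (metis add.left_inverse gp_closed int_pow_0)+
  ultimately show ?thesis by simp
qed

lemma no_bounded_ray:
  assumes "x \<in> carrier G" "infinite A"
  shows "\<exists>i\<in>A. d x (gp i) > R"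
proof (rule ccontr)
  assume "\<not> ?thesis"
  then have "gp ` A \<subseteq> {y \<in> carrier G. d x y \<le> R}" by auto
  then have "finite (gp ` A)" using finite_ball[OF finite_S assms(1)] finite_subset by blast
  moreover have "inj_on gp A" using gp_inj by (auto simp: inj_on_def)
  ultimately show False using assms finite_imageD by blast
qed

text \<open>A point in all translates would make each far translate a bottleneck between it and a
  fixed outside point, so infinitely many powers of \<open>g\<close> would lie in one finite ball.
  The mirrored argument gives \<open>ex_in_Ei\<close>.\<close>

lemma ex_notin_Ei:
  assumes x: "x \<in> carrier G"
  shows "\<exists>i. x \<notin> Ei i"
proof (rule ccontr)
  assume "\<not> ?thesis"
  then have all: "x \<in> Ei i" for i by blast
  obtain z where z: "z \<in> carrier G" "z \<notin> Ei 1" using Ei_witness .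
  have "d z (gp i) \<le> d z x + C" if "i \<ge> 1" for i
  proof -
    have "z \<notin> Ei i" using z Ei_antimono[OF that] by blast
    then show ?thesis using bottleneck_i[OF z(1) x _ all] by fastforce
  qed
  moreover obtain i where "i \<in> {1..}" "d z (gp i) > d z x + C"
    using no_bounded_ray[OF z(1) infinite_Ici] by blast
  ultimately show False by force
qed

lemma ex_in_Ei:
  assumes x: "x \<in> carrier G"
  shows "\<exists>i. x \<in> Ei i"
proof (rule ccontr)
  assume "\<not> ?thesis"
  then have all: "x \<notin> Ei i" for i by blast
  obtain z where z: "z \<in> carrier G" "z \<in> Ei 0" using Ei_witness .
  have "d x (gp i) \<le> d x z + C" if "i \<le> - int N" for i
  proof -
    have "z \<in> Ei (i + int N)" using z Ei_antimono[of "i + int N" 0] that by auto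
    then show ?thesis using bottleneck_i[OF x z(1) all] by fastforce
  qed
  moreover obtain i where "i \<in> {..- int N}" "d x (gp i) > d x z + C"
    using no_bounded_ray[OF x infinite_Iic] by blast
  ultimately show False by force
qed

section \<open>Height of a point along the axis\<close>

definition phi :: "'a \<Rightarrow> int" where "phi x = (SOME i. x \<in> Ei i \<and> x \<notin> Ei (i + 1))"

text \<open>The translates form a decreasing chain with empty intersection that exhausts the group,
  so each point has a well-defined height. This height replaces the nearest point projection to the
  axis.\<close>

lemma mem_Ei_iff:
  assumes x: "x \<in> carrier G"
  shows "x \<in> Ei i \<longleftrightarrow> i \<le> phi x"
proof -
  obtain i0 where i0: "x \<in> Ei i0" using ex_in_Ei[OF x] ..
  obtain j where j: "x \<notin> Ei j" using ex_notin_Ei[OF x] ..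
  have "\<exists>i. x \<in> Ei i \<and> x \<notin> Ei (i + 1)"
  proof (rule ccontr)
    assume *: "\<not> ?thesis"
    have up: "x \<in> Ei i" if "i0 \<le> i" for i using that
    proof (induction i rule: int_ge_induct)
      case base
      show ?case by (rule i0)
    next
      case (step i)
      then show ?case using * by blast
    qed
    have "i0 \<le> j"
    proof (rule ccontr)
      assume "\<not> i0 \<le> j"
      then show False using i0 j Ei_antimono[of j i0] by auto
    qed
    then show False using j up by blast
  qed
  from someI_ex[OF this] have p: "x \<in> Ei (phi x)" "x \<notin> Ei (phi x + 1)" unfolding phi_def by auto
  show ?thesis
  proof (cases "i \<le> phi x")
    case True
    then show ?thesis using p Ei_antimono[OF True] by blast
  next
    case False
    then have "phi x + 1 \<le> i" by simp
    then show ?thesis using p Ei_antimono False by blast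
  qed
qed

lemma phi_translate: "x \<in> carrier G \<Longrightarrow> phi (gp k \<otimes> x) = k + phi x"
proof -
  assume x: "x \<in> carrier G"
  have "i \<le> phi (gp k \<otimes> x) \<longleftrightarrow> i \<le> k + phi x" for i
    using mem_Ei_iff[of "gp k \<otimes> x" i] mem_Ei[of x k i] mem_Ei_iff[of x "i - k"] x by auto
  from this[of "phi (gp k \<otimes> x)"] this[of "k + phi x"] show ?thesis by simp
qed

lemma phi_gp: "phi (gp k) = k + phi \<one>"
  using phi_translate[of \<one> k] by simp

lemma phi_bottleneck:
  assumes "x \<in> carrier G" "y \<in> carrier G" "phi x < i" "i + int N \<le> phi y"
  shows "d x (gp i) + d (gp i) y \<le> d x y + C"
  using bottleneck_i[of x y i] assms mem_Ei_iff[of x i] mem_Ei_iff[of y "i + int N"] by simp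

text \<open>If the heights of two close points differed much, the first and the last bottleneck
  between them would both put a power of \<open>g\<close> within \<open>r + C\<close> of x, although
  the two exponents are far apart.\<close>

lemma phi_lipschitz:
  "\<exists>L\<ge>0. \<forall>x\<in>carrier G. \<forall>y\<in>carrier G. d x y \<le> r \<longrightarrow> \<bar>phi x - phi y\<bar> \<le> L"
proof -
  obtain K where K: "K \<ge> 0" "\<And>k. d \<one> (gp k) \<le> 2 * (r + C) \<Longrightarrow> \<bar>k\<bar> \<le> K"
    using pow_bound by blast
  have le: "phi y - phi x \<le> K + int N + 1"
    if c: "x \<in> carrier G" "y \<in> carrier G" and r: "d x y \<le> r" for x y
  proof (rule ccontr)
    assume "\<not> ?thesis"
    then have big: "phi y - phi x > K + int N + 1" by simp
    let ?i = "phi x + 1" and ?j = "phi y - int N"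
    have "d x (gp ?i) \<le> r + C" "d x (gp ?j) \<le> r + C"
      using phi_bottleneck[OF c, of ?i] phi_bottleneck[OF c, of ?j] K(1) big r by auto
    then have "d (gp ?i) (gp ?j) \<le> 2 * (r + C)"
      using d_triangle[of "gp ?i" x "gp ?j"] d_sym[of x "gp ?i"] c by auto
    then have "\<bar>?j - ?i\<bar> \<le> K" using K(2) d_gp by metis
    then show False using big by linarith
  qed
  show ?thesis
  proof (intro exI[of _ "K + int N + 1"] conjI ballI impI)
    fix x y assume c: "x \<in> carrier G" "y \<in> carrier G" and r: "d x y \<le> r"
    show "\<bar>phi x - phi y\<bar> \<le> K + int N + 1"
      using le[OF c r] le[of y x] d_sym[of x y] c r by auto
  qed (use K in simp)
qed

section \<open>Strong contraction\<close>

abbreviation axis :: "'a set" where "axis \<equiv> generate G {g}"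

lemma axis_eq: "axis = range gp"
  using generate_pow[OF g_carrier] by auto

lemma set_dist_le: "set_dist G S x axis \<le> d x (gp i)"
  unfolding set_dist_def by (rule cInf_lower) (auto simp: axis_eq)

text \<open>Projections are read off from heights. A nearest point of the axis has an exponent close
  to the height of x, since otherwise a bottleneck at that height would be nearer. If x' is no
  further from x than the axis is, its height is close to that of x, since otherwise the bottleneck
  on the way would lie within \<open>C\<close> of x'.\<close>

lemma strongly_contracting_axis: "strongly_contracting G S axis"
proof -
  obtain K where K: "K \<ge> 0" "\<And>k. d \<one> (gp k) \<le> C \<Longrightarrow> \<bar>k\<bar> \<le> K"
    using pow_bound by blast
  obtain L where L: "L \<ge> 0" "\<And>x y. x \<in> carrier G \<Longrightarrow> y \<in> carrier G \<Longrightarrow> d x y \<le> C \<Longrightarrow> \<bar>phi x - phi y\<bar> \<le> L"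
    using phi_lipschitz[of C] by blast
  \<comment> \<open>\<open>K\<close> bounds the exponents of powers within \<open>C\<close> of the
    identity, \<open>N\<close> is the width of a bottleneck, and the last term converts exponents to
    heights.\<close>
  define Q where "Q = K + int N + 1 + \<bar>phi \<one>\<bar>"
  have proj: "\<bar>k - phi x\<bar> \<le> Q"
    if x: "x \<in> carrier G" and k: "gp k \<in> closest_proj G S axis x" for x k
  proof -
    have min: "d x (gp k) \<le> d x (gp i)" for i
      using k set_dist_le[of x i] unfolding closest_proj_def by simp
    have kx: "d (gp k) x = d x (gp k)" "d (gp i) x = d x (gp i)" for i
      using d_sym x by auto
    show ?thesis
    proof (rule ccontr)
      assume "\<not> ?thesis"
      then consider "k - phi x > Q" | "phi x - k > Q" by linarith
      then show False
      proof cases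
        case 1
        let ?i = "phi x + 1"
        have "d x (gp ?i) + d (gp ?i) (gp k) \<le> d x (gp k) + C"
          using 1 K unfolding Q_def by (intro phi_bottleneck) (auto simp: x phi_gp)
        then have "d (gp ?i) (gp k) \<le> C" using min[of ?i] by simp
        then have "\<bar>k - ?i\<bar> \<le> K" using K(2) d_gp by metis
        then show False using 1 unfolding Q_def by linarith
      next
        case 2
        let ?i = "phi x - int N"
        have "d (gp k) (gp ?i) + d (gp ?i) x \<le> d (gp k) x + C"
          using 2 K unfolding Q_def by (intro phi_bottleneck) (auto simp: x phi_gp)
        then have "d (gp k) (gp ?i) \<le> C" using min[of ?i] kx by simp
        then have "\<bar>?i - k\<bar> \<le> K" using K(2) d_gp by metis
        then show False using 2 unfolding Q_def by linarith
      qed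
    qed
  qed
  define Q' where "Q' = L + int N + 1 + \<bar>phi \<one>\<bar>"
  have close: "\<bar>phi x - phi x'\<bar> \<le> Q'"
    if c: "x \<in> carrier G" "x' \<in> carrier G" and le: "d x x' \<le> set_dist G S x axis" for x x'
  proof -
    have min: "d x x' \<le> d x (gp i)" for i using le set_dist_le[of x i] by simp
    have xx: "d x' x = d x x'" "d (gp i) x = d x (gp i)" "d x' (gp i) = d (gp i) x'" for i
      using d_sym c by auto
    show ?thesis
    proof (rule ccontr)
      assume "\<not> ?thesis"
      then consider "phi x' - phi x > Q'" | "phi x - phi x' > Q'" by linarith
      then show False
      proof cases
        case 1
        let ?i = "phi x + 1"
        have "d x (gp ?i) + d (gp ?i) x' \<le> d x x' + C"
          using 1 L unfolding Q'_def by (intro phi_bottleneck) (auto simp: c)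
        then have "d (gp ?i) x' \<le> C" using min[of ?i] by simp
        then have "\<bar>phi (gp ?i) - phi x'\<bar> \<le> L" using L(2) c by simp
        then show False using 1 unfolding Q'_def phi_gp by linarith
      next
        case 2
        let ?i = "phi x - int N"
        have "d x' (gp ?i) + d (gp ?i) x \<le> d x' x + C"
          using 2 L unfolding Q'_def by (intro phi_bottleneck) (auto simp: c)
        then have "d (gp ?i) x' \<le> C" using min[of ?i] xx by simp
        then have "\<bar>phi (gp ?i) - phi x'\<bar> \<le> L" using L(2) c by simp
        then show False using 2 unfolding Q'_def phi_gp by linarith
      qed
    qed
  qed
  define M where "M = 2 * Q + Q'"
  define B where "B = Max ((\<lambda>k. d \<one> (gp k)) ` {-M..M})"
  have B: "d (gp k) (gp l) \<le> B" if "\<bar>k - l\<bar> \<le> M" for k l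
  proof -
    have "l - k \<in> {-M..M}" using that by auto
    then show ?thesis unfolding B_def d_gp by (intro Max_ge imageI) auto
  qed
  show ?thesis
    unfolding strongly_contracting_def
  proof (intro exI[of _ "real B"] ballI impI)
    fix x x' a b
    assume c: "x \<in> carrier G" "x' \<in> carrier G" and le: "d x x' \<le> set_dist G S x axis"
      and a: "a \<in> closest_proj G S axis x \<union> closest_proj G S axis x'"
      and b: "b \<in> closest_proj G S axis x \<union> closest_proj G S axis x'"
    obtain k l where kl: "a = gp k" "b = gp l"
      using a b unfolding closest_proj_def axis_eq by auto
    have "\<bar>k - phi x\<bar> \<le> Q \<or> \<bar>k - phi x'\<bar> \<le> Q" "\<bar>l - phi x\<bar> \<le> Q \<or> \<bar>l - phi x'\<bar> \<le> Q"
      using a b proj c unfolding kl by blast+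
    then have "\<bar>k - l\<bar> \<le> M" using close[OF c le] unfolding M_def by linarith
    then show "real (d a b) \<le> real B" using B kl by simp
  qed
qed

end

section \<open>The commensurator and the elementary closure\<close>

lemma (in group) conj_int_pow:
  assumes "k \<in> carrier G" "h \<in> carrier G"
  shows "(k \<otimes> h \<otimes> inv k) [^] (i::int) = k \<otimes> h [^] i \<otimes> inv k"
proof -
  have nat: "(k \<otimes> h \<otimes> inv k) [^] n = k \<otimes> h [^] n \<otimes> inv k" for n :: nat
  proof (induction n)
    case (Suc n)
    have "k \<otimes> h [^] n \<otimes> inv k \<otimes> (k \<otimes> h \<otimes> inv k) = k \<otimes> h [^] n \<otimes> (inv k \<otimes> k) \<otimes> h \<otimes> inv k"
      using assms by (simp only: m_assoc m_closed inv_closed nat_pow_closed)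
    then show ?case using Suc assms by (simp add: m_assoc)
  qed (use assms in simp)
  have "inv (k \<otimes> h [^] n \<otimes> inv k) = k \<otimes> inv (h [^] n) \<otimes> inv k" for n :: nat
    using assms by (simp add: inv_mult_group m_assoc)
  then show ?thesis by (simp only: int_pow_def2 nat split: if_split) simp
qed

context half_space_axis begin

text \<open>A point almost between two powers of \<open>g\<close> either has a height well between
  theirs, and is squeezed between two neighbouring bottlenecks, or lies near or beyond one end, and
  then a bottleneck just inside that end is close to it. The bound is uniform in the two powers, as
  the commensurator requires.\<close>

lemma near_axis:
  "\<exists>D. \<forall>s t. \<forall>z\<in>carrier G.
     d (gp s) z + d z (gp t) \<le> d (gp s) (gp t) + C \<longrightarrow> (\<exists>m. d (gp m) z \<le> D)"
proof -
  define a where "a = phi \<one>"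
  define n where "n = int N"
  define B where "B = Max ((\<lambda>k. d \<one> (gp k)) ` {-(2 * n + 1) - \<bar>a\<bar>..2 * n + 1 + \<bar>a\<bar>})"
  have B: "d (gp k) (gp l) \<le> B" if "\<bar>k - l\<bar> \<le> 2 * n + 1 + \<bar>a\<bar>" for k l
  proof -
    have "l - k \<in> {-(2 * n + 1) - \<bar>a\<bar>..2 * n + 1 + \<bar>a\<bar>}" using that by auto
    then show ?thesis unfolding B_def d_gp by (intro Max_ge imageI) auto
  qed
  have main: "\<exists>m. d (gp m) z \<le> B + 3 * C"
    if z: "z \<in> carrier G" and le: "d (gp s) z + d z (gp t) \<le> d (gp s) (gp t) + C" and st: "s \<le> t"
    for s t z
  proof (cases "t - s \<le> 2 * n + 1")
    case True
    then have "d (gp s) (gp t) \<le> B" using st by (intro B) auto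
    then show ?thesis using le by (intro exI[of _ s]) linarith
  next
    case False
    note sym = d_sym[of z "gp _", OF z gp_closed]
    consider "s + a < phi z - n" "phi z + 1 + n \<le> t + a" | "t + a - n \<le> phi z"
      | "phi z \<le> s + a + n" by linarith
    then show ?thesis
    proof cases
      case 1
      let ?i = "phi z - n" and ?j = "phi z + 1"
      have "d (gp s) (gp ?i) + d (gp ?i) z \<le> d (gp s) z + C"
        using 1 z by (intro phi_bottleneck) (auto simp: phi_gp a_def n_def)
      moreover have "d z (gp ?j) + d (gp ?j) (gp t) \<le> d z (gp t) + C"
        using 1 z by (intro phi_bottleneck) (auto simp: phi_gp a_def n_def)
      moreover have "d (gp s) (gp t) \<le> d (gp s) (gp ?i) + (d (gp ?i) (gp ?j) + d (gp ?j) (gp t))"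
        using d_triangle by (meson add_left_mono gp_closed le_trans)
      moreover have "d (gp ?i) (gp ?j) \<le> B" by (rule B) (simp add: n_def)
      ultimately have "d (gp ?i) z \<le> B + 3 * C" using le by linarith
      then show ?thesis by blast
    next
      case 2
      let ?l = "t + a - 2 * n"
      have "d (gp s) (gp ?l) + d (gp ?l) z \<le> d (gp s) z + C"
        using 2 False z by (intro phi_bottleneck) (auto simp: phi_gp a_def n_def)
      moreover have "d (gp ?l) (gp t) \<le> B" by (rule B) (simp add: n_def)
      moreover have "d (gp s) (gp t) \<le> d (gp s) (gp ?l) + d (gp ?l) (gp t)"
        by (intro d_triangle) auto
      ultimately have "d (gp ?l) z \<le> B + 3 * C" using le by linarith
      then show ?thesis by blast
    next
      case 3
      let ?l = "s + a + n + 1"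
      have "d z (gp ?l) + d (gp ?l) (gp t) \<le> d z (gp t) + C"
        using 3 False z by (intro phi_bottleneck) (auto simp: phi_gp a_def n_def)
      moreover have "d (gp s) (gp ?l) \<le> B" by (rule B) (simp add: n_def)
      moreover have "d (gp s) (gp t) \<le> d (gp s) (gp ?l) + d (gp ?l) (gp t)"
        by (intro d_triangle) auto
      ultimately have "d z (gp ?l) \<le> B + 3 * C" using le by linarith
      then show ?thesis using sym by metis
    qed
  qed
  show ?thesis
  proof (intro exI[of _ "B + 3 * C"] allI ballI impI)
    fix s t z assume z: "z \<in> carrier G" and le: "d (gp s) z + d z (gp t) \<le> d (gp s) (gp t) + C"
    show "\<exists>m. d (gp m) z \<le> B + 3 * C"
    proof (cases "s \<le> t")
      case True
      then show ?thesis using main[OF z le] by simp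
    next
      case False
      have "d (gp t) z + d z (gp s) \<le> d (gp t) (gp s) + C"
        using le d_sym[OF z gp_closed] d_sym[OF gp_closed gp_closed] by (metis add.commute)
      then show ?thesis using main[OF z, of t s] False by simp
    qed
  qed
qed

text \<open>The commensurator of the cyclic group of \<open>g\<close>, written as an intertwining
  relation so that it can be multiplied up to common exponents.\<close>

definition Comm :: "'a set" where
  "Comm = {k \<in> carrier G. \<exists>p q. p \<noteq> 0 \<and> q \<noteq> 0 \<and> k \<otimes> gp p = gp q \<otimes> k}"

lemma conj_pow:
  assumes "k \<in> carrier G" "k \<otimes> gp p = gp q \<otimes> k"
  shows "k \<otimes> gp (p * j) = gp (q * j) \<otimes> k"
proof -
  have 1: "k \<otimes> gp (p * int m) = gp (q * int m) \<otimes> k" for m :: nat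
  proof (induction m)
    case (Suc m)
    have "k \<otimes> gp (p * int (Suc m)) = (k \<otimes> gp p) \<otimes> gp (p * int m)"
      using assms(1) by (simp add: m_assoc gp_add[symmetric] algebra_simps)
    also have "\<dots> = gp q \<otimes> (k \<otimes> gp (p * int m))" using assms by (simp add: m_assoc)
    also have "\<dots> = gp (q * int (Suc m)) \<otimes> k"
      unfolding Suc using assms(1) by (simp add: m_assoc[symmetric] gp_add[symmetric] algebra_simps)
    finally show ?case .
  qed (use assms in simp)
  show ?thesis
  proof (cases "j \<ge> 0")
    case True
    then show ?thesis using 1[of "nat j"] by simp
  next
    case False
    define m where "m = nat (- j)"
    have j: "j = - int m" using False by (simp add: m_def)
    have "gp (q * j) \<otimes> k = gp (q * j) \<otimes> (k \<otimes> gp (p * int m)) \<otimes> gp (p * j)"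
      using assms(1) by (simp add: m_assoc gp_add[symmetric] j)
    also have "\<dots> = gp (q * j) \<otimes> (gp (q * int m) \<otimes> k) \<otimes> gp (p * j)" by (simp add: 1)
    also have "\<dots> = k \<otimes> gp (p * j)"
      using assms(1) by (simp add: m_assoc[symmetric] gp_add[symmetric] j)
    finally show ?thesis by simp
  qed
qed

lemma Comm_inv:
  assumes k: "k \<in> carrier G" and eq: "k \<otimes> gp p = gp q \<otimes> k"
  shows "inv k \<otimes> gp q = gp p \<otimes> inv k"
proof -
  have "inv k \<otimes> gp q = inv k \<otimes> (gp q \<otimes> k) \<otimes> inv k" using k by (simp add: m_assoc)
  also have "\<dots> = inv k \<otimes> (k \<otimes> gp p) \<otimes> inv k" by (simp add: eq)
  also have "\<dots> = gp p \<otimes> inv k" using k by (simp add: m_assoc[symmetric])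
  finally show ?thesis .
qed

lemma Comm_carrier: "Comm \<subseteq> carrier G" by (auto simp: Comm_def)

lemma g_Comm: "gp i \<in> Comm"
proof -
  have "gp i \<otimes> gp 1 = gp 1 \<otimes> gp i" by (simp only: gp_add[symmetric] add.commute)
  then show ?thesis unfolding Comm_def using gp_closed
    by (intro CollectI conjI exI[of _ 1]) auto
qed

lemma subgroup_Comm: "subgroup Comm G"
proof (rule subgroupI)
  show "Comm \<subseteq> carrier G" by (rule Comm_carrier)
  show "Comm \<noteq> {}" using g_Comm by auto
next
  fix k assume "k \<in> Comm"
  then obtain p q where "k \<in> carrier G" "p \<noteq> 0" "q \<noteq> 0" "k \<otimes> gp p = gp q \<otimes> k"
    unfolding Comm_def by blast
  then show "inv k \<in> Comm" using Comm_inv[of k p q] unfolding Comm_def by auto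
next
  fix k h assume "k \<in> Comm" "h \<in> Comm"
  then obtain p q p' q' where k: "k \<in> carrier G" "p \<noteq> 0" "q \<noteq> 0" "k \<otimes> gp p = gp q \<otimes> k"
    and h: "h \<in> carrier G" "p' \<noteq> 0" "q' \<noteq> 0" "h \<otimes> gp p' = gp q' \<otimes> h"
    unfolding Comm_def by blast
  have "(k \<otimes> h) \<otimes> gp (p' * p) = k \<otimes> (h \<otimes> gp (p' * p))" using k h by (simp add: m_assoc)
  also have "\<dots> = k \<otimes> (gp (q' * p) \<otimes> h)" using conj_pow[OF h(1,4)] by simp
  also have "\<dots> = (k \<otimes> gp (p * q')) \<otimes> h" using k h by (simp add: m_assoc mult.commute)
  also have "\<dots> = gp (q * q') \<otimes> (k \<otimes> h)"
    using conj_pow[OF k(1,4), of q'] k h by (simp add: m_assoc)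
  finally have "(k \<otimes> h) \<otimes> gp (p' * p) = gp (q * q') \<otimes> (k \<otimes> h)" .
  moreover have "p' * p \<noteq> 0" "q * q' \<noteq> 0" using k h by auto
  ultimately show "k \<otimes> h \<in> Comm" unfolding Comm_def using k(1) h(1) by blast
qed

text \<open>\<open>inv k\<close> carries far powers of \<open>g\<close> to points whose heights run
  off to opposite ends, so the identity is a bottleneck between them. Translated back by k, this
  says that k is almost between two powers of \<open>g\<close>.\<close>

lemma Comm_near_axis:
  "\<exists>D. \<forall>k\<in>Comm. \<exists>m. d (gp m) k \<le> D"
proof -
  obtain D where D: "\<And>s t z. z \<in> carrier G \<Longrightarrow>
    d (gp s) z + d z (gp t) \<le> d (gp s) (gp t) + C \<Longrightarrow> \<exists>m. d (gp m) z \<le> D"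
    using near_axis by blast
  have "\<exists>m. d (gp m) k \<le> D" if k: "k \<in> Comm" for k
  proof -
    obtain p q where kc: "k \<in> carrier G" and pq: "p \<noteq> 0" "q \<noteq> 0" "k \<otimes> gp p = gp q \<otimes> k"
      using k unfolding Comm_def by blast
    have ph: "phi (inv k \<otimes> gp (q * j)) = p * j + phi (inv k)" for j
      using conj_pow[OF inv_closed[OF kc] Comm_inv[OF kc pq(3)]] phi_translate[of "inv k"] kc by simp
    define J where "J = \<bar>phi (inv k)\<bar> + int N + 1"
    \<comment> \<open>The sign makes \<open>p * j\<close> positive, so that the two image points
      have heights on the prescribed sides.\<close>
    define j where "j = sgn p * J"
    have pj: "p * j \<ge> J"
    proof -
      have "p * j = \<bar>p\<bar> * J" by (simp add: j_def abs_sgn mult.assoc)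
      moreover have "1 * J \<le> \<bar>p\<bar> * J" using pq unfolding J_def by (intro mult_right_mono) auto
      ultimately show ?thesis by simp
    qed
    let ?x = "inv k \<otimes> gp (q * - j)" and ?y = "inv k \<otimes> gp (q * j)"
    have "d ?x (gp 0) + d (gp 0) ?y \<le> d ?x ?y + C"
      using pj kc ph[of j] ph[of "- j"] unfolding J_def by (intro phi_bottleneck) auto
    moreover have "d ?x (gp 0) = d (gp (q * - j)) k" "d (gp 0) ?y = d k (gp (q * j))"
      using d_translate[of k ?x "gp 0"] d_translate[of k "gp 0" ?y] kc by (simp_all add: m_assoc[symmetric])
    moreover have "d ?x ?y = d (gp (q * - j)) (gp (q * j))" using kc by (simp add: d_translate)
    ultimately show ?thesis using D kc by metis
  qed
  then show ?thesis by blast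
qed

lemma virtually_cyclic_Comm: "virtually_cyclic G Comm"
proof -
  obtain D where D: "\<And>k. k \<in> Comm \<Longrightarrow> \<exists>m. d (gp m) k \<le> D" using Comm_near_axis by blast
  have "{axis #> k | k. k \<in> Comm} \<subseteq> (\<lambda>b. axis #> b) ` {b \<in> carrier G. d \<one> b \<le> D}"
  proof
    fix W assume "W \<in> {axis #> k | k. k \<in> Comm}"
    then obtain k where k: "W = axis #> k" "k \<in> Comm" by blast
    then have kc: "k \<in> carrier G" using Comm_carrier by blast
    obtain m where m: "d (gp m) k \<le> D" using D k by blast
    let ?b = "gp (- m) \<otimes> k"
    have "d \<one> ?b \<le> D" using m d_one[of "gp m" k] kc by (simp add: gp_neg)
    moreover have "axis #> ?b = axis #> k"
    proof -
      have sg: "subgroup axis G" by (rule generate_is_subgroup) simp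
      have "gp (- m) \<in> axis" by (auto simp: axis_eq)
      then have "axis #> gp (- m) = axis" using coset_join2[OF _ sg] by simp
      moreover have "axis #> gp (- m) #> k = axis #> ?b"
        using coset_mult_assoc[of axis "gp (-m)" k] sg kc subgroup.subset[OF sg] by simp
      ultimately show ?thesis by simp
    qed
    ultimately show "W \<in> (\<lambda>b. axis #> b) ` {b \<in> carrier G. d \<one> b \<le> D}"
      using k kc by (intro image_eqI[of _ _ ?b]) auto
  qed
  then have "finite {axis #> k | k. k \<in> Comm}"
    using finite_ball[OF finite_S one_closed] finite_subset by blast
  then show ?thesis unfolding virtually_cyclic_def using subgroup_Comm g_Comm[of 1] by auto
qed

text \<open>Each element of K has a power with non-zero exponent in the cyclic group of c. Applied
  to \<open>g\<close> and to its conjugate by k, this yields a common power, and the exponents are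
  non-zero because \<open>g\<close> has infinite order.\<close>

lemma virtually_cyclic_subset_Comm:
  assumes "virtually_cyclic G K" "g \<in> K"
  shows "K \<subseteq> Comm"
proof
  fix k assume k: "k \<in> K"
  have sg: "subgroup K G" using assms unfolding virtually_cyclic_def by blast
  obtain c where c: "c \<in> K" "finite {generate G {c} #> k | k. k \<in> K}"
    using assms unfolding virtually_cyclic_def by blast
  have Kc: "K \<subseteq> carrier G" using sg subgroup.subset by blast
  have cc: "c \<in> carrier G" using c Kc by blast
  have sc: "subgroup (generate G {c}) G" using cc by (intro generate_is_subgroup) simp
  have pow: "\<exists>(m::int) (e::int). m \<noteq> 0 \<and> h [^] m = c [^] e" if h: "h \<in> K" for h
  proof -
    have hc: "h \<in> carrier G" using h Kc by blast
    have hp: "h [^] (i::int) \<in> K" for i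
      using subgroup_int_pow_closed[OF sg h] .
    have "finite (range (\<lambda>i::int. generate G {c} #> h [^] i))"
      by (rule finite_subset[OF _ c(2)]) (use hp in auto)
    then have "\<not> inj (\<lambda>i::int. generate G {c} #> h [^] i)"
      using finite_imageD infinite_UNIV_int by blast
    then obtain i j :: int where ij: "i \<noteq> j" "generate G {c} #> h [^] i = generate G {c} #> h [^] j"
      unfolding inj_def by blast
    have "h [^] i \<in> generate G {c} #> h [^] i"
      using rcos_self[OF _ sc] hc by simp
    then have "h [^] i \<in> generate G {c} #> h [^] j" using ij(2) by simp
    then obtain e where e: "e \<in> generate G {c}" "h [^] i = e \<otimes> h [^] j"
      unfolding r_coset_def by auto
    obtain l where l: "e = c [^] (l::int)"
      using e(1) generate_pow[OF cc] by auto
    have "h [^] (i - j) = c [^] l"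
      using hc cc by (simp add: int_pow_diff m_assoc e(2) l)
    then show ?thesis using ij(1) by (intro exI[of _ "i - j"] exI[of _ l]) auto
  qed
  have kc: "k \<in> carrier G" using k Kc by blast
  obtain m e :: int where me: "m \<noteq> 0" "gp m = c [^] e" using pow[OF assms(2)] by blast
  have "k \<otimes> g \<otimes> inv k \<in> K" using k assms(2) sg
    by (simp add: subgroup.m_closed subgroup.m_inv_closed)
  then obtain m' e' :: int where me': "m' \<noteq> 0" "(k \<otimes> g \<otimes> inv k) [^] m' = c [^] e'" using pow by blast
  have cp: "(k \<otimes> g \<otimes> inv k) [^] i = k \<otimes> gp i \<otimes> inv k" for i :: int
    using conj_int_pow[OF kc g_carrier] .
  have "k \<otimes> gp (m' * e) \<otimes> inv k = (k \<otimes> g \<otimes> inv k) [^] (m' * e)" by (simp add: cp)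
  also have "\<dots> = (c [^] e') [^] e" using kc me'(2) by (simp add: int_pow_pow[symmetric])
  also have "\<dots> = (c [^] e) [^] e'" using cc by (simp add: int_pow_pow mult.commute)
  also have "\<dots> = gp (m * e')" using me(2) by (simp add: int_pow_pow[symmetric])
  finally have eq: "k \<otimes> gp (m' * e) \<otimes> inv k = gp (m * e')" .
  have e0: "e \<noteq> 0"
  proof
    assume "e = 0"
    then have "gp m = gp 0" using me by simp
    then show False using gp_inj me by blast
  qed
  have e1: "e' \<noteq> 0"
  proof
    assume "e' = 0"
    then have "k \<otimes> gp m' \<otimes> inv k = \<one>" using me' cp by simp
    moreover have "gp m' = inv k \<otimes> (k \<otimes> gp m' \<otimes> inv k) \<otimes> k"
      using kc by (simp add: m_assoc) (simp add: m_assoc[symmetric])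
    ultimately have "gp m' = gp 0" using kc by simp
    then show False using gp_inj me' by blast
  qed
  have "k \<otimes> gp (m' * e) = gp (m * e') \<otimes> k"
    using eq[symmetric] kc by (simp add: m_assoc)
  then show "k \<in> Comm" unfolding Comm_def using kc me me' e0 e1 by (intro CollectI conjI exI) auto
qed

lemma elementary_closure_eq: "elementary_closure G g = Comm"
proof
  have "\<Union> {K. virtually_cyclic G K \<and> g \<in> K} \<subseteq> Comm"
    using virtually_cyclic_subset_Comm by blast
  then show "elementary_closure G g \<subseteq> Comm"
    unfolding elementary_closure_def using generate_subgroup_incl subgroup_Comm by blast
  have "g \<in> Comm" using g_Comm[of 1] by simp
  then show "Comm \<subseteq> elementary_closure G g"
    unfolding elementary_closure_def using virtually_cyclic_Comm by (auto intro: generate.incl)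
qed

section \<open>Counting separating half-spaces\<close>

definition halves :: "'a set set" where "halves = {translate f E | f. f \<in> carrier G}"

definition sep :: "'a \<Rightarrow> 'a \<Rightarrow> 'a set set" where "sep x y = {D \<in> halves. (x \<in> D) \<noteq> (y \<in> D)}"

definition sigma :: "'a \<Rightarrow> 'a \<Rightarrow> nat" where "sigma x y = card (sep x y)"

lemma halvesE:
  assumes "D \<in> halves"
  obtains f where "f \<in> carrier G" "D = translate f E"
  using assms unfolding halves_def by auto

lemma sep_halves: "D \<in> sep x y \<Longrightarrow> D \<in> halves" by (simp add: sep_def)

lemma finite_sep: "x \<in> carrier G \<Longrightarrow> y \<in> carrier G \<Longrightarrow> finite (sep x y)"
  using finite_separating[of x y]
  by (rule back_subst[of finite]) (auto simp: sep_def halves_def)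

lemma sep_sym: "sep x y = sep y x" by (auto simp: sep_def)

lemma sigma_sym: "sigma x y = sigma y x" by (simp add: sigma_def sep_sym)

lemma sep_self [simp]: "sep x x = {}" by (simp add: sep_def)

lemma sep_triangle: "sep x z \<subseteq> sep x y \<union> sep y z" by (auto simp: sep_def)

lemma halves_nested:
  assumes "D \<in> halves" "D' \<in> halves"
  shows "D \<subseteq> D' \<or> D' \<subseteq> D \<or> D \<inter> D' = {} \<or> D \<union> D' = carrier G"
proof -
  obtain f where f1: "f \<in> carrier G" "D = translate f E" using halvesE[OF assms(1)] .
  obtain f' where f2: "f' \<in> carrier G" "D' = translate f' E" using halvesE[OF assms(2)] .
  note f = f1 f2
  let ?h = "inv f' \<otimes> f"
  have D: "D = translate f' (translate ?h E)"
    using f by (simp add: translate_translate m_assoc[symmetric])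
  have "translate ?h E \<subseteq> E \<or> E \<subseteq> translate ?h E \<or> translate ?h E \<inter> E = {} \<or> translate ?h E \<union> E = carrier G"
    using nested f by simp
  then show ?thesis
  proof (elim disjE)
    assume "translate ?h E \<union> E = carrier G"
    then have "D \<union> D' = carrier G" unfolding D f(4) using f(3) by (auto simp: translate_def)
    then show ?thesis by blast
  next
    assume "translate ?h E \<inter> E = {}"
    then have "D \<inter> D' = {}" unfolding D f(4) by (auto simp: translate_def)
    then show ?thesis by blast
  qed (use translate_mono D f(4) in blast)+
qed

lemma sep_translate:
  assumes "f \<in> carrier G" "x \<in> carrier G" "y \<in> carrier G"
  shows "sep (f \<otimes> x) (f \<otimes> y) = translate f ` sep x y"
proof (intro equalityI subsetI)
  fix D assume D: "D \<in> sep (f \<otimes> x) (f \<otimes> y)"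
  then obtain h where h: "h \<in> carrier G" "D = translate h E" using halvesE sep_halves by metis
  let ?D = "translate (inv f \<otimes> h) E"
  have "D = translate f ?D" using h assms by (simp add: translate_translate m_assoc[symmetric])
  moreover have "?D \<in> halves" using h assms by (auto simp: halves_def)
  ultimately show "D \<in> translate f ` sep x y"
    using D assms by (auto simp: sep_def mem_translate_mult)
next
  fix D assume "D \<in> translate f ` sep x y"
  then obtain D' where D': "D = translate f D'" "D' \<in> sep x y" by blast
  obtain h where "h \<in> carrier G" "D' = translate h E" using halvesE[OF sep_halves[OF D'(2)]] .
  with D' have h: "h \<in> carrier G" "D = translate f (translate h E)" "translate h E \<in> sep x y" by auto
  have "D \<in> halves" using h assms by (auto simp: translate_translate halves_def)
  then show "D \<in> sep (f \<otimes> x) (f \<otimes> y)"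
    using h assms by (simp add: sep_def mem_translate_mult)
qed

lemma sigma_translate:
  assumes "f \<in> carrier G" "x \<in> carrier G" "y \<in> carrier G"
  shows "sigma (f \<otimes> x) (f \<otimes> y) = sigma x y"
proof -
  have "translate (inv f) (translate f D) = D" if D: "D \<in> sep x y" for D
  proof -
    obtain h where "h \<in> carrier G" "D = translate h E" using halvesE[OF sep_halves[OF D]] .
    then show ?thesis using assms by (simp add: translate_translate m_assoc[symmetric])
  qed
  then have "inj_on (translate f) (sep x y)" by (rule inj_on_inverseI)
  then show ?thesis unfolding sigma_def sep_translate[OF assms] by (rule card_image)
qed

lemma sigma_mult:
  "x \<in> carrier G \<Longrightarrow> s \<in> carrier G \<Longrightarrow> sigma x (x \<otimes> s) = sigma \<one> s"
  using sigma_translate[of x \<one> s] by simp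

text \<open>If some half-space separates both pairs, nestedness forbids a second half-space with
  x, y on one side and a, b on the other.\<close>
lemma sep_four:
  assumes "x \<in> carrier G" "y \<in> carrier G" "a \<in> carrier G" "b \<in> carrier G"
    and "P \<in> sep x y" "P \<in> sep a b"
  shows "sep x a \<subseteq> sep x y \<union> sep a b"
proof
  fix D assume D: "D \<in> sep x a"
  have "P \<subseteq> D \<or> D \<subseteq> P \<or> P \<inter> D = {} \<or> P \<union> D = carrier G"
    using halves_nested[of P D] D assms unfolding sep_def by blast
  then show "D \<in> sep x y \<union> sep a b"
    using D assms unfolding sep_def by auto
qed

lemma path_crosses:
  assumes "P \<in> sep (w 0) (w n)"
  shows "\<exists>i<n. P \<in> sep (w i) (w (Suc i))"
  using assms
proof (induction n)
  case (Suc n)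
  show ?case
  proof (cases "P \<in> sep (w 0) (w n)")
    case True
    then show ?thesis using Suc.IH less_SucI by blast
  next
    case False
    then have "P \<in> sep (w n) (w (Suc n))" using Suc.prems sep_triangle by blast
    then show ?thesis by blast
  qed
qed simp

lemma phi_diff_le_sigma:
  assumes "x \<in> carrier G" "y \<in> carrier G"
  shows "\<bar>phi x - phi y\<bar> \<le> int (sigma x y)"
proof -
  have inj: "inj_on Ei A" for A
  proof (rule inj_onI)
    fix i j assume e: "Ei i = Ei j"
    have "i \<le> phi (gp (j - phi \<one>)) \<longleftrightarrow> j \<le> phi (gp (j - phi \<one>))"
      "i \<le> phi (gp (i - phi \<one>)) \<longleftrightarrow> j \<le> phi (gp (i - phi \<one>))"
      using mem_Ei_iff[OF gp_closed] e by blast+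
    then show "i = j" by (simp add: phi_gp)
  qed
  have le: "phi y - phi x \<le> int (sigma x y)" if c: "x \<in> carrier G" "y \<in> carrier G" for x y
  proof -
    have "Ei ` {phi x + 1..phi y} \<subseteq> sep x y"
      using mem_Ei_iff c by (auto simp: sep_def halves_def Ei_def)
    then have "card (Ei ` {phi x + 1..phi y}) \<le> sigma x y"
      unfolding sigma_def using finite_sep[OF c] by (intro card_mono)
    then show ?thesis using card_image[OF inj, of "{phi x + 1..phi y}"] by simp
  qed
  show ?thesis using le[OF assms] le[OF assms(2,1)] sigma_sym[of x y] by linarith
qed

lemma ex_step_bound: "\<exists>k\<ge>1. \<forall>x\<in>carrier G. \<forall>s\<in>letters. sigma x (x \<otimes> s) \<le> k"
proof -
  have fin: "finite letters" using finite_S by (simp add: letters_def)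
  have "sigma x (x \<otimes> s) \<le> Suc (Max (sigma \<one> ` letters))" if "x \<in> carrier G" "s \<in> letters" for x s
  proof -
    have "sigma x (x \<otimes> s) = sigma \<one> s" using sigma_mult that letters_carrier by blast
    also have "\<dots> \<le> Max (sigma \<one> ` letters)" using fin that by (intro Max_ge) auto
    finally show ?thesis by simp
  qed
  then show ?thesis by (intro exI[of _ "Suc (Max (sigma \<one> ` letters))"]) auto
qed

text \<open>z lies beside a wall between x and y. By \<open>sep_four\<close>, two points beside the
  same wall are within \<open>2 * k\<close> for \<open>sigma\<close>, so the wall determines them
  coarsely.\<close>

definition touches :: "nat \<Rightarrow> 'a \<Rightarrow> 'a \<Rightarrow> 'a \<Rightarrow> bool" where
  "touches k x y z \<longleftrightarrow> (\<exists>a\<in>carrier G. \<exists>P\<in>sep x y. P \<in> sep a z \<and> sigma a z \<le> k)"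

text \<open>A geodesic for S also makes excursions across walls that do not separate x from y. The
  chain advances only at steps that cross a wall of \<open>sep x y\<close> and waits otherwise;
  \<open>sep_four\<close> then bounds the number of other walls that a step of the chain
  crosses.\<close>

lemma ex_chain:
  assumes c: "x \<in> carrier G" "y \<in> carrier G"
    and k: "\<And>x s. x \<in> carrier G \<Longrightarrow> s \<in> letters \<Longrightarrow> sigma x (x \<otimes> s) \<le> k"
  shows "\<exists>m n. m 0 = x \<and> m n = y \<and> (\<forall>j\<le>n. m j \<in> carrier G) \<and>
    (\<forall>j<n. sigma (m j) (m (Suc j)) \<le> 2 * k) \<and> (\<forall>j\<le>n. m j = x \<or> m j = y \<or> touches k x y (m j))"
proof -
  obtain p where p: "geod x y p" using ex_geod[OF c] .
  define n where "n = d x y"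
  have pc: "\<And>j. j \<le> n \<Longrightarrow> p j \<in> carrier G" and p0: "p 0 = x" and pn: "p n = y"
    using geod_closed[OF p] p unfolding geod_def n_def by auto
  have step: "sigma (p j) (p (Suc j)) \<le> k" if "j < n" for j
    using path_step[of p n j] that p k[of "p j"] pc[of j] unfolding geod_def n_def by auto
  define cr where "cr j \<longleftrightarrow> (\<exists>P\<in>sep x y. P \<in> sep (p j) (p (Suc j)))" for j
  \<comment> \<open>The point after the last relevant crossing; it is x before the first
    one.\<close>
  define m0 where "m0 = rec_nat x (\<lambda>j z. if cr j then p (Suc j) else z)"
  have m0_0: "m0 0 = x" and m0_Suc: "m0 (Suc j) = (if cr j then p (Suc j) else m0 j)" for j
    by (simp_all add: m0_def)
  have m0c: "m0 j \<in> carrier G" if "j \<le> n" for j using that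
    by (induction j) (use c m0_0 m0_Suc pc in auto)
  \<comment> \<open>Steps during which the chain waits cross no wall of \<open>sep x y\<close>, so
    the waiting point and the geodesic point stay on the same sides of those walls.\<close>
  have nosep: "sep (m0 j) (p j) \<inter> sep x y = {}" if "j \<le> n" for j using that
  proof (induction j)
    case (Suc j)
    show ?case
    proof (cases "cr j")
      case False
      then have "sep (p j) (p (Suc j)) \<inter> sep x y = {}" unfolding cr_def by blast
      then show ?thesis using Suc False sep_triangle[of "m0 j" "p (Suc j)" "p j"]
        by (auto simp: m0_Suc)
    qed (simp add: m0_Suc)
  qed (simp add: m0_0 p0)
  have tch: "m0 j = x \<or> touches k x y (m0 j)" if "j \<le> n" for j using that
  proof (induction j)
    case (Suc j)
    show ?case
    proof (cases "cr j")
      case True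
      then obtain P where P: "P \<in> sep x y" "P \<in> sep (p j) (p (Suc j))" unfolding cr_def by blast
      then have "touches k x y (p (Suc j))"
        unfolding touches_def using step[of j] pc[of j] Suc.prems by (intro bexI[of _ "p j"] bexI[of _ P]) auto
      then show ?thesis using True by (simp add: m0_Suc)
    qed (use Suc in \<open>simp add: m0_Suc\<close>)
  qed (simp add: m0_0)
  have ex_F: "\<exists>F. finite F \<and> card F \<le> k \<and> sep x z \<subseteq> sep x y \<union> F"
    if z: "z \<in> carrier G" "z = x \<or> touches k x y z" for z
  proof (cases "z = x")
    case False
    then obtain a P where a: "a \<in> carrier G" "P \<in> sep x y" "P \<in> sep a z" "sigma a z \<le> k"
      using z unfolding touches_def by blast
    have "sep x z \<subseteq> sep x y \<union> sep z a"
      using sep_four[of x y z a P] a c z sep_sym by blast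
    then show ?thesis using a finite_sep[OF a(1) z(1)] unfolding sigma_def
      by (intro exI[of _ "sep a z"]) (auto simp: sep_sym)
  qed (intro exI[of _ "{}"], simp)
  \<comment> \<open>The last waiting point need not be y, so one final step to y is
    appended.\<close>
  define m where "m j = (if j \<le> n then m0 j else y)" for j
  have "sigma (m j) (m (Suc j)) \<le> 2 * k" if j: "j \<le> n" for j
  proof -
    obtain F where F: "finite F" "card F \<le> k" "sep x (m0 j) \<subseteq> sep x y \<union> F"
      using ex_F[OF m0c tch] j by blast
    consider "j = n" | "j < n" "\<not> cr j" | "j < n" "cr j" using j by linarith
    then show ?thesis
    proof cases
      case 1
      have "sep (m0 j) y \<subseteq> F"
      proof
        fix D assume D: "D \<in> sep (m0 j) y"
        then have "D \<notin> sep x y" using nosep[OF j] 1 pn by blast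
        then have "D \<in> sep x (m0 j)" using D sep_triangle sep_sym by blast
        then show "D \<in> F" using F \<open>D \<notin> sep x y\<close> by blast
      qed
      then have "sigma (m0 j) y \<le> card F" unfolding sigma_def using F by (intro card_mono)
      then show ?thesis using 1 F by (simp add: m_def)
    next
      case 2
      then show ?thesis by (simp add: m_def m0_Suc sigma_def)
    next
      case 3
      then obtain P where P: "P \<in> sep x y" "P \<in> sep (p j) (p (Suc j))" unfolding cr_def by blast
      have four: "sep x (p (Suc j)) \<subseteq> sep x y \<union> sep (p j) (p (Suc j))"
        using sep_four[of x y "p (Suc j)" "p j" P] P c pc 3 sep_sym by force
      have "sep (m0 j) (p (Suc j)) \<subseteq> F \<union> sep (p j) (p (Suc j))"
      proof
        fix D assume D: "D \<in> sep (m0 j) (p (Suc j))"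
        show "D \<in> F \<union> sep (p j) (p (Suc j))"
        proof (cases "D \<in> sep x y")
          case True
          then show ?thesis using D nosep[OF j] sep_triangle by blast
        next
          case False
          have "D \<in> sep x (m0 j) \<union> sep x (p (Suc j))" using D sep_triangle sep_sym by blast
          then show ?thesis using False four F by blast
        qed
      qed
      moreover have "finite (sep (p j) (p (Suc j)))" using finite_sep pc 3 by simp
      ultimately have "sigma (m0 j) (p (Suc j)) \<le> card (F \<union> sep (p j) (p (Suc j)))"
        unfolding sigma_def using F by (intro card_mono) auto
      also have "\<dots> \<le> card F + card (sep (p j) (p (Suc j)))" by (rule card_Un_le)
      also have "\<dots> \<le> 2 * k" using F step[of j] 3 unfolding sigma_def by simp
      finally show ?thesis using 3 by (simp add: m_def m0_Suc)
    qed
  qed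
  then show ?thesis
    using m0c tch m0_0 c by (intro exI[of _ m] exI[of _ "Suc n"]) (auto simp: m_def)
qed

text \<open>An edge labelled by an element of \<open>Comm\<close> may cross arbitrarily many walls.
  Inside the coset it can be replaced by steps of \<open>g\<close> and one step of bounded length,
  and one of these crosses P.\<close>

lemma coset_crossing:
  "\<exists>k. \<forall>w\<in>carrier G. \<forall>h\<in>Comm. \<forall>P\<in>sep w (w \<otimes> h). \<exists>c\<in>Comm. \<exists>c'\<in>Comm.
     P \<in> sep (w \<otimes> c) (w \<otimes> c') \<and> sigma (w \<otimes> c) (w \<otimes> c') \<le> k"
proof -
  obtain D where D: "\<And>k. k \<in> Comm \<Longrightarrow> \<exists>m. d (gp m) k \<le> D" using Comm_near_axis by blast
  define B where "B = {b \<in> carrier G. d \<one> b \<le> D}"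
  have fin: "finite B" unfolding B_def by (rule finite_ball[OF finite_S one_closed])
  define k where "k = max (sigma \<one> g) (Max (insert 0 (sigma \<one> ` B)))"
  show ?thesis
  proof (intro exI[of _ k] ballI)
    fix w h P assume w: "w \<in> carrier G" and h: "h \<in> Comm" and P: "P \<in> sep w (w \<otimes> h)"
    have hc: "h \<in> carrier G" using h Comm_carrier by blast
    obtain m where m: "d (gp m) h \<le> D" using D[OF h] ..
    show "\<exists>c\<in>Comm. \<exists>c'\<in>Comm. P \<in> sep (w \<otimes> c) (w \<otimes> c') \<and> sigma (w \<otimes> c) (w \<otimes> c') \<le> k"
    proof (cases "P \<in> sep (w \<otimes> gp m) (w \<otimes> h)")
      case True
      have "gp (- m) \<otimes> h \<in> B" using m hc d_one[of "gp m" h] by (simp add: B_def gp_neg)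
      then have "sigma \<one> (gp (- m) \<otimes> h) \<le> k" unfolding k_def using fin by (simp add: le_max_iff_disj)
      moreover have "sigma (w \<otimes> gp m) (w \<otimes> h) = sigma \<one> (gp (- m) \<otimes> h)"
        using sigma_mult[of "w \<otimes> gp m" "gp (- m) \<otimes> h"] w hc
        by (simp add: m_assoc) (simp add: m_assoc[symmetric] gp_add[symmetric])
      ultimately show ?thesis using True h g_Comm by (intro bexI[of _ "gp m"] bexI[of _ h]) auto
    next
      case False
      then have P1: "P \<in> sep w (w \<otimes> gp m)" using P sep_triangle by blast
      have "\<exists>i. P \<in> sep (w \<otimes> gp i) (w \<otimes> gp (i + 1))"
      proof (rule ccontr)
        assume no: "\<not> ?thesis"
        have "P \<in> halves" using P by (simp add: sep_def)
        then have eq: "(w \<otimes> gp i \<in> P) = (w \<otimes> gp (i + 1) \<in> P)" for i using no by (auto simp: sep_def)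
        have "(w \<otimes> gp i \<in> P) = (w \<otimes> gp 0 \<in> P)" for i
        proof (induction i rule: int_induct[where k = 0])
          case (step2 i)
          then show ?case using eq[of "i - 1"] by simp
        qed (use eq in auto)
        then show False using P1 w by (simp add: sep_def)
      qed
      then obtain i where i: "P \<in> sep (w \<otimes> gp i) (w \<otimes> gp (i + 1))" ..
      have "sigma (w \<otimes> gp i) (w \<otimes> gp (i + 1)) = sigma \<one> g"
        using sigma_mult[of "w \<otimes> gp i" g] w gp_add[of i 1] by (simp add: m_assoc)
      then have "sigma (w \<otimes> gp i) (w \<otimes> gp (i + 1)) \<le> k" by (simp add: k_def)
      then show ?thesis using i g_Comm by blast
    qed
  qed
qed

text \<open>Cosets other than \<open>Comm\<close> itself have bounded shadows on the axis. If the
  translate by f had a long shadow, many powers of \<open>g\<close> would lie near it with offsets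
  in a finite set, and two equal offsets would put f into the commensurator.\<close>

lemma phi_coset_bounded:
  "\<exists>B\<ge>0. \<forall>f\<in>carrier G. f \<notin> Comm \<longrightarrow> (\<forall>h\<in>Comm. \<bar>phi (f \<otimes> h) - phi f\<bar> \<le> B)"
proof -
  obtain D where D: "\<And>s t z. z \<in> carrier G \<Longrightarrow>
    d (gp s) z + d z (gp t) \<le> d (gp s) (gp t) + C \<Longrightarrow> \<exists>m. d (gp m) z \<le> D"
    using near_axis by blast
  define B0 where "B0 = {b \<in> carrier G. d \<one> b \<le> D}"
  have fin: "finite B0" unfolding B0_def by (rule finite_ball[OF finite_S one_closed])
  have line: "phi (f \<otimes> gp t) - phi (f \<otimes> gp s) \<le> int N + card B0"
    if f: "f \<in> carrier G" "f \<notin> Comm" for f s t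
  proof (rule ccontr)
    let ?u = "f \<otimes> gp s" and ?v = "f \<otimes> gp t"
    assume "\<not> phi ?v - phi ?u \<le> int N + card B0"
    then have big: "phi ?v - int N - phi ?u > card B0" by simp
    define A where "A = {phi ?u + 1..phi ?v - int N}"
    have "\<exists>m. inv (gp m) \<otimes> (inv f \<otimes> gp k) \<in> B0" if k: "k \<in> A" for k
    proof -
      have "d ?u (gp k) + d (gp k) ?v \<le> d ?u ?v + C"
        using k f by (intro phi_bottleneck) (auto simp: A_def)
      moreover have "d ?u (gp k) = d (gp s) (inv f \<otimes> gp k)" "d (gp k) ?v = d (inv f \<otimes> gp k) (gp t)"
        using d_translate[of f "gp s" "inv f \<otimes> gp k"] d_translate[of f "inv f \<otimes> gp k" "gp t"] f
        by (simp_all add: m_assoc[symmetric])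
      moreover have "d ?u ?v = d (gp s) (gp t)" using f by (simp add: d_translate)
      ultimately obtain m where "d (gp m) (inv f \<otimes> gp k) \<le> D" using D[of "inv f \<otimes> gp k" s t] f by auto
      then have "inv (gp m) \<otimes> (inv f \<otimes> gp k) \<in> B0"
        using d_one[of "gp m" "inv f \<otimes> gp k"] f by (simp add: B0_def)
      then show ?thesis ..
    qed
    then obtain mm where mm: "\<And>k. k \<in> A \<Longrightarrow> inv (gp (mm k)) \<otimes> (inv f \<otimes> gp k) \<in> B0" by metis
    have "card A > card B0" using big by (simp add: A_def)
    moreover have "card ((\<lambda>k. inv (gp (mm k)) \<otimes> (inv f \<otimes> gp k)) ` A) \<le> card B0"
      using mm fin by (intro card_mono image_subsetI)
    ultimately have "\<not> inj_on (\<lambda>k. inv (gp (mm k)) \<otimes> (inv f \<otimes> gp k)) A"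
      by (intro pigeonhole) simp
    then obtain k l where kl: "k \<noteq> l"
      "inv (gp (mm k)) \<otimes> (inv f \<otimes> gp k) = inv (gp (mm l)) \<otimes> (inv f \<otimes> gp l)"
      unfolding inj_on_def by blast
    \<comment> \<open>Both sides contain the common offset; multiplying out leaves f between two
      powers of \<open>g\<close>.\<close>
    have "f \<otimes> gp (mm l) \<otimes> (inv (gp (mm k)) \<otimes> (inv f \<otimes> gp k)) \<otimes> gp (- k) \<otimes> f
        = f \<otimes> gp (mm l) \<otimes> (inv (gp (mm l)) \<otimes> (inv f \<otimes> gp l)) \<otimes> gp (- k) \<otimes> f"
      by (simp only: kl(2))
    moreover have "f \<otimes> gp (mm l) \<otimes> (inv (gp (mm k)) \<otimes> (inv f \<otimes> gp k)) \<otimes> gp (- k) \<otimes> f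
        = f \<otimes> (gp (mm l) \<otimes> gp (- mm k)) \<otimes> inv f \<otimes> (gp k \<otimes> gp (- k)) \<otimes> f"
      using f by (simp only: m_assoc gp_neg m_closed gp_closed inv_closed)
    moreover have "\<dots> = f \<otimes> gp (mm l - mm k)"
      using f by (simp add: gp_add[symmetric] m_assoc)
    moreover have "f \<otimes> gp (mm l) \<otimes> (inv (gp (mm l)) \<otimes> (inv f \<otimes> gp l)) \<otimes> gp (- k) \<otimes> f
        = f \<otimes> (gp (mm l) \<otimes> gp (- mm l)) \<otimes> inv f \<otimes> (gp l \<otimes> gp (- k)) \<otimes> f"
      using f by (simp only: m_assoc gp_neg m_closed gp_closed inv_closed)
    moreover have "\<dots> = gp (l - k) \<otimes> f"
      using f by (simp add: gp_add[symmetric])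
    ultimately have eq: "f \<otimes> gp (mm l - mm k) = gp (l - k) \<otimes> f" by simp
    have "mm l - mm k \<noteq> 0"
    proof
      assume "mm l - mm k = 0"
      then have "gp (l - k) \<otimes> f = \<one> \<otimes> f" using eq f by simp
      then have "gp (l - k) = gp 0" using f r_cancel[of f "gp (l - k)" \<one>] by simp
      then show False using gp_inj[of "l - k" 0] kl by simp
    qed
    moreover have "l - k \<noteq> 0" using kl by simp
    ultimately have "f \<in> Comm" unfolding Comm_def using f(1) eq by blast
    then show False using f(2) by contradiction
  qed
  obtain D' where D': "\<And>k. k \<in> Comm \<Longrightarrow> \<exists>m. d (gp m) k \<le> D'" using Comm_near_axis by blast
  obtain L where L: "L \<ge> 0" "\<And>x y. x \<in> carrier G \<Longrightarrow> y \<in> carrier G \<Longrightarrow> d x y \<le> D' \<Longrightarrow> \<bar>phi x - phi y\<bar> \<le> L"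
    using phi_lipschitz[of D'] by blast
  show ?thesis
  proof (intro exI[of _ "int N + card B0 + L"] conjI ballI impI)
    fix f h assume f: "f \<in> carrier G" "f \<notin> Comm" and h: "h \<in> Comm"
    have hc: "h \<in> carrier G" using h Comm_carrier by blast
    obtain m where "d (gp m) h \<le> D'" using D'[OF h] ..
    then have "d (f \<otimes> gp m) (f \<otimes> h) \<le> D'" using f hc by (simp add: d_translate)
    then have "\<bar>phi (f \<otimes> gp m) - phi (f \<otimes> h)\<bar> \<le> L" using L(2) f hc by simp
    moreover have "phi (f \<otimes> gp m) - phi (f \<otimes> gp 0) \<le> int N + card B0"
      "phi (f \<otimes> gp 0) - phi (f \<otimes> gp m) \<le> int N + card B0"
      using line[OF f] by blast+
    ultimately show "\<bar>phi (f \<otimes> h) - phi f\<bar> \<le> int N + card B0 + L" using f by simp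
  qed (use L in simp)
qed

text \<open>Up to finitely many offsets an element of \<open>Comm\<close> is a power of
  \<open>g\<close>, and the height then determines the exponent up to a bounded error.\<close>

lemma finite_Comm_phi: "finite {h \<in> Comm. \<bar>phi h - a\<bar> \<le> R}"
proof -
  obtain D where D: "\<And>k. k \<in> Comm \<Longrightarrow> \<exists>m. d (gp m) k \<le> D" using Comm_near_axis by blast
  define B where "B = {b \<in> carrier G. d \<one> b \<le> D}"
  have fin: "finite B" unfolding B_def by (rule finite_ball[OF finite_S one_closed])
  define M where "M = (\<Union>b\<in>B. {a - R - phi b..a + R - phi b})"
  have "{h \<in> Comm. \<bar>phi h - a\<bar> \<le> R} \<subseteq> (\<lambda>(m, b). gp m \<otimes> b) ` (M \<times> B)"
  proof
    fix h assume h: "h \<in> {h \<in> Comm. \<bar>phi h - a\<bar> \<le> R}"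
    then have hc: "h \<in> carrier G" using Comm_carrier by blast
    obtain m where m: "d (gp m) h \<le> D" using D h by blast
    let ?b = "gp (- m) \<otimes> h"
    have b: "?b \<in> B" using m hc d_one[of "gp m" h] by (simp add: B_def gp_neg)
    have "phi ?b = phi h - m" using phi_translate[OF hc] by simp
    then have "m \<in> {a - R - phi ?b..a + R - phi ?b}" using h by auto
    then have "m \<in> M" unfolding M_def using b by blast
    moreover have "h = gp m \<otimes> ?b" using hc by (simp add: m_assoc[symmetric] gp_add[symmetric])
    ultimately show "h \<in> (\<lambda>(m, b). gp m \<otimes> b) ` (M \<times> B)" using b by force
  qed
  moreover have "finite M" unfolding M_def using fin by simp
  ultimately show ?thesis using fin finite_subset by blast
qed

section \<open>Hyperbolic embedding of the commensurator\<close>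

definition small :: "nat \<Rightarrow> 'a set" where "small k = {t \<in> carrier G. sigma \<one> t \<le> k}"

lemma sigma_inv: "t \<in> carrier G \<Longrightarrow> sigma \<one> (inv t) = sigma \<one> t"
  using sigma_translate[of t \<one> "inv t"] sigma_sym by simp

lemma diff_small:
  "x \<in> carrier G \<Longrightarrow> y \<in> carrier G \<Longrightarrow> sigma x y \<le> k \<Longrightarrow> inv x \<otimes> y \<in> small k"
  using sigma_translate[of "inv x" x y] by (simp add: small_def)

lemma diff_Comm_d:
  assumes "generated_group G (Comm \<union> small k)" "x \<in> carrier G" "y \<in> carrier G"
    "inv x \<otimes> y \<in> Comm \<union> small k"
  shows "cay_dist G (Comm \<union> small k) x y \<le> 1"
proof -
  interpret Z: generated_group G "Comm \<union> small k" by fact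
  show ?thesis
    using Z.d_step[of x "inv x \<otimes> y"] assms(2-) unfolding Z.letters_def
    by (auto simp: m_assoc[symmetric])
qed

text \<open>The bottlenecks are the chains of \<open>ex_chain\<close>. Every path of the coned-off
  graph from x to y crosses the wall beside a given chain point. A crossing edge from
  \<open>small\<close> is close to that point by \<open>sep_four\<close>; for a crossing edge from
  \<open>Comm\<close>, the coset has a short crossing one edge away.\<close>

lemma hyperbolic_coned:
  assumes k: "\<And>x s. x \<in> carrier G \<Longrightarrow> s \<in> letters \<Longrightarrow> sigma x (x \<otimes> s) \<le> k" and k1: "k \<ge> 1"
    and gen: "generated_group G (Comm \<union> small (10 * k))"
  shows "gromov_hyperbolic (carrier G) (\<lambda>x y. real (cay_dist G (Comm \<union> small (10 * k)) x y))"
proof -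
  interpret Z: generated_group G "Comm \<union> small (10 * k)" by fact
  note dZ = diff_Comm_d[OF gen]
  have small_d: "Z.d x y \<le> 1" if "x \<in> carrier G" "y \<in> carrier G" "sigma x y \<le> 10 * k" for x y
    using dZ diff_small that by blast
  \<comment> \<open>The first chain point at \<open>sigma\<close>-distance at least
    \<open>3 * k\<close> from x is at most \<open>5 * k\<close> away, hence one edge. A detour
    through it crosses at most k walls twice, so the distance to y drops by at least k.\<close>
  have sig_d: "Z.d x y \<le> sigma x y + 1" if "x \<in> carrier G" "y \<in> carrier G" for x y
    using that
  proof (induction "sigma x y" arbitrary: x rule: less_induct)
    case less
    note c = less.prems
    show ?case
    proof (cases "sigma x y \<le> 10 * k")
      case True
      then show ?thesis using small_d[OF c] by simp
    next
      case False
      obtain m n where m: "m 0 = x" "m n = y" "\<forall>j\<le>n. m j \<in> carrier G"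
        "\<forall>j<n. sigma (m j) (m (Suc j)) \<le> 2 * k" "\<forall>j\<le>n. m j = x \<or> m j = y \<or> touches k x y (m j)"
        using ex_chain[OF c k] by blast
      define j where "j = (LEAST j. sigma x (m j) \<ge> 3 * k)"
      have n3: "sigma x (m n) \<ge> 3 * k" using False m by simp
      have j: "sigma x (m j) \<ge> 3 * k" "j \<le> n" using n3 unfolding j_def by (auto intro: LeastI Least_le)
      have "j \<noteq> 0" using j m k1 by (intro notI) (simp add: sigma_def)
      then obtain i where i: "j = Suc i" using not0_implies_Suc by blast
      have "sigma x (m i) < 3 * k"
        using i not_less_Least[of i "\<lambda>j. sigma x (m j) \<ge> 3 * k"] unfolding j_def by simp
      have mc: "m i \<in> carrier G" "m j \<in> carrier G" using m(3) i j by auto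
      have "sigma x (m j) \<le> sigma x (m i) + sigma (m i) (m j)"
        unfolding sigma_def using finite_sep c mc sep_triangle
        by (meson card_Un_le card_mono finite_Un le_trans)
      then have up: "sigma x (m j) \<le> 5 * k" using \<open>sigma x (m i) < 3 * k\<close> m(4)[rule_format, of i] i j by simp
      have "m j \<noteq> y" using up False k1 by auto
      moreover have "m j \<noteq> x" using j k1 by (auto simp: sigma_def)
      ultimately obtain a P where a: "a \<in> carrier G" "P \<in> sep x y" "P \<in> sep a (m j)" "sigma a (m j) \<le> k"
        using m(5) j unfolding touches_def by blast
      let ?U = "sep x y" and ?F = "sep a (m j)" and ?A = "sep x (m j)" and ?B = "sep (m j) y"
      have "?A \<subseteq> ?U \<union> ?F" using sep_four[of x y "m j" a P] a c mc sep_sym by blast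
      moreover have "?B \<subseteq> ?U \<union> ?F" using sep_four[of y x "m j" a P] a c mc sep_sym by blast
      ultimately have AB: "?A \<union> ?B \<subseteq> ?U \<union> ?F" by blast
      have "?A \<inter> ?B \<subseteq> ?F"
      proof
        fix D assume D: "D \<in> ?A \<inter> ?B"
        then have "D \<notin> ?U" by (auto simp: sep_def)
        then show "D \<in> ?F" using D \<open>?A \<subseteq> ?U \<union> ?F\<close> by blast
      qed
      then have 1: "card (?A \<inter> ?B) \<le> card ?F" using finite_sep a mc by (intro card_mono)
      have "card (?A \<union> ?B) \<le> card (?U \<union> ?F)" using AB finite_sep a c mc by (intro card_mono) auto
      also have "\<dots> \<le> card ?U + card ?F" by (rule card_Un_le)
      finally have 2: "card (?A \<union> ?B) \<le> card ?U + card ?F" .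
      have "card ?A + card ?B = card (?A \<union> ?B) + card (?A \<inter> ?B)"
        using finite_sep c mc by (intro card_Un_Int) auto
      then have "sigma x (m j) + sigma (m j) y \<le> sigma x y + 2 * k"
        using 1 2 a(4) unfolding sigma_def by linarith
      then have less': "sigma (m j) y < sigma x y" using j k1 by linarith
      then have "Z.d (m j) y \<le> sigma (m j) y + 1" using less.hyps mc c by blast
      moreover have "Z.d x (m j) \<le> 1" using small_d c mc up by simp
      moreover have "Z.d x y \<le> Z.d x (m j) + Z.d (m j) y" using Z.d_triangle c mc by blast
      ultimately show ?thesis using less' by linarith
    qed
  qed
  obtain k2 where k2: "\<And>w h P. w \<in> carrier G \<Longrightarrow> h \<in> Comm \<Longrightarrow> P \<in> sep w (w \<otimes> h) \<Longrightarrow>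
     \<exists>c\<in>Comm. \<exists>c'\<in>Comm. P \<in> sep (w \<otimes> c) (w \<otimes> c') \<and> sigma (w \<otimes> c) (w \<otimes> c') \<le> k2"
    using coset_crossing by blast
  \<comment> \<open>\<open>11 * k + 1\<close> covers a crossing edge from \<open>small\<close>, and
    \<open>k2 + k + 2\<close> one from \<open>Comm\<close>.\<close>
  define D where "D = 11 * k + k2 + 2"
  show ?thesis
  proof (rule Z.bottleneck_hyperbolic)
    fix x y assume c: "x \<in> carrier G" "y \<in> carrier G"
    obtain m n where m: "m 0 = x" "m n = y" "\<forall>j\<le>n. m j \<in> carrier G"
      "\<forall>j<n. sigma (m j) (m (Suc j)) \<le> 2 * k" "\<forall>j\<le>n. m j = x \<or> m j = y \<or> touches k x y (m j)"
      using ex_chain[OF c k] by blast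
    have "\<exists>j\<le>l. Z.d (m i) (w j) \<le> D"
      if w: "Z.path w l" "w 0 = x" "w l = y" and i: "i \<le> n" for w l i
    proof -
      have mi: "m i \<in> carrier G" using m i by blast
      consider "m i = x" | "m i = y" | "touches k x y (m i)" using m(5) i by blast
      then show ?thesis
      proof cases
        case 1
        then show ?thesis using w c by (intro exI[of _ 0]) simp
      next
        case 2
        then show ?thesis using w c by (intro exI[of _ l]) simp
      next
        case 3
        then obtain a P where a: "a \<in> carrier G" "P \<in> sep x y" "P \<in> sep a (m i)" "sigma a (m i) \<le> k"
          unfolding touches_def by blast
        obtain j where j: "j < l" "P \<in> sep (w j) (w (Suc j))"
          using path_crosses[of P w l] a w by blast
        have wc: "w j \<in> carrier G" "w (Suc j) \<in> carrier G" using Z.path_closed[OF w(1)] j by auto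
        obtain s where s: "s \<in> Z.letters" "w (Suc j) = w j \<otimes> s"
          using Z.path_step[OF w(1) j(1)] by blast
        have sc: "s \<in> carrier G" using s Z.letters_carrier by blast
        have close: "sigma u (m i) \<le> q + k"
          if "P \<in> sep u v" "u \<in> carrier G" "v \<in> carrier G" "sigma u v \<le> q" for u v q
        proof -
          have "sep u (m i) \<subseteq> sep u v \<union> sep a (m i)"
            using sep_four[of u v "m i" a P] that a mi sep_sym by blast
          then have "card (sep u (m i)) \<le> card (sep u v \<union> sep a (m i))"
            using that a mi finite_sep by (intro card_mono) auto
          also have "\<dots> \<le> card (sep u v) + card (sep a (m i))" by (rule card_Un_le)
          finally show ?thesis using that a unfolding sigma_def by simp
        qed
        have "Z.d (w j) (m i) \<le> D"
        proof (cases "s \<in> Comm")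
          case True
          obtain e e' where e: "e \<in> Comm" "e' \<in> Comm" "P \<in> sep (w j \<otimes> e) (w j \<otimes> e')"
            "sigma (w j \<otimes> e) (w j \<otimes> e') \<le> k2"
            using k2[of "w j" s P] wc True j s by auto
          have ec: "e \<in> carrier G" "e' \<in> carrier G" using e Comm_carrier by auto
          have "sigma (w j \<otimes> e) (m i) \<le> k2 + k" using close e ec wc by simp
          then have "Z.d (w j \<otimes> e) (m i) \<le> k2 + k + 1" using sig_d[of "w j \<otimes> e" "m i"] wc ec mi by simp
          moreover have "Z.d (w j) (w j \<otimes> e) \<le> 1" using e wc Z.d_step[of "w j" e] by (simp add: Z.letters_def)
          ultimately show ?thesis
            using Z.d_triangle[of "w j" "w j \<otimes> e" "m i"] wc ec mi unfolding D_def by simp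
        next
          case False
          have "s \<in> small (10 * k)"
          proof (rule ccontr)
            assume no: "s \<notin> small (10 * k)"
            then obtain t where t: "t \<in> Comm \<union> small (10 * k)" "s = inv t"
              using s False unfolding Z.letters_def by blast
            then have "t \<in> small (10 * k)" using False subgroup.m_inv_closed[OF subgroup_Comm] by blast
            then show False using no t(2) sigma_inv by (simp add: small_def)
          qed
          then have "sigma (w j) (w (Suc j)) \<le> 10 * k"
            using sigma_mult[OF wc(1) sc] s by (simp add: small_def)
          then have "sigma (w j) (m i) \<le> 10 * k + k" using close j wc by blast
          then show ?thesis using sig_d[OF wc(1) mi] unfolding D_def by simp
        qed
        then show ?thesis using j Z.d_sym[OF mi wc(1)] by (intro exI[of _ j]) simp
      qed
    qed
    moreover have "Z.d (m j) (m (Suc j)) \<le> 1" if "j < n" for j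
      using m(3,4) that by (intro small_d) (auto intro: le_trans)
    ultimately show "\<exists>m n. Z.bottlenecks D x y m n"
      using m(1-3) unfolding Z.bottlenecks_def by (intro exI[of _ m] exI[of _ n]) auto
  qed
qed

text \<open>An admissible edge changes the height by a bounded amount: a label from
  \<open>small\<close> crosses few walls, and a label from \<open>Comm\<close> is used inside
  another coset, whose shadow is bounded. So a short admissible path ends at an element of bounded
  height.\<close>

lemma finite_hat_balls:
  assumes h0: "h0 \<in> Comm"
  shows "finite {h \<in> Comm. hat_dist G Comm (small k) h0 h \<le> enat r}"
proof -
  obtain B where B: "B \<ge> 0" "\<And>f h. f \<in> carrier G \<Longrightarrow> f \<notin> Comm \<Longrightarrow> h \<in> Comm \<Longrightarrow> \<bar>phi (f \<otimes> h) - phi f\<bar> \<le> B"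
    using phi_coset_bounded by blast
  define M where "M = B + int k"
  have walk: "\<bar>phi (walk_end G z ss) - phi z\<bar> \<le> int (length ss) * M"
    if "z \<in> carrier G" "labels_ok Comm (small k) ss" "avoids_HH G Comm z ss" for z ss
    using that
  proof (induction ss arbitrary: z)
    case (Cons s ss)
    have lab: "case fst s of Inl h \<Rightarrow> h \<in> Comm | Inr t \<Rightarrow> t \<in> small k"
      using Cons.prems(2) by (simp add: labels_ok_def)
    have Sc: "step_val G s \<in> carrier G"
      using lab Comm_carrier unfolding step_val_def Let_def small_def by (auto split: sum.splits)
    have one: "\<bar>phi (z \<otimes> step_val G s) - phi z\<bar> \<le> M"
    proof (cases "fst s")
      case (Inl h)
      then have "step_val G s \<in> Comm"
        using lab subgroup.m_inv_closed[OF subgroup_Comm] by (simp add: step_val_def Let_def)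
      moreover have "z \<notin> Comm" using Cons.prems Inl by simp
      ultimately show ?thesis using B(2)[of z "step_val G s"] Cons.prems unfolding M_def by force
    next
      case (Inr t)
      then have "t \<in> small k" using lab by simp
      then have "sigma \<one> (step_val G s) \<le> k"
        using Inr sigma_inv by (auto simp: step_val_def Let_def small_def)
      then have "sigma (z \<otimes> step_val G s) z \<le> k" using sigma_mult Cons.prems Sc sigma_sym by simp
      then show ?thesis
        using phi_diff_le_sigma[of "z \<otimes> step_val G s" z] Cons.prems Sc B(1) unfolding M_def by simp
    qed
    have "\<bar>phi (walk_end G (z \<otimes> step_val G s) ss) - phi (z \<otimes> step_val G s)\<bar> \<le> int (length ss) * M"
      using Cons Sc by (simp add: labels_ok_def)
    then show ?case using one by (simp add: distrib_right)
  qed simp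
  have "{h \<in> Comm. hat_dist G Comm (small k) h0 h \<le> enat r} \<subseteq> {h \<in> Comm. \<bar>phi h - phi h0\<bar> \<le> int r * M}"
  proof safe
    fix h assume h: "h \<in> Comm" "hat_dist G Comm (small k) h0 h \<le> enat r"
    let ?W = "{ss. labels_ok Comm (small k) ss \<and> avoids_HH G Comm h0 ss \<and> walk_end G h0 ss = h}"
    have "Inf ((\<lambda>ss. enat (length ss)) ` ?W) \<le> enat r" using h(2) by (simp add: hat_dist_def)
    moreover have "(\<lambda>ss. enat (length ss)) ` ?W \<noteq> {}"
    proof
      assume "(\<lambda>ss. enat (length ss)) ` ?W = {}"
      then have "Inf ((\<lambda>ss. enat (length ss)) ` ?W) = \<infinity>" by (simp add: Inf_enat_def)
      then show False using calculation by simp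
    qed
    ultimately obtain ss where ss: "ss \<in> ?W" "enat (length ss) \<le> enat r"
      using wellorder_InfI by (metis (no_types, lifting) ex_in_conv imageE)
    have "\<bar>phi h - phi h0\<bar> \<le> int (length ss) * M" using walk[of h0 ss] ss h0 Comm_carrier by auto
    moreover have "int (length ss) * M \<le> int r * M"
      using ss B(1) unfolding M_def by (intro mult_right_mono) auto
    ultimately show "\<bar>phi h - phi h0\<bar> \<le> int r * M" by linarith
  qed
  then show ?thesis using finite_Comm_phi finite_subset by blast
qed

lemma hyperbolically_embedded_Comm: "hyperbolically_embedded G Comm"
proof -
  obtain k where k: "k \<ge> 1" "\<And>x s. x \<in> carrier G \<Longrightarrow> s \<in> letters \<Longrightarrow> sigma x (x \<otimes> s) \<le> k"
    using ex_step_bound by blast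
  have "S \<subseteq> small (10 * k)"
  proof
    fix s assume "s \<in> S"
    then have "s \<in> letters" "s \<in> carrier G" using S_carrier by (auto simp: letters_def)
    then show "s \<in> small (10 * k)" using k(2)[of \<one> s] by (simp add: small_def)
  qed
  moreover have sc: "Comm \<union> small (10 * k) \<subseteq> carrier G" using Comm_carrier by (auto simp: small_def)
  ultimately have gen: "generate G (Comm \<union> small (10 * k)) = carrier G"
    using mono_generate[of S "Comm \<union> small (10 * k)"] S_generates generate_incl[OF sc] by blast
  then have "generated_group G (Comm \<union> small (10 * k))"
    using sc by unfold_locales
  then show ?thesis
    unfolding hyperbolically_embedded_def
    using subgroup_Comm gen hyperbolic_coned[OF k(2,1)] finite_hat_balls sc
    by (intro conjI exI[of _ "small (10 * k)"]) auto
qed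

theorem elementary_closure_conclusions:
  "infinite_order G g" "strongly_contracting G S (generate G {g})"
  "virtually_cyclic G (elementary_closure G g)" "hyperbolically_embedded G (elementary_closure G g)"
  using infinite_order_g strongly_contracting_axis virtually_cyclic_Comm hyperbolically_embedded_Comm
  by (simp_all add: elementary_closure_eq)

end

section \<open>Reduced words and lamplighter elements\<close>

text \<open>One theory of reduced words serves twice: a fixed-point free involution on the letters
  gives a free group, and the identity gives a free product of groups of order two.\<close>

class invol =
  fixes flip :: "'a \<Rightarrow> 'a"
  assumes flip_flip [simp]: "flip (flip a) = a"

lemma flip_inject [simp]: "flip a = flip b \<longleftrightarrow> a = (b :: 'a :: invol)"
  by (metis flip_flip)

abbreviation reduced :: "'a::invol list \<Rightarrow> bool" where
  "reduced \<equiv> successively (\<lambda>a b. b \<noteq> flip a)"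

definition push :: "'a::invol \<Rightarrow> 'a list \<Rightarrow> 'a list" where
  "push a l = (case l of [] \<Rightarrow> [a] | b # l' \<Rightarrow> if b = flip a then l' else a # l)"

lemma push_simps [simp]:
  "push a [] = [a]" "push a (b # l) = (if b = flip a then l else a # b # l)"
  by (simp_all add: push_def)

lemma push_reduced: "reduced l \<Longrightarrow> reduced (push a l)"
  by (cases l) (auto simp: successively_Cons)

lemma push_flip: "reduced l \<Longrightarrow> push (flip a) (push a l) = l"
  by (cases l rule: list.exhaust; cases "tl l") (auto simp: successively_Cons)

lemma push_flip': "reduced l \<Longrightarrow> push a (push (flip a) l) = l"
  using push_flip[of l "flip a"] by simp

lemma foldr_push_reduced: "reduced v \<Longrightarrow> reduced (foldr push u v)"
  by (induction u) (auto intro: push_reduced)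

lemma foldr_push_push:
  "reduced v \<Longrightarrow> reduced w \<Longrightarrow> foldr push (push a v) w = push a (foldr push v w)"
  by (cases v) (auto simp: push_flip' foldr_push_reduced)

text \<open>Letters act on reduced words by \<open>push\<close>, with \<open>push (flip a)\<close>
  undoing \<open>push a\<close>; associativity is composition in this action, as in van der
  Waerden's proof of the normal form theorem.\<close>

lemma foldr_push_assoc:
  "reduced v \<Longrightarrow> reduced w \<Longrightarrow> foldr push (foldr push u v) w = foldr push u (foldr push v w)"
  by (induction u) (auto simp: foldr_push_push foldr_push_reduced)

lemma foldr_push_append: "reduced (u @ v) \<Longrightarrow> foldr push u v = u @ v"
proof (induction u)
  case (Cons a u)
  then have "foldr push u v = u @ v" by (auto simp: successively_Cons)
  then show ?case using Cons.prems by (cases "u @ v") auto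
qed simp

lemma foldr_push_inverse: "foldr push (rev (map flip u)) (u @ v) = v"
  by (induction u) simp_all

lemma reduced_rev_flip: "reduced u \<Longrightarrow> reduced (rev (map flip u))"
  by (simp add: successively_rev successively_map) (auto elim: successively_mono)

typedef (overloaded) 'a red = "{l :: 'a::invol list. reduced l}" morphisms lst Abs_red
  by (intro exI[of _ "[]"]) simp

setup_lifting type_definition_red

lemma reduced_lst [simp]: "reduced (lst u)"
  using lst[of u] by simp

instantiation red :: (invol) group_add
begin

lift_definition zero_red :: "'a red" is "[]" by simp
lift_definition plus_red :: "'a red \<Rightarrow> 'a red \<Rightarrow> 'a red" is "foldr push" by (rule foldr_push_reduced)
lift_definition uminus_red :: "'a red \<Rightarrow> 'a red" is "\<lambda>u. rev (map flip u)" by (rule reduced_rev_flip)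
definition minus_red :: "'a red \<Rightarrow> 'a red \<Rightarrow> 'a red" where "minus_red u v = u + - v"

instance
proof
  fix u v w :: "'a red"
  show "u + v + w = u + (v + w)" by transfer (rule foldr_push_assoc)
  show "0 + u = u" by transfer simp
  show "u + 0 = u" by transfer (use foldr_push_append[of _ "[]"] in simp)
  show "- u + u = 0" by transfer (use foldr_push_inverse[of _ "[]"] in simp)
  show "u + - v = u - v" by (simp add: minus_red_def)
qed

end

lemma lst_0 [simp]: "lst 0 = []" by (rule zero_red.rep_eq)
lemma lst_uminus: "lst (- u) = rev (map flip (lst u))" by (rule uminus_red.rep_eq)
lemma lst_plus: "lst (u + v) = foldr push (lst u) (lst v)" by (rule plus_red.rep_eq)
lemma lst_eq_iff: "lst u = lst v \<longleftrightarrow> u = v" by (rule lst_inject)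
lemma lst_eq_Nil [simp]: "lst u = [] \<longleftrightarrow> u = 0" by (metis lst_0 lst_eq_iff)

lemma lst_append: "reduced (lst u @ lst v) \<Longrightarrow> lst (u + v) = lst u @ lst v"
  by (simp add: lst_plus foldr_push_append)

lift_definition gen :: "'a::invol \<Rightarrow> 'a red" is "\<lambda>a. [a]" by simp

lemma lst_gen [simp]: "lst (gen a) = [a]" by (rule gen.rep_eq)

lemma uminus_gen: "- gen a = gen (flip a)"
  by (simp add: lst_eq_iff[symmetric] lst_uminus)

definition of_lst :: "'a::invol list \<Rightarrow> 'a red" where "of_lst = Abs_red"

lemma lst_of_lst [simp]: "reduced l \<Longrightarrow> lst (of_lst l) = l"
  by (simp add: of_lst_def Abs_red_inverse)

lemma of_lst_lst [simp]: "of_lst (lst u) = u"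
  by (simp add: of_lst_def lst_inverse)

lemma red_Cons:
  assumes "lst u = a # l"
  obtains v where "lst v = l" "u = gen a + v"
proof -
  have "reduced (a # l)" using reduced_lst[of u] assms by simp
  then have l: "reduced l" by (auto simp: successively_Cons)
  have "lst (gen a + of_lst l) = lst u"
    using lst_append[of "gen a" "of_lst l"] l \<open>reduced (a # l)\<close> assms by simp
  then have "gen a + of_lst l = u" by (rule lst_eq_iff[THEN iffD1])
  then show ?thesis using that[of "of_lst l"] l by simp
qed

lemma red_append:
  assumes "lst u = k @ l"
  obtains v w where "lst v = k" "lst w = l" "u = v + w"
proof -
  have kl: "reduced (k @ l)" using reduced_lst[of u] assms by simp
  then have r: "reduced k" "reduced l" by (auto simp: successively_append_iff)
  have "lst (of_lst k + of_lst l) = lst u"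
    using lst_append[of "of_lst k" "of_lst l"] r kl assms by simp
  then have "of_lst k + of_lst l = u" by (rule lst_eq_iff[THEN iffD1])
  then show ?thesis using that[of "of_lst k" "of_lst l"] r by simp
qed

abbreviation len :: "'a::invol red \<Rightarrow> nat" where "len u \<equiv> length (lst u)"

lemma len_uminus [simp]: "len (- u) = len u"
  by (simp add: lst_uminus)

lemma length_push: "length (push a l) \<le> Suc (length l)"
  by (cases l) auto

lemma len_plus: "len (u + v) \<le> len u + len v"
proof -
  have "length (foldr push k l) \<le> length k + length l" for k l :: "'a list"
    by (induction k) (auto intro: le_trans[OF length_push])
  then show ?thesis by (simp add: lst_plus)
qed

text \<open>The tree structure: the geodesic from u to v leaves u backwards to the branching point
  and then runs forwards to v.\<close>
lemma lst_diff:
  obtains p u' v' where "lst u = p @ u'" "lst v = p @ v'" "u' = [] \<or> v' = [] \<or> hd u' \<noteq> hd v'"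
    "lst (- u + v) = rev (map flip u') @ v'"
proof -
  obtain p u' v' where p: "lst u = p @ u'" "lst v = p @ v'" "u' = [] \<or> v' = [] \<or> hd u' \<noteq> hd v'"
    using longest_common_prefix[of "lst u" "lst v"] by (metis list.sel(1) neq_Nil_conv)
  have r: "reduced u'" "reduced v'"
    using reduced_lst[of u] reduced_lst[of v] p by (auto simp: successively_append_iff)
  have "reduced (rev (map flip u') @ v')"
    using reduced_rev_flip[OF r(1)] r(2) p(3)
    by (auto simp: successively_append_iff last_rev hd_map)
  moreover have "foldr push (rev (map flip (p @ u'))) (p @ v') = foldr push (rev (map flip u')) v'"
    by (simp add: foldr_push_inverse)
  ultimately have "lst (- u + v) = rev (map flip u') @ v'"
    by (simp add: lst_plus lst_uminus p foldr_push_append)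
  then show ?thesis using that p by blast
qed

section \<open>Half-trees\<close>

definition cyl :: "'a::invol list \<Rightarrow> 'a red set" where "cyl m = {x. prefix m (lst x)}"

lemma mem_cyl: "x \<in> cyl m \<longleftrightarrow> prefix m (lst x)" by (simp add: cyl_def)

lemma mem_cyl1: "x \<in> cyl [a] \<longleftrightarrow> x \<noteq> 0 \<and> hd (lst x) = a"
  by (cases "lst x") (auto simp: mem_cyl simp flip: lst_eq_Nil)

text \<open>The two sides of an edge of the Cayley tree; the side away from 0 is a
  \<open>cyl\<close>.\<close>

definition halftree :: "'a::invol red set \<Rightarrow> bool" where
  "halftree D \<longleftrightarrow> (\<exists>m. m \<noteq> [] \<and> (D = cyl m \<or> D = - cyl m))"

lemma halftree_cyl: "m \<noteq> [] \<Longrightarrow> halftree (cyl m)" "m \<noteq> [] \<Longrightarrow> halftree (- cyl m)"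
  by (auto simp: halftree_def)

text \<open>The edge from f to \<open>f + gen a\<close> leads away from 0 unless the word of f ends
  in \<open>flip a\<close>; in that case its far side is the one that contains 0.\<close>

lemma halftree_translate_cyl1: "halftree ((+) f ` cyl [a])"
proof -
  have mem: "x \<in> (+) f ` cyl [a] \<longleftrightarrow> - f + x \<in> cyl [a]" for x
    by (auto simp: image_iff add.assoc[symmetric] intro!: bexI[of _ "- f + x"])
  show ?thesis
  proof (cases "f \<noteq> 0 \<and> last (lst f) = flip a")
    case True
    have "x \<in> (+) f ` cyl [a] \<longleftrightarrow> x \<notin> cyl (lst f)" for x
    proof -
      obtain p f' x' where d: "lst f = p @ f'" "lst x = p @ x'" "f' = [] \<or> x' = [] \<or> hd f' \<noteq> hd x'"
        "lst (- f + x) = rev (map flip f') @ x'" by (rule lst_diff[of f x])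
      show ?thesis
      proof (cases "f' = []")
        case f': True
        have "x' = [] \<or> hd x' \<noteq> a"
          using reduced_lst[of x] d f' True by (auto simp: successively_append_iff simp flip: lst_eq_Nil)
        then have "\<not> prefix [a] (lst (- f + x))" using d f' by (cases x') auto
        then show ?thesis unfolding mem using d f' by (simp add: mem_cyl)
      next
        case f': False
        then have "last f' = flip a" using True d by simp
        then have "lst (- f + x) = a # map flip (rev (butlast f')) @ x'"
          using f' d(4) by (cases f' rule: rev_cases) (auto simp: rev_map)
        moreover have "\<not> prefix (lst f) (lst x)"
          using d f' by (cases f'; cases x') auto
        ultimately show ?thesis unfolding mem by (simp add: mem_cyl)
      qed
    qed
    then have "(+) f ` cyl [a] = - cyl (lst f)" by blast
    then show ?thesis using True halftree_cyl(2)[of "lst f"] by simp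
  next
    case False
    have "x \<in> (+) f ` cyl [a] \<longleftrightarrow> x \<in> cyl (lst f @ [a])" for x
    proof -
      obtain p f' x' where d: "lst f = p @ f'" "lst x = p @ x'" "f' = [] \<or> x' = [] \<or> hd f' \<noteq> hd x'"
        "lst (- f + x) = rev (map flip f') @ x'" by (rule lst_diff[of f x])
      show ?thesis
      proof (cases "f' = []")
        case f': False
        then have "f \<noteq> 0" using d by (auto simp flip: lst_eq_Nil)
        then have "last f' \<noteq> flip a" using False d f' by simp
        then have "hd (lst (- f + x)) \<noteq> a" "lst (- f + x) \<noteq> []"
          using f' d(4) by (auto simp: hd_append hd_rev last_map)
        then have "\<not> prefix [a] (lst (- f + x))" by (cases "lst (- f + x)") auto
        moreover have "\<not> prefix (lst f @ [a]) (lst x)"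
          using d f' by (cases f'; cases x') auto
        ultimately show ?thesis unfolding mem by (simp add: mem_cyl)
      qed (use d mem in \<open>simp add: mem_cyl\<close>)
    qed
    then have "(+) f ` cyl [a] = cyl (lst f @ [a])" by blast
    then show ?thesis using halftree_cyl[of "lst f @ [a]"] by simp
  qed
qed

lemma halftree_nested:
  assumes "halftree D" "halftree D'"
  shows "D \<subseteq> D' \<or> D' \<subseteq> D \<or> D \<inter> D' = {} \<or> D \<union> D' = UNIV"
proof -
  obtain m m' where m: "D = cyl m \<or> D = - cyl m" "D' = cyl m' \<or> D' = - cyl m'"
    using assms unfolding halftree_def by blast
  have "cyl m \<subseteq> cyl m' \<or> cyl m' \<subseteq> cyl m \<or> cyl m \<inter> cyl m' = {}"
    unfolding cyl_def using prefix_same_cases prefix_order.trans by (smt (verit) Collect_mono_iff disjoint_iff mem_Collect_eq)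
  then show ?thesis using m by blast
qed

lemma halftree_separating_finite: "finite {D. halftree D \<and> (x \<in> D) \<noteq> (y \<in> D)}"
proof -
  let ?M = "{m. prefix m (lst x)} \<union> {m. prefix m (lst y)}"
  have "finite {m. prefix m l}" for l :: "'a list"
    by (rule finite_subset[of _ "set (prefixes l)"]) auto
  then have "finite (cyl ` ?M \<union> (\<lambda>m. - cyl m) ` ?M)" by simp
  moreover have "{D. halftree D \<and> (x \<in> D) \<noteq> (y \<in> D)} \<subseteq> cyl ` ?M \<union> (\<lambda>m. - cyl m) ` ?M"
    unfolding halftree_def by (auto simp: mem_cyl)
  ultimately show ?thesis using finite_subset by blast
qed

section \<open>Free products of groups of order two and lamplighter elements\<close>

instantiation set :: (type) invol
begin
definition flip_set :: "'a set \<Rightarrow> 'a set" where [simp]: "flip_set c = c"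
instance by standard simp
end

lemma reduced_lst_set [simp]: "successively (\<lambda>c c'. c' \<noteq> c) (lst w)" for w :: "'b set red"
  using reduced_lst[of w] by (simp del: reduced_lst)

lemma inj_image_plus: "inj ((`) ((+) (f :: 'a::group_add)))"
  by (rule injI) (simp add: inj_image_eq_iff)

lemma diff_cancel_left: "- (f + p) + (f + q) = - p + q" for f p q :: "'a::group_add"
  by (simp add: minus_add add.assoc diff_conv_add_uminus del: add_uminus_conv_diff)

lemma reduced_map_translate: "reduced (map ((`) ((+) f)) l) \<longleftrightarrow> reduced l"
  for l :: "'a::group_add set list"
  by (simp add: successively_map inj_eq[OF inj_image_plus])

lift_definition act :: "'a::group_add \<Rightarrow> 'a set red \<Rightarrow> 'a set red" is "\<lambda>f. map ((`) ((+) f))"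
  by (simp only: reduced_map_translate)

lemma lst_act: "lst (act f w) = map ((`) ((+) f)) (lst w)"
  by (rule act.rep_eq)

lemma map_push_translate:
  "map ((`) ((+) f)) (push c l) = push ((+) f ` c) (map ((`) ((+) f)) l)"
  for c :: "'a::group_add set"
  by (cases l) (auto dest: injD[OF inj_image_plus])

lemma act_add: "act f (u + v) = act f u + act f v"
proof -
  have "map ((`) ((+) f)) (foldr push k l) = foldr push (map ((`) ((+) f)) k) (map ((`) ((+) f)) l)"
    for k l by (induction k) (simp_all add: map_push_translate)
  then show ?thesis by (simp add: lst_eq_iff[symmetric] lst_act lst_plus)
qed

lemma act_0 [simp]: "act f 0 = 0"
  by (simp add: lst_eq_iff[symmetric] lst_act del: lst_eq_Nil)

lemma act_0_left [simp]: "act (0 :: 'a::group_add) w = w"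
proof -
  have "map ((`) ((+) (0::'a))) l = l" for l by (rule map_idI) auto
  then show ?thesis by (simp add: lst_eq_iff[symmetric] lst_act)
qed

lemma act_act: "act f (act h w) = act (f + h) w"
  by (simp add: lst_eq_iff[symmetric] lst_act image_image add.assoc)

lemma act_uminus: "act f (- w) = - act f w"
  by (simp add: lst_eq_iff[symmetric] lst_act lst_uminus rev_map)

lemma act_gen: "act f (gen c) = gen ((+) f ` c)"
  by (simp add: lst_eq_iff[symmetric] lst_act)

text \<open>The semidirect product of the free product of copies of Z/2 indexed by sets with the
  group acting on these sets by translation.\<close>
datatype 'a lamp = Lamp (stk: "'a set red") (loc: 'a)

instantiation lamp :: (group_add) group_add
begin

definition "0 = Lamp 0 0"
definition "x + y = Lamp (stk x + act (loc x) (stk y)) (loc x + loc y)"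
definition "- x = Lamp (act (- loc x) (- stk x)) (- loc x)"
definition "x - y = x + - (y :: 'a lamp)"

instance
  by standard (simp_all add: zero_lamp_def plus_lamp_def uminus_lamp_def minus_lamp_def
      act_add act_act add.assoc act_uminus)

end

lemma lamp_simps [simp]:
  "stk (x + y) = stk x + act (loc x) (stk y)" "loc (x + y) = loc x + loc y"
  "stk 0 = 0" "loc 0 = 0" "loc (- x) = - loc x" "stk (- x) = - act (- loc x) (stk x)"
  by (simp_all add: zero_lamp_def plus_lamp_def uminus_lamp_def act_uminus)

lemma stk_diff: "stk (- x + y) = act (- loc x) (- stk x + stk y)"
  by (simp add: act_add act_uminus)

lemma lst_uminus_set: "lst (- w) = rev (lst w)" for w :: "'a set red"
proof -
  have "map flip l = l" for l :: "'a set list" by (induction l) auto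
  then show ?thesis by (simp add: lst_uminus)
qed

text \<open>Length of a shortest path from p to q that visits the sets in w in this order.\<close>
primrec cst :: "'a::invol red \<Rightarrow> 'a red set list \<Rightarrow> 'a red \<Rightarrow> nat" where
  "cst p [] q = len (- p + q)"
| "cst p (c # w) q = (INF r\<in>c. len (- p + r) + cst r w q)"

lemma cst_Cons_le: "r \<in> c \<Longrightarrow> cst p (c # w) q \<le> len (- p + r) + cst r w q"
  by (auto intro!: cINF_lower)

lemma cst_Cons_ex:
  assumes "c \<noteq> {}"
  obtains r where "r \<in> c" "cst p (c # w) q = len (- p + r) + cst r w q"
proof -
  have "Inf ((\<lambda>r. len (- p + r) + cst r w q) ` c) \<in> (\<lambda>r. len (- p + r) + cst r w q) ` c"
    using assms by (intro Inf_nat_def1) simp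
  then show ?thesis using that by auto
qed

section \<open>Inequalities for the travelling cost\<close>

lemma len_triangle: "len (- p + q) \<le> len (- p + r) + len (- r + q)" for p q r :: "'a::invol red"
  using len_plus[of "- p + r" "- r + q"] by (simp add: add.assoc)

lemma len_sym: "len (- p + q) = len (- q + p)" for p q :: "'a::invol red"
  using len_uminus[of "- p + q"] by (simp add: minus_add)

text \<open>An optimal path from r is preceded by the way from p to r. Excluding empty sets, here
  and below, guarantees that the infima are attained.\<close>

lemma cst_drop:
  assumes "{} \<notin> set w"
  shows "cst p w q \<le> len (- p + r) + cst r w q"
proof (cases w)
  case (Cons c w')
  then obtain s where s: "s \<in> c" "cst r (c # w') q = len (- r + s) + cst s w' q"
    using cst_Cons_ex assms by (metis list.set_intros(1))
  have "cst p (c # w') q \<le> len (- p + s) + cst s w' q" using cst_Cons_le s by blast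
  also have "\<dots> \<le> len (- p + r) + len (- r + s) + cst s w' q" using len_triangle by simp
  finally show ?thesis using s Cons by simp
qed (use len_triangle in simp)

lemma cst_append_le:
  assumes "r \<in> c" "{} \<notin> set u"
  shows "cst p (u @ c # v) q \<le> cst p u r + cst r v q"
  using assms(2)
proof (induction u arbitrary: p)
  case Nil
  then show ?case using cst_Cons_le[OF assms(1)] by simp
next
  case (Cons b u)
  then obtain s where s: "s \<in> b" "cst p (b # u) r = len (- p + s) + cst s u r"
    using cst_Cons_ex by (metis list.set_intros(1))
  have "cst p (b # (u @ c # v)) q \<le> len (- p + s) + cst s (u @ c # v) q"
    using s by (intro cst_Cons_le)
  moreover have "cst s (u @ c # v) q \<le> cst s u r + cst r v q" using Cons by simp
  ultimately show ?case using s by simp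
qed

lemma cst_append_ex:
  assumes "c \<noteq> {}" "{} \<notin> set u"
  shows "\<exists>r\<in>c. cst p (u @ c # v) q = cst p u r + cst r v q"
  using assms(2)
proof (induction u arbitrary: p)
  case Nil
  then show ?case using cst_Cons_ex[OF assms(1)] by (metis append_Nil cst.simps(1))
next
  case (Cons b u)
  then have "b \<noteq> {}" by auto
  then obtain s where s: "s \<in> b" "cst p (b # u @ c # v) q = len (- p + s) + cst s (u @ c # v) q"
    using cst_Cons_ex by blast
  obtain r where r: "r \<in> c" "cst s (u @ c # v) q = cst s u r + cst r v q" using Cons by auto
  have "cst p (b # u) r \<le> len (- p + s) + cst s u r" using s by (intro cst_Cons_le)
  moreover have "cst p ((b # u) @ c # v) q \<le> cst p (b # u) r + cst r v q"
    using Cons.prems r by (intro cst_append_le)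
  ultimately show ?case using s r by (intro bexI[of _ r]) auto
qed

text \<open>The intermediate point r need not belong to a set of the list: it is only a detour, so
  this serves the triangle inequality, while \<open>cst_append_le\<close> serves cuts at a visited
  set.\<close>

lemma cst_append_free:
  assumes "{} \<notin> set u" "{} \<notin> set v"
  shows "cst p (u @ v) q \<le> cst p u r + cst r v q"
  using assms(1)
proof (induction u arbitrary: p)
  case Nil
  then show ?case using cst_drop[OF assms(2)] by simp
next
  case (Cons b u)
  then obtain s where s: "s \<in> b" "cst p (b # u) r = len (- p + s) + cst s u r"
    using cst_Cons_ex by (metis list.set_intros(1))
  have "cst p (b # (u @ v)) q \<le> len (- p + s) + cst s (u @ v) q"
    using s by (intro cst_Cons_le)
  moreover have "cst s (u @ v) q \<le> cst s u r + cst r v q" using Cons by simp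
  ultimately show ?case using s by simp
qed

text \<open>When two equal sets cancel, a path for the longer list is also a path for the shorter
  one; so reduction never raises the cost.\<close>

lemma cst_push:
  assumes "{} \<notin> set v" "c \<noteq> {}"
  shows "cst p (push c v) q \<le> cst p (c # v) q"
proof (cases "v \<noteq> [] \<and> hd v = c")
  case True
  then obtain v' where v: "v = c # v'" by (cases v) auto
  have "cst p v' q \<le> cst p (c # c # v') q"
  proof -
    obtain r where r: "r \<in> c" "cst p (c # c # v') q = len (- p + r) + cst r (c # v') q"
      using cst_Cons_ex[OF assms(2)] by blast
    obtain s where s: "s \<in> c" "cst r (c # v') q = len (- r + s) + cst s v' q"
      using cst_Cons_ex[OF assms(2)] by blast
    have "cst p v' q \<le> len (- p + s) + cst s v' q" using assms v by (intro cst_drop) auto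
    then show ?thesis using r s len_triangle[of p s r] by simp
  qed
  then show ?thesis using v by simp
next
  case False
  then show ?thesis by (cases v) auto
qed

lemma set_push: "set (push c v) \<subseteq> insert c (set v)"
  by (cases v) auto

lemma set_foldr_push: "set (foldr push u v) \<subseteq> set u \<union> set v"
proof (induction u)
  case (Cons a u)
  then show ?case using set_push[of a "foldr push u v"] by auto
qed simp

lemma cst_foldr_push:
  assumes "{} \<notin> set u" "{} \<notin> set v"
  shows "cst p (foldr push u v) q \<le> cst p (u @ v) q"
  using assms(1)
proof (induction u arbitrary: p)
  case (Cons c u)
  have ne: "{} \<notin> set (foldr push u v)" "c \<noteq> {}"
    using Cons.prems assms set_foldr_push[of u v] by auto
  have "cst p (push c (foldr push u v)) q \<le> cst p (c # foldr push u v) q"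
    using ne by (intro cst_push)
  also have "\<dots> \<le> cst p (c # (u @ v)) q"
  proof -
    obtain r where r: "r \<in> c" "cst p (c # (u @ v)) q = len (- p + r) + cst r (u @ v) q"
      using cst_Cons_ex[OF ne(2)] by blast
    have "cst p (c # foldr push u v) q \<le> len (- p + r) + cst r (foldr push u v) q"
      using r by (intro cst_Cons_le)
    moreover have "cst r (foldr push u v) q \<le> cst r (u @ v) q" using Cons by simp
    ultimately show ?thesis using r by simp
  qed
  finally show ?case by simp
qed simp

lemma cst_translate: "cst (f + p) (map ((`) ((+) f)) w) (f + q) = cst p w q"
proof (induction w arbitrary: p)
  case Nil
  then show ?case by (simp add: diff_cancel_left)
next
  case (Cons c w)
  have "(\<lambda>r. len (- (f + p) + r) + cst r (map ((`) ((+) f)) w) (f + q)) ` (+) f ` c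
    = (\<lambda>r. len (- p + r) + cst r w q) ` c"
    using Cons by (simp add: image_image diff_cancel_left)
  then show ?case by simp
qed

text \<open>Changing sheets at a point of the coset concerned is free, so only the travel in the
  tree is charged. On the double this is the word length for \<open>SG\<close>.\<close>

definition nrm :: "'a::invol red lamp \<Rightarrow> nat" where "nrm x = cst 0 (lst (stk x)) (loc x)"

definition dst :: "'a::invol red lamp \<Rightarrow> 'a red lamp \<Rightarrow> nat" where
  "dst x y = cst (loc x) (lst (- stk x + stk y)) (loc y)"

lemma nrm_diff: "nrm (- x + y) = dst x y"
proof -
  have "nrm (- x + y) = cst (- loc x + loc x) (map ((`) ((+) (- loc x))) (lst (- stk x + stk y))) (- loc x + loc y)"
    by (simp add: nrm_def stk_diff lst_act del: lamp_simps(1))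
  then show ?thesis unfolding dst_def cst_translate .
qed

definition legal :: "'a::invol red lamp \<Rightarrow> bool" where "legal x \<longleftrightarrow> {} \<notin> set (lst (stk x))"

lemma dst_translate: "dst (a + x) (a + y) = dst x y"
  by (simp add: nrm_diff[symmetric] diff_cancel_left)

lemma ne_diff:
  assumes "legal x" "legal y"
  shows "{} \<notin> set (lst (- stk x + stk y))"
  using assms set_foldr_push[of "lst (- stk x)" "lst (stk y)"]
  by (auto simp: legal_def lst_plus lst_uminus_set)

text \<open>Concatenating two paths visits the unreduced product of the two lists, and reducing it
  does not raise the cost.\<close>

lemma dst_triangle:
  assumes "legal x" "legal y" "legal z"
  shows "dst x z \<le> dst x y + dst y z"
proof -
  let ?u = "- stk x + stk y" and ?v = "- stk y + stk z"
  have "- stk x + stk z = ?u + ?v" by (simp add: add.assoc)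
  then have "dst x z = cst (loc x) (foldr push (lst ?u) (lst ?v)) (loc z)"
    by (simp only: dst_def lst_plus[of ?u ?v])
  also have "\<dots> \<le> cst (loc x) (lst ?u @ lst ?v) (loc z)"
    using ne_diff assms by (intro cst_foldr_push)
  also have "\<dots> \<le> cst (loc x) (lst ?u) (loc y) + cst (loc y) (lst ?v) (loc z)"
    using ne_diff assms by (intro cst_append_free)
  finally show ?thesis by (simp add: dst_def)
qed

section \<open>Groups with a word length, copied to the natural numbers\<close>

text \<open>Transport to the naturals puts all groups of the family into one type, whatever type
  they are constructed in.\<close>

definition nat_copy :: "'b::group_add set \<Rightarrow> nat monoid" where
  "nat_copy H = \<lparr>carrier = to_nat_on H ` H,
     monoid.mult = (\<lambda>m n. to_nat_on H (from_nat_into H m + from_nat_into H n)), one = to_nat_on H 0\<rparr>"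

primrec nmul :: "nat \<Rightarrow> 'b::monoid_add \<Rightarrow> 'b" where
  "nmul 0 g = 0" | "nmul (Suc n) g = nmul n g + g"

text \<open>The last two assumptions characterise \<open>ell\<close> as the word length for the
  symmetric set S.\<close>

locale length_group =
  fixes H :: "'b::group_add set" and S :: "'b set" and ell :: "'b \<Rightarrow> nat"
  assumes zero_H: "0 \<in> H" and add_H: "\<And>x y. x \<in> H \<Longrightarrow> y \<in> H \<Longrightarrow> x + y \<in> H"
    and uminus_H: "\<And>x. x \<in> H \<Longrightarrow> - x \<in> H"
    and S_H: "S \<subseteq> H" and finite_S: "finite S" and S_sym: "\<And>s. s \<in> S \<Longrightarrow> - s \<in> S"
    and ell_word: "\<And>x. x \<in> H \<Longrightarrow> \<exists>ws. set ws \<subseteq> S \<and> length ws = ell x \<and> sum_list ws = x"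
    and ell_le: "\<And>ws. set ws \<subseteq> S \<Longrightarrow> ell (sum_list ws) \<le> length ws"
begin

abbreviation NG :: "nat monoid" where "NG \<equiv> nat_copy H"
abbreviation enc :: "'b \<Rightarrow> nat" where "enc \<equiv> to_nat_on H"

lemma countable_H: "countable H"
proof -
  have "countable (sum_list ` lists S)"
    using finite_S by (intro countable_image countable_lists countable_finite)
  moreover have "H \<subseteq> sum_list ` lists S"
  proof
    fix x assume "x \<in> H"
    then obtain ws where "set ws \<subseteq> S" "sum_list ws = x" using ell_word by blast
    then show "x \<in> sum_list ` lists S" by (intro image_eqI[of _ _ ws]) (auto simp: in_lists_conv_set)
  qed
  ultimately show ?thesis using countable_subset by blast
qed

lemma dec_enc [simp]: "x \<in> H \<Longrightarrow> from_nat_into H (enc x) = x"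
  using countable_H by simp

lemma enc_inject: "x \<in> H \<Longrightarrow> y \<in> H \<Longrightarrow> enc x = enc y \<longleftrightarrow> x = y"
  using countable_H by (simp add: to_nat_on_inj)

lemma NG_simps [simp]: "carrier NG = enc ` H" "\<one>\<^bsub>NG\<^esub> = enc 0"
  by (simp_all add: nat_copy_def)

lemma NG_mult [simp]: "x \<in> H \<Longrightarrow> y \<in> H \<Longrightarrow> enc x \<otimes>\<^bsub>NG\<^esub> enc y = enc (x + y)"
  by (simp add: nat_copy_def)

lemma group_NG: "group NG"
proof (rule groupI)
  fix x assume "x \<in> carrier NG"
  then obtain a where "a \<in> H" "x = enc a" by auto
  then show "\<exists>y\<in>carrier NG. y \<otimes>\<^bsub>NG\<^esub> x = \<one>\<^bsub>NG\<^esub>"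
    using uminus_H by (intro bexI[of _ "enc (- a)"]) auto
qed (auto simp: zero_H add_H add.assoc)

lemma NG_inv [simp]: "x \<in> H \<Longrightarrow> inv\<^bsub>NG\<^esub> enc x = enc (- x)"
  by (rule group.inv_equality[OF group_NG]) (auto simp: uminus_H)

lemma NG_pow: "g \<in> H \<Longrightarrow> enc g [^]\<^bsub>NG\<^esub> (n::nat) = enc (nmul n g) \<and> nmul n g \<in> H"
proof (induction n)
  case 0
  show ?case by (simp add: zero_H nat_pow_def)
next
  case (Suc n)
  then show ?case by (simp add: add_H)
qed

lemma sum_list_H: "set ws \<subseteq> H \<Longrightarrow> sum_list ws \<in> H"
  by (induction ws) (auto simp: zero_H add_H)

lemma foldr_NG: "set ws \<subseteq> H \<Longrightarrow> foldr (monoid.mult NG) (map enc ws) (monoid.one NG) = enc (sum_list ws)"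
  by (induction ws) (auto simp: sum_list_H)

lemma letters_NG: "enc ` S \<union> m_inv NG ` (enc ` S) = enc ` S"
proof -
  have "m_inv NG ` (enc ` S) \<subseteq> enc ` S" using S_H S_sym by (auto simp: subset_iff)
  then show ?thesis by blast
qed

lemma generate_NG: "generate NG (enc ` S) = carrier NG"
proof -
  interpret NG: group NG by (rule group_NG)
  have "enc (sum_list ws) \<in> generate NG (enc ` S)" if "set ws \<subseteq> S" for ws using that
  proof (induction ws)
    case Nil
    then show ?case using generate.one[of NG] by simp
  next
    case (Cons s ws)
    then have "s \<in> H" "sum_list ws \<in> H" using S_H by (auto intro: sum_list_H)
    then have "enc (sum_list (s # ws)) = enc s \<otimes>\<^bsub>NG\<^esub> enc (sum_list ws)" by simp
    moreover have "enc s \<in> generate NG (enc ` S)" using Cons.prems by (intro generate.incl) auto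
    moreover have "enc (sum_list ws) \<in> generate NG (enc ` S)" using Cons by auto
    ultimately show ?case by (simp only: generate.eng)
  qed
  then have "enc x \<in> generate NG (enc ` S)" if "x \<in> H" for x using ell_word[OF that] by blast
  moreover have "generate NG (enc ` S) \<subseteq> carrier NG" using S_H by (intro NG.generate_incl) auto
  ultimately show ?thesis by auto
qed

lemma generated_group_NG: "generated_group NG (enc ` S)"
  using group_NG generate_NG S_H
  by (intro generated_group.intro generated_group_axioms.intro) auto

lemma cay_dist_NG:
  assumes "x \<in> H" "y \<in> H"
  shows "cay_dist NG (enc ` S) (enc x) (enc y) = ell (- x + y)"
proof -
  interpret NG: generated_group NG "enc ` S" by (rule generated_group_NG)
  have let_eq: "NG.letters = enc ` S" unfolding NG.letters_def by (rule letters_NG)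
  have wp: "NG.wprod (map enc ws) = enc (sum_list ws)" if "set ws \<subseteq> H" for ws
    using foldr_NG[OF that] by (simp only: NG.wprod_def)
  have xy: "- x + y \<in> H" using assms add_H uminus_H by blast
  show ?thesis
  proof (rule antisym)
    obtain ws where ws: "set ws \<subseteq> S" "length ws = ell (- x + y)" "sum_list ws = - x + y"
      using ell_word[OF xy] by blast
    have "cay_dist NG (enc ` S) (enc x) (enc y) \<le> length (map enc ws)"
    proof (rule NG.d_le_word)
      show "set (map enc ws) \<subseteq> NG.letters" unfolding let_eq using ws by auto
      have "set ws \<subseteq> H" using ws S_H by blast
      then show "enc x \<otimes>\<^bsub>NG\<^esub> NG.wprod (map enc ws) = enc y"
        using wp ws assms xy by (simp add: add.assoc[symmetric])
    qed
    then show "cay_dist NG (enc ` S) (enc x) (enc y) \<le> ell (- x + y)" using ws by simp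
  next
    obtain us where us: "length us = cay_dist NG (enc ` S) (enc x) (enc y)" "set us \<subseteq> NG.letters"
      "enc x \<otimes>\<^bsub>NG\<^esub> NG.wprod us = enc y"
      using NG.d_word[of "enc x" "enc y"] assms by auto
    define ws where "ws = map (from_nat_into H) us"
    have "\<forall>u\<in>set us. \<exists>s\<in>S. u = enc s" using us(2) unfolding let_eq by auto
    then have ws: "set ws \<subseteq> S" "map enc ws = us"
      unfolding ws_def using S_H by (auto simp: subset_iff intro!: map_idI)
    then have wH: "set ws \<subseteq> H" using S_H by blast
    have "enc (x + sum_list ws) = enc y"
      using us(3) wp[OF wH] ws assms sum_list_H[OF wH] by simp
    then have "x + sum_list ws = y" using enc_inject add_H assms sum_list_H[OF wH] by blast
    then have "sum_list ws = - x + y" by (auto simp: add.assoc[symmetric])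
    then show "ell (- x + y) \<le> cay_dist NG (enc ` S) (enc x) (enc y)"
      using ell_le[OF ws(1)] us(1) by (simp add: ws_def)
  qed
qed

text \<open>The hypotheses of the locale for half-space axes, read in the ambient group; the translate
  by f of E contains x iff - f + x is in E.\<close>
definition axis_half_space :: "'b \<Rightarrow> 'b set \<Rightarrow> bool" where
  "axis_half_space g E \<longleftrightarrow>
    (\<forall>x\<in>H. x \<in> E \<longrightarrow> g + x \<in> E) \<and> (\<exists>x\<in>H. x \<in> E \<and> - g + x \<notin> E) \<and>
    (\<forall>f\<in>H. (\<forall>x\<in>H. - f + x \<in> E \<longrightarrow> x \<in> E) \<or> (\<forall>x\<in>H. x \<in> E \<longrightarrow> - f + x \<in> E) \<or>
       (\<forall>x\<in>H. x \<in> E \<longrightarrow> - f + x \<notin> E) \<or> (\<forall>x\<in>H. x \<in> E \<or> - f + x \<in> E)) \<and>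
    (\<forall>x\<in>H. \<forall>y\<in>H. finite {{z \<in> H. - f + z \<in> E} | f. f \<in> H \<and> (- f + x \<in> E) \<noteq> (- f + y \<in> E)}) \<and>
    (\<exists>N C. \<forall>x\<in>H. \<forall>y\<in>H. x \<notin> E \<longrightarrow> - nmul N g + y \<in> E \<longrightarrow> ell (- x) + ell y \<le> ell (- x + y) + C)"

lemma half_space_axis_NG:
  assumes g: "g \<in> H" and good: "axis_half_space g E"
  shows "\<exists>N C. half_space_axis NG (enc ` S) (enc g) (enc ` (E \<inter> H)) N C"
proof -
  interpret NG: generated_group NG "enc ` S" by (rule generated_group_NG)
  note gd = good[unfolded axis_half_space_def]
  obtain N C where NC: "\<forall>x\<in>H. \<forall>y\<in>H. x \<notin> E \<longrightarrow> - nmul N g + y \<in> E \<longrightarrow> ell (- x) + ell y \<le> ell (- x + y) + C"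
    using gd by blast
  let ?E = "enc ` (E \<inter> H)"
  have mem: "enc x \<in> ?E \<longleftrightarrow> x \<in> E" if "x \<in> H" for x
    using that enc_inject by (auto simp: image_iff)
  have memtr: "enc x \<in> NG.translate (enc f) ?E \<longleftrightarrow> - f + x \<in> E" if "f \<in> H" "x \<in> H" for f x
  proof -
    have "- f + x \<in> H" using that add_H uminus_H by blast
    then have "enc (- f + x) \<in> ?E \<longleftrightarrow> - f + x \<in> E" by (rule mem)
    then show ?thesis using that uminus_H by (simp add: NG.translate_def)
  qed
  have tr: "NG.translate (enc f) ?E = enc ` {z \<in> H. - f + z \<in> E}" if "f \<in> H" for f
  proof -
    have "NG.translate (enc f) ?E \<subseteq> enc ` H" by (auto simp: NG.translate_def)
    then show ?thesis using memtr[OF that] by blast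
  qed
  have "half_space_axis NG (enc ` S) (enc g) ?E N C"
  proof (intro half_space_axis.intro generated_group_NG half_space_axis_axioms.intro)
    show "finite (enc ` S)" using finite_S by simp
    show "enc g \<in> carrier NG" using g by simp
    show "?E \<subseteq> carrier NG" by auto
    show "NG.translate (enc g) ?E \<subset> ?E"
    proof
      show "NG.translate (enc g) ?E \<subseteq> ?E"
      proof
        fix n assume "n \<in> NG.translate (enc g) ?E"
        then obtain z where z: "z \<in> H" "n = enc z" "- g + z \<in> E" using tr[OF g] by auto
        have "- g + z \<in> H" using z g add_H uminus_H by blast
        then have "g + (- g + z) \<in> E" using gd z by blast
        then show "n \<in> ?E" using z mem by (simp add: add.assoc[symmetric])
      qed
      obtain x where "x \<in> H" "x \<in> E" "- g + x \<notin> E" using gd by blast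
      then show "NG.translate (enc g) ?E \<noteq> ?E" using mem memtr g by blast
    qed
  next
    fix f assume "f \<in> carrier NG"
    then obtain f' where f: "f' \<in> H" "f = enc f'" by auto
    have sub: "NG.translate f ?E \<subseteq> enc ` H" using tr f by auto
    consider "\<forall>x\<in>H. - f' + x \<in> E \<longrightarrow> x \<in> E" | "\<forall>x\<in>H. x \<in> E \<longrightarrow> - f' + x \<in> E"
      | "\<forall>x\<in>H. x \<in> E \<longrightarrow> - f' + x \<notin> E" | "\<forall>x\<in>H. x \<in> E \<or> - f' + x \<in> E"
      using gd f by blast
    then show "NG.translate f ?E \<subseteq> ?E \<or> ?E \<subseteq> NG.translate f ?E \<or>
      NG.translate f ?E \<inter> ?E = {} \<or> NG.translate f ?E \<union> ?E = carrier NG"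
    proof cases
      case 1
      then have "NG.translate f ?E \<subseteq> ?E" using sub memtr f mem by blast
      then show ?thesis by blast
    next
      case 2
      then have "?E \<subseteq> NG.translate f ?E" using memtr f mem by blast
      then show ?thesis by blast
    next
      case 3
      then have "NG.translate f ?E \<inter> ?E = {}" using memtr f mem by blast
      then show ?thesis by blast
    next
      case 4
      then have "carrier NG \<subseteq> NG.translate f ?E \<union> ?E" using memtr f mem by auto
      then show ?thesis using sub by auto
    qed
  next
    fix x y assume "x \<in> carrier NG" "y \<in> carrier NG"
    then obtain x' y' where xy: "x' \<in> H" "x = enc x'" "y' \<in> H" "y = enc y'" by auto
    have "{D. (\<exists>f\<in>carrier NG. D = NG.translate f ?E) \<and> (x \<in> D) \<noteq> (y \<in> D)}
      \<subseteq> (\<lambda>D. enc ` D) ` {{z \<in> H. - f + z \<in> E} | f. f \<in> H \<and> (- f + x' \<in> E) \<noteq> (- f + y' \<in> E)}"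
    proof
      fix D assume "D \<in> {D. (\<exists>f\<in>carrier NG. D = NG.translate f ?E) \<and> (x \<in> D) \<noteq> (y \<in> D)}"
      then obtain f where f: "f \<in> H" "D = NG.translate (enc f) ?E" "(x \<in> D) \<noteq> (y \<in> D)" by auto
      then have "(- f + x' \<in> E) \<noteq> (- f + y' \<in> E)" using memtr xy by simp
      then show "D \<in> (\<lambda>D. enc ` D) ` {{z \<in> H. - f + z \<in> E} | f. f \<in> H \<and> (- f + x' \<in> E) \<noteq> (- f + y' \<in> E)}"
        using f tr by blast
    qed
    moreover have "finite {{z \<in> H. - f + z \<in> E} | f. f \<in> H \<and> (- f + x' \<in> E) \<noteq> (- f + y' \<in> E)}"
      using gd xy by blast
    ultimately show "finite {D. (\<exists>f\<in>carrier NG. D = NG.translate f ?E) \<and> (x \<in> D) \<noteq> (y \<in> D)}"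
      using finite_subset by blast
  next
    fix x y assume "x \<in> carrier NG" "y \<in> carrier NG"
      and nx: "x \<notin> ?E" and iy: "y \<in> NG.translate (enc g [^]\<^bsub>NG\<^esub> N) ?E"
    then obtain x' y' where xy: "x' \<in> H" "x = enc x'" "y' \<in> H" "y = enc y'" by auto
    have "x' \<notin> E" using nx xy mem by simp
    moreover have "- nmul N g + y' \<in> E" using iy xy memtr NG_pow[OF g] by simp
    ultimately have "ell (- x') + ell y' \<le> ell (- x' + y') + C" using NC xy by blast
    then show "NG.d x \<one>\<^bsub>NG\<^esub> + NG.d \<one>\<^bsub>NG\<^esub> y \<le> NG.d x y + C"
      using xy zero_H by (simp add: cay_dist_NG)
  qed
  then show ?thesis by blast
qed

theorem NG_conclusions:
  assumes good: "\<And>g. g \<in> H \<Longrightarrow> g \<noteq> 0 \<Longrightarrow> \<exists>E. axis_half_space g E"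
  shows "torsion_free NG"
    and "\<forall>g\<in>carrier NG. g \<noteq> \<one>\<^bsub>NG\<^esub> \<longrightarrow> strongly_contracting NG (enc ` S) (generate NG {g})"
    and "HEC NG"
proof -
  have concl: "infinite_order NG g \<and> strongly_contracting NG (enc ` S) (generate NG {g}) \<and>
    virtually_cyclic NG (elementary_closure NG g) \<and> hyperbolically_embedded NG (elementary_closure NG g)"
    if g: "g \<in> carrier NG" "g \<noteq> \<one>\<^bsub>NG\<^esub>" for g
  proof -
    obtain h where h: "h \<in> H" "g = enc h" "h \<noteq> 0" using g by auto
    obtain E where E: "axis_half_space h E" using good h by blast
    obtain N C where "half_space_axis NG (enc ` S) (enc h) (enc ` (E \<inter> H)) N C"
      using half_space_axis_NG[OF h(1) E] by blast
    from half_space_axis.elementary_closure_conclusions[OF this] show ?thesis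
      unfolding h(2) by (intro conjI)
  qed
  show "torsion_free NG" unfolding torsion_free_def using concl by blast
  show "\<forall>g\<in>carrier NG. g \<noteq> \<one>\<^bsub>NG\<^esub> \<longrightarrow> strongly_contracting NG (enc ` S) (generate NG {g})"
    using concl by blast
  have "g \<noteq> \<one>\<^bsub>NG\<^esub>" if "infinite_order NG g" for g
  proof
    interpret NG: group NG by (rule group_NG)
    assume "g = \<one>\<^bsub>NG\<^esub>"
    then have "g [^]\<^bsub>NG\<^esub> (1::nat) = \<one>\<^bsub>NG\<^esub>" using NG.nat_pow_one by blast
    then show False using that unfolding infinite_order_def using zero_less_one by blast
  qed
  then show "HEC NG" unfolding HEC_def using concl by blast
qed

end

section \<open>The double of a free group along a subgroup\<close>

text \<open>Each \<open>push\<close> changes the length by one, up or down, so the length modulo two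
  is a homomorphism. It will single out the double as a subgroup of index two.\<close>

lemma even_len_plus: "even (len (u + v)) \<longleftrightarrow> (even (len u) \<longleftrightarrow> even (len v))" for u v :: "'a::invol red"
proof -
  have "even (length (push a l)) \<longleftrightarrow> odd (length l)" for a and l :: "'a list"
    by (cases l) auto
  then have "even (length (foldr push k l)) \<longleftrightarrow> (even (length k) \<longleftrightarrow> even (length l))" for k l :: "'a list"
    by (induction k) auto
  then show ?thesis by (simp add: lst_plus)
qed

lemma sum_list_gen: "sum_list (map gen (lst u)) = u"
proof (induction "lst u" arbitrary: u)
  case (Cons a l)
  obtain v where v: "lst v = l" "u = gen a + v" using red_Cons Cons(2) by metis
  have u: "lst u = a # lst v" using Cons(2) v by simp
  have "sum_list (map gen (lst v)) = v" by (rule Cons(1)[OF v(1)[symmetric]])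
  then show ?case unfolding u using v(2) by simp
qed (simp flip: lst_eq_Nil)

section \<open>The double and its word length\<close>

locale double_group =
  fixes A :: "'a::{invol,finite} red set"
  assumes A_zero: "0 \<in> A" and A_add: "\<And>u v. u \<in> A \<Longrightarrow> v \<in> A \<Longrightarrow> u + v \<in> A"
    and A_uminus: "\<And>u. u \<in> A \<Longrightarrow> - u \<in> A"
begin

definition coset :: "'a red \<Rightarrow> 'a red set" where "coset f = (+) f ` A"

lemma mem_coset: "x \<in> coset f \<longleftrightarrow> - f + x \<in> A"
  by (auto simp: coset_def image_iff add.assoc[symmetric] intro!: bexI[of _ "- f + x"])

lemma coset_self: "f \<in> coset f"
  using A_zero by (simp add: mem_coset)

lemma coset_eq: "r \<in> coset f \<Longrightarrow> coset r = coset f"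
proof -
  assume "r \<in> coset f"
  then have r: "- f + r \<in> A" by (simp add: mem_coset)
  have "- r + f \<in> A" using A_uminus[OF r] by (simp add: minus_add)
  show ?thesis
  proof (intro equalityI subsetI)
    fix x assume "x \<in> coset r"
    then show "x \<in> coset f" using A_add[OF r, of "- r + x"] by (simp add: mem_coset add.assoc)
  next
    fix x assume "x \<in> coset f"
    then show "x \<in> coset r" using A_add[OF \<open>- r + f \<in> A\<close>, of "- f + x"] by (simp add: mem_coset add.assoc)
  qed
qed

lemma coset_eq_iff: "coset f = coset h \<longleftrightarrow> - f + h \<in> A"
  using coset_eq[of h f] coset_self[of h] by (auto simp: mem_coset)

lemma coset_translate: "(+) h ` coset f = coset (h + f)"
  by (simp add: coset_def image_image add.assoc)

lemma coset_0: "coset 0 = A" by (simp add: coset_def)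

lemma coset_ne: "coset f \<noteq> {}" using coset_self by blast

text \<open>The amalgam of F with A x Z/2 along A: only cosets of A may be stacked, and translations
  permute these.\<close>

definition Full :: "'a red lamp set" where "Full = {x. set (lst (stk x)) \<subseteq> range coset}"

text \<open>The kernel of the parity of t, that is, the amalgam along A of F and its conjugate by
  t.\<close>

definition GA :: "'a red lamp set" where "GA = {x \<in> Full. even (len (stk x))}"

lemma GA_Full: "x \<in> GA \<Longrightarrow> x \<in> Full" by (simp add: GA_def)

lemma Full_legal: "x \<in> Full \<Longrightarrow> legal x"
  using coset_ne by (fastforce simp: Full_def legal_def)

lemma Full_zero: "0 \<in> Full" by (simp add: Full_def)

lemma set_act: "set (lst (act f w)) \<subseteq> range coset \<longleftrightarrow> set (lst w) \<subseteq> range coset"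
proof -
  have le: "set (lst (act f w)) \<subseteq> range coset" if "set (lst w) \<subseteq> range coset" for f w
    using that coset_translate by (fastforce simp: lst_act)
  show ?thesis using le[of w f] le[of "act f w" "- f"] by (auto simp: act_act)
qed

lemma Full_add: "x \<in> Full \<Longrightarrow> y \<in> Full \<Longrightarrow> x + y \<in> Full"
  using set_foldr_push[of "lst (stk x)" "lst (act (loc x) (stk y))"] set_act[of "loc x" "stk y"]
  by (auto simp: Full_def lst_plus)

lemma Full_uminus: "x \<in> Full \<Longrightarrow> - x \<in> Full"
  using set_act[of "- loc x" "stk x"] by (simp add: Full_def lst_uminus_set)

lemma len_act [simp]: "len (act f w) = len w" by (simp add: lst_act)

lemma even_stk_add: "even (len (stk (x + y))) \<longleftrightarrow> (even (len (stk x)) \<longleftrightarrow> even (len (stk y)))"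
  by (simp add: even_len_plus)

lemma even_stk_uminus: "even (len (stk (- x))) \<longleftrightarrow> even (len (stk x))"
  by simp

definition t :: "'a red lamp" where "t = Lamp (gen A) 0"

definition lt :: "'a red \<Rightarrow> 'a red lamp" where "lt u = Lamp 0 u"

definition SG :: "'a red lamp set" where
  "SG = (\<lambda>a. lt (gen a)) ` UNIV \<union> (\<lambda>a. t + lt (gen a) + t) ` UNIV"

lemma gen_set_double: "gen c + gen c = 0" for c :: "'b set"
  using left_minus[of "gen c"] by (simp add: uminus_gen)

lemma t_t: "t + t = 0"
  by (simp add: t_def plus_lamp_def zero_lamp_def gen_set_double)

lemma t_t_add: "t + (t + x) = x"
  by (simp add: add.assoc[symmetric] t_t)

lemma uminus_t: "- t = t"
  using t_t by (rule minus_unique)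

lemma lt_add: "lt u + lt v = lt (u + v)"
  by (simp add: lt_def plus_lamp_def)

lemma lt_0: "lt 0 = 0" by (simp add: lt_def zero_lamp_def)

lemma lt_uminus: "- lt u = lt (- u)"
  by (rule minus_unique) (simp add: lt_add lt_0)

lemma t_Full: "t \<in> Full" using coset_0 by (auto simp: t_def Full_def)

lemma lt_Full: "lt u \<in> Full" by (simp add: lt_def Full_def)

lemma SG_GA: "SG \<subseteq> GA"
proof -
  have "t + lt u + t \<in> GA" for u
    using t_Full lt_Full Full_add even_stk_add[of "t + lt u" t] even_stk_add[of t "lt u"]
    by (auto simp: GA_def lt_def t_def)
  moreover have "lt u \<in> GA" for u using lt_Full by (simp add: GA_def lt_def)
  ultimately show ?thesis by (auto simp: SG_def)
qed

lemma sum_list_lt: "sum_list (map (\<lambda>a. lt (gen a)) (lst u)) = lt u"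
proof -
  have "sum_list (map (\<lambda>a. lt (gen a)) l) = lt (sum_list (map gen l))" for l
    by (induction l) (simp_all add: lt_0 lt_add)
  then show ?thesis by (simp add: sum_list_gen)
qed

lemma sum_list_tlt: "sum_list (map (\<lambda>a. t + lt (gen a) + t) (lst u)) = t + lt u + t"
proof -
  have "sum_list (map (\<lambda>a. t + lt (gen a) + t) l) = t + lt (sum_list (map gen l)) + t" for l
  proof (induction l)
    case (Cons a l)
    then show ?case by (simp add: add.assoc t_t_add flip: lt_add)
  qed (simp add: lt_0 t_t)
  then show ?thesis by (simp add: sum_list_gen)
qed

lemma Lamp_add_t: "Lamp w r + t = Lamp (w + gen (coset r)) r"
  by (simp add: t_def plus_lamp_def act_gen coset_def)

lemma Lamp_add_lt: "Lamp w r + lt u = Lamp w (r + u)"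
  by (simp add: lt_def plus_lamp_def)

text \<open>A cheapest path is spelled letter by letter, and the letters travelled after an odd
  number of visited cosets are taken from the mirror copy \<open>t + lt u + t\<close>. A single t
  may remain open at the end, whence the two alternatives.\<close>

lemma full_word:
  assumes "reduced w" "set w \<subseteq> range coset"
  shows "\<exists>ws. set ws \<subseteq> SG \<and> length ws = cst 0 w f \<and>
    (sum_list ws = Lamp (of_lst w) f \<or> sum_list ws = Lamp (of_lst w) f + t)"
  using assms
proof (induction w arbitrary: f rule: rev_induct)
  case Nil
  have "of_lst [] = (0 :: 'a red set red)" using of_lst_lst[of 0] by simp
  then show ?case using sum_list_lt[of f]
    by (intro exI[of _ "map (\<lambda>a. lt (gen a)) (lst f)"]) (auto simp: SG_def lt_def)
next
  case (snoc c w)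
  then have w: "reduced w" "set w \<subseteq> range coset" by (auto simp: successively_append_iff)
  then have "{} \<notin> set w" "c \<noteq> {}" using coset_ne snoc.prems by fastforce+
  then obtain r where r: "r \<in> c" "cst 0 (w @ [c]) f = cst 0 w r + len (- r + f)"
    using cst_append_ex[of c w 0 "[]" f] by auto
  have c: "coset r = c" using snoc.prems(2) r(1) coset_eq by auto
  have "lst (of_lst w + gen c) = w @ [c]"
    using lst_append[of "of_lst w" "gen c"] w snoc.prems(1) by simp
  then have wc: "of_lst w + gen c = of_lst (w @ [c])" by (metis of_lst_lst)
  obtain ws where ws: "set ws \<subseteq> SG" "length ws = cst 0 w r"
    "sum_list ws = Lamp (of_lst w) r \<or> sum_list ws = Lamp (of_lst w) r + t"
    using snoc.IH[OF w] by blast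
  let ?x = "Lamp (of_lst (w @ [c])) f"
  have x: "?x = Lamp (of_lst w) r + t + lt (- r + f)"
    by (simp add: Lamp_add_t Lamp_add_lt c wc add.assoc[symmetric])
  from ws(3) show ?case
  proof
    assume "sum_list ws = Lamp (of_lst w) r"
    then have "sum_list (ws @ map (\<lambda>a. t + lt (gen a) + t) (lst (- r + f))) = ?x + t"
      unfolding x by (simp only: sum_list_append sum_list_tlt) (simp only: add.assoc)
    then show ?thesis using ws r by (intro exI[of _ "ws @ map (\<lambda>a. t + lt (gen a) + t) (lst (- r + f))"])
        (auto simp: SG_def)
  next
    assume "sum_list ws = Lamp (of_lst w) r + t"
    then have "sum_list (ws @ map (\<lambda>a. lt (gen a)) (lst (- r + f))) = ?x"
      unfolding x by (simp only: sum_list_append sum_list_lt add.assoc)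
    then show ?thesis using ws r by (intro exI[of _ "ws @ map (\<lambda>a. lt (gen a)) (lst (- r + f))"])
        (auto simp: SG_def)
  qed
qed

lemma nrm_dst: "nrm x = dst 0 x" using nrm_diff[of 0 x] by simp

lemma nrm_add: "x \<in> Full \<Longrightarrow> y \<in> Full \<Longrightarrow> nrm (x + y) \<le> nrm x + nrm y"
  using dst_triangle[of 0 x "x + y"] Full_legal Full_zero Full_add dst_translate[of x 0 y]
  by (simp add: nrm_dst)

lemma nrm_t: "nrm t = 0"
  using cst_Cons_le[of 0 A 0 "[]" 0] A_zero by (simp add: nrm_def t_def)

lemma nrm_SG: "s \<in> SG \<Longrightarrow> nrm s \<le> 1"
proof -
  have 1: "nrm (lt (gen a)) = 1" for a by (simp add: nrm_def lt_def)
  have "nrm (t + lt (gen a) + t) \<le> 1" for a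
    using nrm_add[of "t + lt (gen a)" t] nrm_add[of t "lt (gen a)"] t_Full lt_Full Full_add 1[of a] nrm_t by simp
  then show "s \<in> SG \<Longrightarrow> nrm s \<le> 1" using 1 by (auto simp: SG_def)
qed

sublocale length_group GA SG nrm
proof
  show "0 \<in> GA" by (simp add: GA_def Full_zero)
  show "x + y \<in> GA" if "x \<in> GA" "y \<in> GA" for x y
    using that Full_add even_stk_add[of x y] by (simp add: GA_def)
  show "- x \<in> GA" if "x \<in> GA" for x using that Full_uminus by (simp add: GA_def)
  show "SG \<subseteq> GA" by (rule SG_GA)
  show "finite SG" by (simp add: SG_def)
  show "- s \<in> SG" if "s \<in> SG" for s
    using that by (auto simp: SG_def minus_add uminus_t lt_uminus uminus_gen add.assoc
      simp del: add_uminus_conv_diff)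
  show len: "nrm (sum_list ws) \<le> length ws" if "set ws \<subseteq> SG" for ws using that
  proof (induction ws)
    case Nil
    then show ?case by (simp add: nrm_def)
  next
    case (Cons s ws)
    have "sum_list us \<in> Full" if "set us \<subseteq> SG" for us using that SG_GA GA_Full
      by (induction us) (auto simp: Full_zero intro!: Full_add)
    then have "sum_list ws \<in> Full" using Cons.prems by simp
    then have "nrm (s + sum_list ws) \<le> nrm s + nrm (sum_list ws)"
      using Cons.prems SG_GA GA_Full by (intro nrm_add) auto
    then show ?case using Cons nrm_SG[of s] by simp
  qed
  show "\<exists>ws. set ws \<subseteq> SG \<and> length ws = nrm x \<and> sum_list ws = x" if x: "x \<in> GA" for x
  proof -
    obtain ws where ws: "set ws \<subseteq> SG" "length ws = nrm x" "sum_list ws = x \<or> sum_list ws = x + t"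
      using full_word[of "lst (stk x)" "loc x"] x by (auto simp: GA_def Full_def nrm_def)
    \<comment> \<open>Words in \<open>SG\<close> have even stacks, which excludes the alternative
      with an open t.\<close>
    have "even (len (stk (sum_list ws)))" using ws(1) SG_GA
      by (induction ws) (auto simp: even_len_plus GA_def subset_iff)
    moreover have "odd (len (stk (x + t)))"
      using x even_stk_add[of x t] by (simp add: GA_def t_def)
    ultimately show ?thesis using ws by auto
  qed
qed

text \<open>\<open>axis_half_space\<close> for the larger group \<open>Full\<close>, in which
  conjugation by odd elements is available. Witnesses of both parities are required so that one lies
  in \<open>GA\<close> and the property survives an odd conjugation.\<close>

definition full_axis :: "'a red lamp \<Rightarrow> 'a red lamp set \<Rightarrow> bool" where
  "full_axis g E \<longleftrightarrow>
    (\<forall>x\<in>Full. x \<in> E \<longrightarrow> g + x \<in> E) \<and>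
    (\<forall>b. \<exists>x\<in>Full. x \<in> E \<and> - g + x \<notin> E \<and> even (len (stk x)) = b) \<and>
    (\<forall>f\<in>Full. (\<forall>x\<in>Full. - f + x \<in> E \<longrightarrow> x \<in> E) \<or> (\<forall>x\<in>Full. x \<in> E \<longrightarrow> - f + x \<in> E) \<or>
       (\<forall>x\<in>Full. x \<in> E \<longrightarrow> - f + x \<notin> E) \<or> (\<forall>x\<in>Full. x \<in> E \<or> - f + x \<in> E)) \<and>
    (\<forall>x\<in>Full. \<forall>y\<in>Full. finite {{z \<in> Full. - f + z \<in> E} | f. f \<in> Full \<and> (- f + x \<in> E) \<noteq> (- f + y \<in> E)}) \<and>
    (\<exists>N C. \<forall>x\<in>Full. \<forall>y\<in>Full. x \<notin> E \<longrightarrow> - nmul N g + y \<in> E \<longrightarrow> dst x 0 + dst 0 y \<le> dst x y + C)"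

lemma axis_half_space_of_full:
  assumes "full_axis g E"
  shows "axis_half_space g E"
proof -
  note fd = assms[unfolded full_axis_def]
  show ?thesis
    unfolding axis_half_space_def
  proof (intro conjI)
    show "\<forall>x\<in>GA. x \<in> E \<longrightarrow> g + x \<in> E" using fd GA_Full by blast
    obtain x where "x \<in> Full" "x \<in> E" "- g + x \<notin> E" "even (len (stk x)) = True" using fd by meson
    then show "\<exists>x\<in>GA. x \<in> E \<and> - g + x \<notin> E" by (intro bexI[of _ x]) (auto simp: GA_def)
    show "\<forall>f\<in>GA. (\<forall>x\<in>GA. - f + x \<in> E \<longrightarrow> x \<in> E) \<or> (\<forall>x\<in>GA. x \<in> E \<longrightarrow> - f + x \<in> E) \<or>
       (\<forall>x\<in>GA. x \<in> E \<longrightarrow> - f + x \<notin> E) \<or> (\<forall>x\<in>GA. x \<in> E \<or> - f + x \<in> E)"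
    proof
      fix f assume "f \<in> GA"
      then have "f \<in> Full" by (rule GA_Full)
      with fd consider "\<forall>x\<in>Full. - f + x \<in> E \<longrightarrow> x \<in> E" | "\<forall>x\<in>Full. x \<in> E \<longrightarrow> - f + x \<in> E"
        | "\<forall>x\<in>Full. x \<in> E \<longrightarrow> - f + x \<notin> E" | "\<forall>x\<in>Full. x \<in> E \<or> - f + x \<in> E" by blast
      then show "(\<forall>x\<in>GA. - f + x \<in> E \<longrightarrow> x \<in> E) \<or> (\<forall>x\<in>GA. x \<in> E \<longrightarrow> - f + x \<in> E) \<or>
       (\<forall>x\<in>GA. x \<in> E \<longrightarrow> - f + x \<notin> E) \<or> (\<forall>x\<in>GA. x \<in> E \<or> - f + x \<in> E)"
        by cases (use GA_Full in blast)+
    qed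
    show "\<forall>x\<in>GA. \<forall>y\<in>GA. finite {{z \<in> GA. - f + z \<in> E} | f. f \<in> GA \<and> (- f + x \<in> E) \<noteq> (- f + y \<in> E)}"
    proof (intro ballI)
      fix x y assume xy: "x \<in> GA" "y \<in> GA"
      have "{{z \<in> GA. - f + z \<in> E} | f. f \<in> GA \<and> (- f + x \<in> E) \<noteq> (- f + y \<in> E)}
        \<subseteq> (\<lambda>D. D \<inter> GA) ` {{z \<in> Full. - f + z \<in> E} | f. f \<in> Full \<and> (- f + x \<in> E) \<noteq> (- f + y \<in> E)}"
      proof
        fix D assume "D \<in> {{z \<in> GA. - f + z \<in> E} | f. f \<in> GA \<and> (- f + x \<in> E) \<noteq> (- f + y \<in> E)}"
        then obtain f where f: "D = {z \<in> GA. - f + z \<in> E}" "f \<in> GA" "(- f + x \<in> E) \<noteq> (- f + y \<in> E)" by auto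
        have "D = {z \<in> Full. - f + z \<in> E} \<inter> GA" using f(1) GA_Full by blast
        then show "D \<in> (\<lambda>D. D \<inter> GA) ` {{z \<in> Full. - f + z \<in> E} | f. f \<in> Full \<and> (- f + x \<in> E) \<noteq> (- f + y \<in> E)}"
          using f(2,3) GA_Full by blast
      qed
      moreover have "finite {{z \<in> Full. - f + z \<in> E} | f. f \<in> Full \<and> (- f + x \<in> E) \<noteq> (- f + y \<in> E)}"
        using fd xy GA_Full by blast
      ultimately show "finite {{z \<in> GA. - f + z \<in> E} | f. f \<in> GA \<and> (- f + x \<in> E) \<noteq> (- f + y \<in> E)}"
        using finite_subset by blast
    qed
    obtain N C where "\<forall>x\<in>Full. \<forall>y\<in>Full. x \<notin> E \<longrightarrow> - nmul N g + y \<in> E \<longrightarrow> dst x 0 + dst 0 y \<le> dst x y + C"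
      using fd by blast
    then have NC: "nrm (- x) + nrm y \<le> nrm (- x + y) + C"
      if "x \<in> GA" "y \<in> GA" "x \<notin> E" "- nmul N g + y \<in> E" for x y
      using that nrm_diff[of x 0] nrm_diff[of x y] nrm_dst[of y] GA_Full by simp
    show "\<exists>N C. \<forall>x\<in>GA. \<forall>y\<in>GA. x \<notin> E \<longrightarrow> - nmul N g + y \<in> E \<longrightarrow> nrm (- x) + nrm y \<le> nrm (- x + y) + C"
      by (rule exI[of _ N], rule exI[of _ C]) (use NC in blast)
  qed
qed

lemma nmul_conj: "nmul n (u + g - u) = u + nmul n g - u" for u g :: "'b::group_add"
proof (induction n)
  case (Suc n)
  have "u + nmul n g - u + (u + g - u) = u + (nmul n g + g) - u"
    by (simp add: add.assoc diff_conv_add_uminus del: add_uminus_conv_diff)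
  then show ?case using Suc by simp
qed simp

lemma full_axis_conj:
  assumes u: "u \<in> Full" and good: "full_axis g E"
  shows "full_axis (u + g - u) {x. - u + x \<in> E}"
proof -
  note fd = good[unfolded full_axis_def]
  have uF: "- u + x \<in> Full" if "x \<in> Full" for x using that u Full_add Full_uminus by blast
  have c1: "- u + (u + g - u + x) = g + (- u + x)" for x
    by (simp add: add.assoc diff_conv_add_uminus del: add_uminus_conv_diff)
  have c2: "- u + (- (u + h - u) + x) = - h + (- u + x)" for h x
    by (simp add: add.assoc minus_add diff_conv_add_uminus del: add_uminus_conv_diff)
  show ?thesis
    unfolding full_axis_def mem_Collect_eq
  proof (intro conjI allI)
    show "\<forall>x\<in>Full. - u + x \<in> E \<longrightarrow> - u + (u + g - u + x) \<in> E"
      unfolding c1 using fd uF by blast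
    fix b
    obtain x where x: "x \<in> Full" "x \<in> E" "- g + x \<notin> E" "even (len (stk x)) = (b = even (len (stk u)))"
      using fd[THEN conjunct2, THEN conjunct1, rule_format, of "b = even (len (stk u))"] by blast
    have "- u + (u + x) = x" by (simp add: add.assoc[symmetric])
    then show "\<exists>x\<in>Full. - u + x \<in> E \<and> - u + (- (u + g - u) + x) \<notin> E \<and> even (len (stk x)) = b"
      unfolding c2 using x u Full_add even_stk_add[of u x] by (intro bexI[of _ "u + x"]) auto
  next
    show "\<forall>f\<in>Full. (\<forall>x\<in>Full. - u + (- f + x) \<in> E \<longrightarrow> - u + x \<in> E) \<or>
      (\<forall>x\<in>Full. - u + x \<in> E \<longrightarrow> - u + (- f + x) \<in> E) \<or>
      (\<forall>x\<in>Full. - u + x \<in> E \<longrightarrow> - u + (- f + x) \<notin> E) \<or> (\<forall>x\<in>Full. - u + x \<in> E \<or> - u + (- f + x) \<in> E)"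
    proof
      fix f assume f: "f \<in> Full"
      let ?h = "- u + f + u"
      have h: "?h \<in> Full" using f u Full_add Full_uminus by blast
      have c3: "- u + (- f + x) = - ?h + (- u + x)" for x
        by (simp add: add.assoc minus_add diff_conv_add_uminus del: add_uminus_conv_diff)
      from fd h consider "\<forall>x\<in>Full. - ?h + x \<in> E \<longrightarrow> x \<in> E" | "\<forall>x\<in>Full. x \<in> E \<longrightarrow> - ?h + x \<in> E"
        | "\<forall>x\<in>Full. x \<in> E \<longrightarrow> - ?h + x \<notin> E" | "\<forall>x\<in>Full. x \<in> E \<or> - ?h + x \<in> E" by blast
      then show "(\<forall>x\<in>Full. - u + (- f + x) \<in> E \<longrightarrow> - u + x \<in> E) \<or>
        (\<forall>x\<in>Full. - u + x \<in> E \<longrightarrow> - u + (- f + x) \<in> E) \<or>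
        (\<forall>x\<in>Full. - u + x \<in> E \<longrightarrow> - u + (- f + x) \<notin> E) \<or> (\<forall>x\<in>Full. - u + x \<in> E \<or> - u + (- f + x) \<in> E)"
        unfolding c3 by cases (use uF in blast)+
    qed
    show "\<forall>x\<in>Full. \<forall>y\<in>Full. finite {{z \<in> Full. - u + (- f + z) \<in> E} | f.
        f \<in> Full \<and> (- u + (- f + x) \<in> E) \<noteq> (- u + (- f + y) \<in> E)}"
    proof (intro ballI)
      fix x y assume xy: "x \<in> Full" "y \<in> Full"
      have c4: "- u + (- f + z) = - (f + u) + z" for f z
        by (simp add: add.assoc minus_add diff_conv_add_uminus del: add_uminus_conv_diff)
      have "{{z \<in> Full. - u + (- f + z) \<in> E} | f. f \<in> Full \<and> (- u + (- f + x) \<in> E) \<noteq> (- u + (- f + y) \<in> E)}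
        \<subseteq> {{z \<in> Full. - f + z \<in> E} | f. f \<in> Full \<and> (- f + x \<in> E) \<noteq> (- f + y \<in> E)}"
        unfolding c4 using u Full_add by blast
      moreover have "finite {{z \<in> Full. - f + z \<in> E} | f. f \<in> Full \<and> (- f + x \<in> E) \<noteq> (- f + y \<in> E)}"
        using fd xy by blast
      ultimately show "finite {{z \<in> Full. - u + (- f + z) \<in> E} | f. f \<in> Full \<and>
          (- u + (- f + x) \<in> E) \<noteq> (- u + (- f + y) \<in> E)}" by (rule finite_subset)
    qed
    obtain N C where NC: "\<And>x y. x \<in> Full \<Longrightarrow> y \<in> Full \<Longrightarrow> x \<notin> E \<Longrightarrow> - nmul N g + y \<in> E \<Longrightarrow>
        dst x 0 + dst 0 y \<le> dst x y + C"
      using fd by blast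
    \<comment> \<open>After translation by \<open>- u\<close> the bottleneck sits at u; routing
      through 0 instead costs the way between u and 0 in both directions.\<close>
    have "dst x 0 + dst 0 y \<le> dst x y + (C + dst u 0 + dst 0 u)"
      if x: "x \<in> Full" "- u + x \<notin> E" and y: "y \<in> Full" "- u + (- nmul N (u + g - u) + y) \<in> E" for x y
    proof -
      have "dst (- u + x) 0 + dst 0 (- u + y) \<le> dst (- u + x) (- u + y) + C"
        using NC uF x y unfolding nmul_conj c2 by blast
      moreover have "dst (- u + x) (- u + y) = dst x y" "dst (- u + x) 0 = dst x u" "dst 0 (- u + y) = dst u y"
        using dst_translate[of "- u" x y] dst_translate[of "- u" x u] dst_translate[of "- u" u y] by simp_all
      moreover have "dst x 0 \<le> dst x u + dst u 0" "dst 0 y \<le> dst 0 u + dst u y"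
        using dst_triangle Full_legal Full_zero x y u by blast+
      ultimately show ?thesis by linarith
    qed
    then show "\<exists>N C. \<forall>x\<in>Full. \<forall>y\<in>Full. - u + x \<notin> E \<longrightarrow> - u + (- nmul N (u + g - u) + y) \<in> E \<longrightarrow>
      dst x 0 + dst 0 y \<le> dst x y + C" by blast
  qed
qed

end

text \<open>The two consequences of the labelling that axes need: at most one coset leaks along the
  axis of a cyclically reduced f, and f preserves it; and distinct cosets are so independent that
  all geodesics between them pass through a finite set.\<close>

locale contracting_double = double_group A for A :: "'a::{invol,finite} red set" +
  assumes flip_neq: "\<And>a::'a. flip a \<noteq> a"
    and periodic_coset: "\<And>f. f \<noteq> 0 \<Longrightarrow> last (lst f) \<noteq> flip (hd (lst f)) \<Longrightarrow>
      \<exists>n. \<forall>c\<in>range coset. \<forall>c'\<in>range coset.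
        \<not> c \<subseteq> cyl [hd (lst f)] \<longrightarrow> c \<inter> (+) (nmul n f) ` cyl [hd (lst f)] \<noteq> {} \<longrightarrow>
        \<not> c' \<subseteq> cyl [hd (lst f)] \<longrightarrow> c' \<inter> (+) (nmul n f) ` cyl [hd (lst f)] \<noteq> {} \<longrightarrow>
        c = c' \<and> (+) f ` c = c"
    and finite_bridge: "\<And>c c'. c \<in> range coset \<Longrightarrow> c' \<in> range coset \<Longrightarrow> c \<noteq> c' \<Longrightarrow>
      \<exists>P. finite P \<and> (\<forall>p\<in>c. \<forall>q\<in>c'. \<exists>v\<in>P. len (- p + q) = len (- p + v) + len (- v + q))"
begin

lemma four_nestings:
  fixes Q R :: "'b \<Rightarrow> bool"
  assumes "halftree D" "halftree D'"
  shows "(\<forall>x\<in>V. h x \<in> D \<longrightarrow> h x \<in> D') \<or> (\<forall>x\<in>V. h x \<in> D' \<longrightarrow> h x \<in> D) \<or>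
    (\<forall>x\<in>V. h x \<in> D' \<longrightarrow> h x \<notin> D) \<or> (\<forall>x\<in>V. h x \<in> D' \<or> h x \<in> D)"
  using halftree_nested[OF assms] by blast

text \<open>Finitely many points have bounded distance from the identity, so a finite set may serve
  as the bottleneck; this also absorbs the choice between several sheets.\<close>

lemma bottleneck_of_finite:
  assumes "finite Z" "Z \<subseteq> Full"
    and "\<And>x y. x \<in> Full \<Longrightarrow> y \<in> Full \<Longrightarrow> Q x y \<Longrightarrow> \<exists>z\<in>Z. dst x z + dst z y \<le> dst x y"
  shows "\<exists>C. \<forall>x\<in>Full. \<forall>y\<in>Full. Q x y \<longrightarrow> dst x 0 + dst 0 y \<le> dst x y + C"
proof -
  define C where "C = Max (insert 0 ((\<lambda>z. dst z 0 + dst 0 z) ` Z))"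
  have "dst x 0 + dst 0 y \<le> dst x y + C" if xy: "x \<in> Full" "y \<in> Full" "Q x y" for x y
  proof -
    obtain z where z: "z \<in> Z" "dst x z + dst z y \<le> dst x y" using assms(3)[OF xy] by blast
    have "dst z 0 + dst 0 z \<le> C" unfolding C_def using assms(1) z by (intro Max_ge) auto
    moreover have "dst x 0 \<le> dst x z + dst z 0" "dst 0 y \<le> dst 0 z + dst z y"
      using dst_triangle Full_legal Full_zero xy z assms(2) by (meson subsetD)+
    ultimately show ?thesis using z by linarith
  qed
  then show ?thesis by blast
qed

text \<open>The half-space is a half-tree in the tree of the free product of groups of order two. A
  path from its complement to its translate by \<open>g\<close> visits the first two cosets
  \<open>c1\<close> and \<open>c2\<close> of the stack of \<open>g\<close> in succession, so
  \<open>finite_bridge\<close> supplies the bottleneck.\<close>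

lemma loxodromic_axis:
  assumes g: "g \<in> Full" and ne: "stk g \<noteq> 0" and ev: "even (len (stk g))"
    and cyc: "last (lst (stk g)) \<noteq> (+) (loc g) ` hd (lst (stk g))"
  shows "\<exists>E. full_axis g E"
proof -
  define w where "w = stk g"
  define f where "f = loc g"
  have "lst w \<noteq> []" using ne by (simp add: w_def)
  \<comment> \<open>Even parity rules out a single coset, so a second one is available for the
    bridge.\<close>
  moreover have "length (lst w) \<noteq> 1" using ev by (auto simp: w_def)
  ultimately obtain c1 c2 w' where w: "lst w = c1 # c2 # w'"
    by (cases "lst w"; cases "tl (lst w)") auto
  have c12: "c1 \<noteq> c2" using reduced_lst[of w] w by (auto simp: successively_Cons)
  have cs: "c1 \<in> range coset" "c2 \<in> range coset" using g w unfolding Full_def w_def by auto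
  define E where "E = {x. stk x \<in> cyl [c1]}"
  have lastw: "last (lst w) \<noteq> (+) f ` c1" using cyc w unfolding w_def f_def by simp
  \<comment> \<open>\<open>cyc\<close> prevents cancellation between the stack of \<open>g\<close>
    and the translate of a stack that begins with \<open>c1\<close>.\<close>
  have app: "\<exists>l. lst (stk (g + x)) = lst w @ ((+) f ` c1) # l" if x: "x \<in> E" for x
  proof -
    obtain l where l: "lst (stk x) = c1 # l" using x unfolding E_def by (auto simp: mem_cyl prefix_def)
    have "lst w \<noteq> []" "reduced (lst (act f (stk x)))" using w by simp_all
    then have "reduced (lst w @ lst (act f (stk x)))"
      using lastw by (simp add: successively_append_iff lst_act l)
    then have "lst (w + act f (stk x)) = lst w @ lst (act f (stk x))" by (rule lst_append)
    then show ?thesis using l by (simp add: lst_act w_def f_def)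
  qed
  have appd: "\<exists>l. lst (stk y) = lst w @ ((+) f ` c1) # l" if "- g + y \<in> E" for y
    using app[OF that] by (simp only: add_minus_cancel)
  have trans: "- h + x \<in> E \<longleftrightarrow> stk x \<in> (+) (stk h) ` cyl [(+) (loc h) ` c1]" for h x
  proof -
    have "- h + x \<in> E \<longleftrightarrow> act (- loc h) (- stk h + stk x) \<in> cyl [c1]" by (simp add: E_def stk_diff del: lamp_simps)
    also have "\<dots> \<longleftrightarrow> - stk h + stk x \<in> cyl [(+) (loc h) ` c1]"
    proof -
      have e: "(+) (- loc h) ` c = c1 \<longleftrightarrow> c = (+) (loc h) ` c1" for c
        by (auto simp: image_image add.assoc[symmetric])
      show ?thesis
      proof (cases "lst (- stk h + stk x)")
        case (Cons a l)
        then show ?thesis using e[of a] by (simp add: mem_cyl lst_act) metis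
      qed (simp add: mem_cyl lst_act)
    qed
    also have "\<dots> \<longleftrightarrow> stk x \<in> (+) (stk h) ` cyl [(+) (loc h) ` c1]"
      by (auto simp: image_iff add.assoc[symmetric] intro!: bexI[of _ "- stk h + stk x"])
    finally show ?thesis .
  qed
  have "full_axis g E"
    unfolding full_axis_def
  proof (intro conjI)
    show "\<forall>x\<in>Full. x \<in> E \<longrightarrow> g + x \<in> E"
      using app w by (fastforce simp: E_def mem_cyl simp del: lamp_simps)
    show "\<forall>b. \<exists>x\<in>Full. x \<in> E \<and> - g + x \<notin> E \<and> even (len (stk x)) = b"
    proof
      fix b
      have r2: "lst (gen c1 + gen c2) = [c1, c2]" using lst_append[of "gen c1" "gen c2"] c12 by simp
      define x where "x = Lamp (if b then gen c1 + gen c2 else gen c1) 0"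
      have "x \<in> Full" "x \<in> E" "even (len (stk x)) = b" "len (stk x) \<le> 2"
        using cs by (auto simp: x_def r2 Full_def E_def mem_cyl)
      moreover have "- g + x \<notin> E" using appd[of x] w calculation(4) by auto
      ultimately show "\<exists>x\<in>Full. x \<in> E \<and> - g + x \<notin> E \<and> even (len (stk x)) = b" by blast
    qed
    show "\<forall>h\<in>Full. (\<forall>x\<in>Full. - h + x \<in> E \<longrightarrow> x \<in> E) \<or> (\<forall>x\<in>Full. x \<in> E \<longrightarrow> - h + x \<in> E) \<or>
       (\<forall>x\<in>Full. x \<in> E \<longrightarrow> - h + x \<notin> E) \<or> (\<forall>x\<in>Full. x \<in> E \<or> - h + x \<in> E)"
      unfolding trans unfolding E_def mem_Collect_eq
      by (intro ballI four_nestings halftree_translate_cyl1 halftree_cyl) simp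
    show "\<forall>x\<in>Full. \<forall>y\<in>Full. finite {{z \<in> Full. - h + z \<in> E} | h. h \<in> Full \<and> (- h + x \<in> E) \<noteq> (- h + y \<in> E)}"
    proof (intro ballI)
      fix x y
      have "{{z \<in> Full. - h + z \<in> E} | h. h \<in> Full \<and> (- h + x \<in> E) \<noteq> (- h + y \<in> E)}
        \<subseteq> (\<lambda>D. {z \<in> Full. stk z \<in> D}) ` {D. halftree D \<and> (stk x \<in> D) \<noteq> (stk y \<in> D)}"
        unfolding trans using halftree_translate_cyl1 by blast
      then show "finite {{z \<in> Full. - h + z \<in> E} | h. h \<in> Full \<and> (- h + x \<in> E) \<noteq> (- h + y \<in> E)}"
        by (rule finite_subset[OF _ finite_imageI[OF halftree_separating_finite]])
    qed
    obtain P where P: "finite P" "\<And>p q. p \<in> c1 \<Longrightarrow> q \<in> c2 \<Longrightarrow> \<exists>v\<in>P. len (- p + q) = len (- p + v) + len (- v + q)"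
      using finite_bridge[OF cs c12] by blast
    have "\<exists>C. \<forall>x\<in>Full. \<forall>y\<in>Full. (x \<notin> E \<and> - g + y \<in> E) \<longrightarrow> dst x 0 + dst 0 y \<le> dst x y + C"
    proof (rule bottleneck_of_finite[of "(\<lambda>v. Lamp (gen c1) v) ` P"])
      show "finite (Lamp (gen c1) ` P)" using P by simp
      show "Lamp (gen c1) ` P \<subseteq> Full" using cs by (auto simp: Full_def)
      fix x y assume xy: "x \<in> Full" "y \<in> Full" and c: "x \<notin> E \<and> - g + y \<in> E"
      have ne: "{} \<notin> set (lst (stk x))" "{} \<notin> set (lst (stk y))"
        using Full_legal xy unfolding legal_def by auto
      obtain l where "lst (stk y) = lst w @ ((+) f ` c1) # l" using appd c by blast
      then obtain l where y: "lst (stk y) = c1 # c2 # l" using w by simp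
      have hx: "stk x = 0 \<or> hd (lst (stk x)) \<noteq> c1" using c mem_cyl1[of "stk x" c1] by (auto simp: E_def)
      have d0: "lst (- stk x + v) = rev (lst (stk x)) @ lst v" if "lst v = c1 # l'" for v l'
      proof -
        have "reduced (lst (- stk x) @ lst v)"
          using hx that reduced_lst[of "- stk x"] reduced_lst[of v]
          by (auto simp: successively_append_iff lst_uminus_set last_rev simp del: reduced_lst)
        then show ?thesis using lst_append[of "- stk x" v] by (simp add: lst_uminus_set)
      qed
      have dxy: "dst x y = cst (loc x) (rev (lst (stk x)) @ c1 # c2 # l) (loc y)"
        using d0[OF y] y by (simp add: dst_def)
      obtain p where p: "p \<in> c1" "dst x y = cst (loc x) (rev (lst (stk x))) p + cst p (c2 # l) (loc y)"
      proof -
        have "c1 \<noteq> {}" "{} \<notin> set (rev (lst (stk x)))" using ne y by auto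
        from cst_append_ex[OF this, of "loc x" "c2 # l" "loc y"] show ?thesis
          using that unfolding dxy by blast
      qed
      have "c2 \<noteq> {}" using ne y by auto
      then obtain q where q: "q \<in> c2" "cst p (c2 # l) (loc y) = len (- p + q) + cst q l (loc y)"
        using cst_Cons_ex by blast
      obtain v where v: "v \<in> P" "len (- p + q) = len (- p + v) + len (- v + q)" using P p q by blast
      let ?z = "Lamp (gen c1) v"
      have "dst x ?z = cst (loc x) (rev (lst (stk x)) @ [c1]) v"
        using d0[of "gen c1" "[]"] by (simp add: dst_def)
      also have "\<dots> \<le> cst (loc x) (rev (lst (stk x))) p + cst p [] v"
        using ne p by (intro cst_append_le) auto
      finally have 1: "dst x ?z \<le> cst (loc x) (rev (lst (stk x))) p + len (- p + v)" by simp
      have "lst (- gen c1 + stk y) = c2 # l"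
        using y by (simp add: lst_plus lst_uminus_set)
      then have "dst ?z y = cst v (c2 # l) (loc y)" by (simp add: dst_def)
      also have "\<dots> \<le> len (- v + q) + cst q l (loc y)" using q by (intro cst_Cons_le)
      finally have "dst x ?z + dst ?z y \<le> dst x y" using 1 p q v by simp
      then show "\<exists>z\<in>Lamp (gen c1) ` P. dst x z + dst z y \<le> dst x y" using v by blast
    qed
    then obtain C where "\<forall>x\<in>Full. \<forall>y\<in>Full. (x \<notin> E \<and> - g + y \<in> E) \<longrightarrow> dst x 0 + dst 0 y \<le> dst x y + C" ..
    then show "\<exists>N C. \<forall>x\<in>Full. \<forall>y\<in>Full. x \<notin> E \<longrightarrow> - nmul N g + y \<in> E \<longrightarrow> dst x 0 + dst 0 y \<le> dst x y + C"
      by - (rule exI[of _ 1], rule exI[of _ C], auto)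
  qed
  then show ?thesis ..
qed

end

text \<open>The side on which a sequence of sets followed by the point f lies: the first set that does
  not straddle D decides.\<close>
primrec side :: "'a set \<Rightarrow> 'a set list \<Rightarrow> 'a \<Rightarrow> bool" where
  "side D [] f = (f \<in> D)"
| "side D (c # w) f = (if c \<subseteq> D then True else if c \<inter> D = {} then False else side D w f)"

abbreviation straddles :: "'a set \<Rightarrow> 'a set \<Rightarrow> bool" where
  "straddles D c \<equiv> \<not> c \<subseteq> D \<and> c \<inter> D \<noteq> {}"

lemma side_append: "\<forall>c\<in>set u. straddles D c \<Longrightarrow> side D (u @ w) f = side D w f"
  by (induction u) auto

lemma side_push: "straddles D c \<Longrightarrow> side D (push c w) f = side D w f"
  by (cases w) auto

text \<open>Only the first non-straddling set decides, and the sets of u are all straddling. Hence a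
  half-space looks the same from two sheets that differ by straddling cosets.\<close>

lemma side_foldr_push:
  "\<forall>c\<in>set u. straddles D c \<Longrightarrow> side D (foldr push u w) f = side D w f"
  by (induction u) (auto simp: side_push simp del: side.simps(2))

lemma side_plus:
  "\<forall>c\<in>set (lst u). straddles D c \<Longrightarrow> side D (lst (u + w)) f = side D (lst w) f"
  by (simp add: lst_plus side_foldr_push)

lemma side_mono: "D \<subseteq> D' \<Longrightarrow> {} \<notin> set w \<Longrightarrow> side D w f \<Longrightarrow> side D' w f"
  by (induction w) (auto split: if_splits)

lemma side_compl: "{} \<notin> set w \<Longrightarrow> side (- D) w f \<longleftrightarrow> \<not> side D w f"
  by (induction w) (auto split: if_splits)

lemma side_translate:
  "side D (map ((`) ((+) h)) w) (h + f) = side ((+) (- h) ` D) w f" for D :: "'a::group_add set"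
proof -
  have 1: "(+) h ` c \<subseteq> D \<longleftrightarrow> c \<subseteq> (+) (- h) ` D" for c
    by (force simp: image_iff add.assoc[symmetric] subset_iff)
  have 2: "(+) h ` c \<inter> D = {} \<longleftrightarrow> c \<inter> (+) (- h) ` D = {}" for c
    by (force simp: image_iff add.assoc[symmetric] disjoint_iff)
  have 3: "h + f \<in> D \<longleftrightarrow> f \<in> (+) (- h) ` D"
    by (force simp: image_iff add.assoc[symmetric])
  show ?thesis by (induction w) (simp_all only: list.map side.simps 1 2 3)
qed

lemma side_snoc: "f \<in> c \<Longrightarrow> side D (w @ [c]) f = side D w f"
  by (induction w) auto

lemma side_nonstraddle:
  assumes "\<forall>c\<in>set u. straddles D c" "\<not> straddles D c" "c \<noteq> {}"
  shows "side D (u @ c # w) f \<longleftrightarrow> c \<subseteq> D"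
  using assms by (simp add: side_append) blast

text \<open>The translate of \<open>cyl [a]\<close> by v is joined to its complement by a single
  edge, which starts at v; so every geodesic between the two sides passes through v.\<close>

lemma between_halftree:
  fixes p r :: "'a::invol red"
  assumes "p \<notin> (+) v ` cyl [a]" "r \<in> (+) v ` cyl [a]"
  shows "len (- p + r) = len (- p + v) + len (- v + r)"
proof -
  have mem: "x \<in> (+) v ` cyl [a] \<longleftrightarrow> - v + x \<in> cyl [a]" for x
    by (auto simp: image_iff add.assoc[symmetric] intro!: bexI[of _ "- v + x"])
  define p' r' where "p' = - v + p" and "r' = - v + r"
  have pr: "p' = 0 \<or> hd (lst p') \<noteq> a" "r' \<noteq> 0" "hd (lst r') = a"
    using assms unfolding mem p'_def r'_def mem_cyl1 by auto
  obtain k u w where d: "lst p' = k @ u" "lst r' = k @ w" "lst (- p' + r') = rev (map flip u) @ w"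
    by (rule lst_diff[of p' r'])
  have "k = []"
  proof (cases k)
    case (Cons b k')
    then show ?thesis using pr d by (auto simp flip: lst_eq_Nil)
  qed simp
  then have "len (- p' + r') = len p' + len r'" using d by simp
  then show ?thesis unfolding p'_def r'_def diff_cancel_left len_sym[of p v] .
qed

section \<open>Half-spaces of the double grown from half-trees\<close>

context contracting_double begin

text \<open>The half-tree D is placed in the sheet with stack s; every other sheet is assigned to a
  side by the cosets through which it is reached from there.\<close>

definition halfspace :: "'a red set red \<Rightarrow> 'a red set \<Rightarrow> 'a red lamp set" where
  "halfspace s D = {x. side D (lst (- s + stk x)) (loc x)}"

lemma translate_halfspace: "- f + x \<in> halfspace 0 D \<longleftrightarrow> x \<in> halfspace (stk f) ((+) (loc f) ` D)"
  using side_translate[of D "- loc f" "lst (- stk f + stk x)" "loc x"]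
  by (simp add: halfspace_def stk_diff lst_act del: lamp_simps(1,6))

lemma halfspace_straddle:
  assumes "\<forall>c\<in>set (lst s). straddles D c"
  shows "halfspace s D = halfspace 0 D"
  using side_plus[of "- s" D] assms by (simp add: halfspace_def lst_uminus_set)

lemma halfspace_add_straddle:
  assumes "\<forall>c\<in>set (lst s'). straddles D c"
  shows "halfspace (s + s') D = halfspace s D"
proof -
  have "- (s + s') + w = - s' + (- s + w)" for w
    by (simp add: minus_add add.assoc diff_conv_add_uminus del: add_uminus_conv_diff)
  then show ?thesis using side_plus[of "- s'" D] assms by (simp add: halfspace_def lst_uminus_set)
qed

definition related :: "'b set \<Rightarrow> 'b set \<Rightarrow> 'b set \<Rightarrow> bool" where
  "related V M M' \<longleftrightarrow> (\<forall>x\<in>V. x \<in> M \<longrightarrow> x \<in> M') \<or> (\<forall>x\<in>V. x \<in> M' \<longrightarrow> x \<in> M) \<or>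
     (\<forall>x\<in>V. x \<in> M' \<longrightarrow> x \<notin> M) \<or> (\<forall>x\<in>V. x \<in> M' \<or> x \<in> M)"

definition legal_stk :: "'a red set red \<Rightarrow> bool" where "legal_stk s \<longleftrightarrow> {} \<notin> set (lst s)"

lemma legal_stk_diff: "legal_stk s \<Longrightarrow> legal_stk w \<Longrightarrow> legal_stk (- s + w)"
  using set_foldr_push[of "lst (- s)" "lst w"] by (auto simp: legal_stk_def lst_plus lst_uminus_set)

lemma Full_legal_stk: "x \<in> Full \<Longrightarrow> legal_stk (stk x)"
  using Full_legal by (simp add: legal_def legal_stk_def)

lemma halfspace_related_same:
  assumes "halftree D" "halftree D'" "legal_stk s"
  shows "related Full (halfspace s D') (halfspace s D)"
proof -
  have ne: "{} \<notin> set (lst (- s + stk x))" if "x \<in> Full" for x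
    using legal_stk_diff[OF assms(3) Full_legal_stk[OF that]] by (simp add: legal_stk_def)
  consider "D \<subseteq> D'" | "D' \<subseteq> D" | "D' \<subseteq> - D" | "- D \<subseteq> D'"
    using halftree_nested[OF assms(1,2)] by blast
  then show ?thesis
  proof cases
    case 1
    have "x \<in> halfspace s D'" if "x \<in> Full" "x \<in> halfspace s D" for x
      using side_mono[OF 1 ne[OF that(1)]] that(2) by (simp add: halfspace_def)
    then show ?thesis by (simp add: related_def)
  next
    case 2
    have "x \<in> halfspace s D" if "x \<in> Full" "x \<in> halfspace s D'" for x
      using side_mono[OF 2 ne[OF that(1)]] that(2) by (simp add: halfspace_def)
    then show ?thesis by (simp add: related_def)
  next
    case 3
    have "x \<notin> halfspace s D" if "x \<in> Full" "x \<in> halfspace s D'" for x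
      using side_mono[OF 3 ne[OF that(1)]] side_compl[OF ne[OF that(1)]] that(2) by (simp add: halfspace_def)
    then show ?thesis by (auto simp: related_def)
  next
    case 4
    have "x \<in> halfspace s D'" if "x \<in> Full" "x \<notin> halfspace s D" for x
      using side_mono[OF 4 ne[OF that(1)]] side_compl[OF ne[OF that(1)]] that(2) by (simp add: halfspace_def)
    then show ?thesis by (auto simp: related_def)
  qed
qed

text \<open>Unless both half-trees can be moved into one sheet, s is cut after its last coset c that
  does not straddle \<open>D'\<close>. A point whose stack does not begin with the cut
  \<open>s'\<close> meets c first and so has a fixed side for \<open>D'\<close>; a point whose stack
  begins with \<open>s'\<close> meets the first coset of \<open>s'\<close> that does not straddle D
  and so has a fixed side for D. Hence one of the four corners is empty.\<close>

lemma halfspace_related: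
  assumes D: "halftree D" "halftree D'" and s: "legal_stk s"
  shows "related Full (halfspace s D') (halfspace 0 D)"
proof (cases "\<forall>c\<in>set (lst s). straddles D' c")
  case True
  have "legal_stk 0" by (simp add: legal_stk_def)
  show ?thesis using halfspace_related_same[OF D \<open>legal_stk 0\<close>] halfspace_straddle[OF True] by simp
next
  case False
  define N where "N c \<longleftrightarrow> \<not> straddles D' c" for c
  have "\<exists>c\<in>set (lst s). N c" using False by (simp add: N_def)
  then obtain s1 c s2 where "lst s = s1 @ c # s2" "N c" "\<forall>c\<in>set s2. \<not> N c"
    using split_list_last_prop by metis
  then have s12: "lst s = s1 @ c # s2" "\<not> straddles D' c" "\<forall>c\<in>set s2. straddles D' c"
    by (simp_all add: N_def)
  obtain s' s'' where ss: "lst s' = s1 @ [c]" "lst s'' = s2" "s = s' + s''"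
    using red_append[of s "s1 @ [c]" s2] s12(1) by auto
  have sX: "halfspace s D' = halfspace s' D'"
    using halfspace_add_straddle[of s'' D' s'] ss s12(3) by simp
  have s'l: "legal_stk s'" using s s12(1) ss by (auto simp: legal_stk_def)
  have cne: "c \<noteq> {}" using s s12(1) by (auto simp: legal_stk_def)
  define Pre where "Pre = {x. prefix (lst s') (lst (stk x))}"
  have off: "x \<in> halfspace s D' \<longleftrightarrow> c \<subseteq> D'" if "x \<notin> Pre" for x
  proof -
    obtain p u v where d: "lst s' = p @ u" "lst (stk x) = p @ v" "lst (- s' + stk x) = rev (map flip u) @ v"
      by (rule lst_diff[of s' "stk x"])
    have "u \<noteq> []" using that d unfolding Pre_def by auto
    then obtain u' where u: "u = u' @ [c]" using d(1) ss(1) by (cases u rule: rev_cases) auto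
    have "lst (- s' + stk x) = c # rev (map flip u') @ v" using d(3) u by simp
    then show ?thesis using side_nonstraddle[of "[]" D' c] s12(2) cne unfolding sX unfolding halfspace_def by simp
  qed
  show ?thesis
  proof (cases "\<forall>c\<in>set (lst s'). straddles D c")
    case True
    then show ?thesis using halfspace_related_same[OF D s'l] halfspace_straddle[OF True] sX by simp
  next
    case False
    define N where "N c \<longleftrightarrow> \<not> straddles D c" for c
    have "\<exists>c\<in>set (lst s'). N c" using False by (simp add: N_def)
    then obtain l1 c0 l2 where "lst s' = l1 @ c0 # l2" "N c0" "\<forall>c\<in>set l1. \<not> N c"
      using split_list_first_prop by metis
    then have l: "lst s' = l1 @ c0 # l2" "\<not> straddles D c0" "\<forall>c\<in>set l1. straddles D c"
      by (simp_all add: N_def)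
    have c0: "c0 \<noteq> {}" using s'l l by (auto simp: legal_stk_def)
    have on: "x \<in> halfspace 0 D \<longleftrightarrow> c0 \<subseteq> D" if x: "x \<in> Pre" for x
    proof -
      obtain v where "lst (stk x) = l1 @ c0 # l2 @ v" using x l(1) unfolding Pre_def by (auto simp: prefix_def)
      then show ?thesis using side_nonstraddle[OF l(3,2) c0] by (simp add: halfspace_def)
    qed
    show ?thesis
      unfolding related_def using off on by (cases "c \<subseteq> D'"; cases "c0 \<subseteq> D") blast+
  qed
qed

text \<open>The sets M are counted and not the pairs of s and D, because sheets that differ by
  straddling cosets give the same half-space.\<close>

definition finitely_separated :: "'a red lamp \<Rightarrow> 'a red lamp \<Rightarrow> bool" where
  "finitely_separated x y \<longleftrightarrow>
    finite {M. (\<exists>s D. halftree D \<and> M = Full \<inter> halfspace s D) \<and> (x \<in> M) \<noteq> (y \<in> M)}"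

lemma finitely_separated_trans:
  assumes "finitely_separated x y" "finitely_separated y z"
  shows "finitely_separated x z"
proof -
  let ?H = "\<lambda>M. \<exists>s D. halftree D \<and> M = Full \<inter> halfspace s D"
  have sub: "{M. H M \<and> (x \<in> M) \<noteq> (z \<in> M)} \<subseteq> {M. H M \<and> (x \<in> M) \<noteq> (y \<in> M)} \<union> {M. H M \<and> (y \<in> M) \<noteq> (z \<in> M)}"
    for H by blast
  show ?thesis
    using finite_subset[OF sub[of ?H] finite_UnI] assms unfolding finitely_separated_def by simp
qed

lemma finitely_separated_sym: "finitely_separated x y \<Longrightarrow> finitely_separated y x"
  unfolding finitely_separated_def by (simp add: eq_commute)

text \<open>A half-space that separates two points of one sheet sees them only through straddling
  cosets. It can therefore be moved into their sheet, where finitely many half-trees separate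
  them.\<close>

lemma finitely_separated_lt:
  assumes "x \<in> Full"
  shows "finitely_separated x (x + lt u)"
proof -
  let ?w = "stk x"
  have stk': "stk (x + lt u) = ?w" "loc (x + lt u) = loc x + u" by (simp_all add: lt_def)
  have F: "x + lt u \<in> Full" using assms stk' by (simp add: Full_def)
  have "{M. (\<exists>s D. halftree D \<and> M = Full \<inter> halfspace s D) \<and> (x \<in> M) \<noteq> (x + lt u \<in> M)}
    \<subseteq> (\<lambda>D. Full \<inter> halfspace ?w D) ` {D. halftree D \<and> (loc x \<in> D) \<noteq> (loc x + u \<in> D)}"
  proof
    fix M assume "M \<in> {M. (\<exists>s D. halftree D \<and> M = Full \<inter> halfspace s D) \<and> (x \<in> M) \<noteq> (x + lt u \<in> M)}"
    then obtain s D where D0: "halftree D" "M = Full \<inter> halfspace s D" "(x \<in> M) \<noteq> (x + lt u \<in> M)" by blast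
    have "side D (lst (- s + ?w)) (loc x) \<noteq> side D (lst (- s + ?w)) (loc x + u)"
      using D0(3) assms F unfolding D0(2) halfspace_def Int_iff mem_Collect_eq stk' by blast
    note D = D0(1,2) this
    have diff: "(\<forall>c\<in>set l. straddles D c) \<and> (f \<in> D) \<noteq> (h \<in> D)"
      if "side D l f \<noteq> side D l h" for l f h
      using that by (induction l) (auto split: if_splits)
    have st: "\<forall>c\<in>set (lst (- s + ?w)). straddles D c" "(loc x \<in> D) \<noteq> (loc x + u \<in> D)"
      using diff[OF D(3)] by auto
    have "halfspace (s + (- s + ?w)) D = halfspace s D" using st by (intro halfspace_add_straddle)
    then have "M = Full \<inter> halfspace ?w D" using D(2) by (simp add: add.assoc[symmetric])
    then show "M \<in> (\<lambda>D. Full \<inter> halfspace ?w D) ` {D. halftree D \<and> (loc x \<in> D) \<noteq> (loc x + u \<in> D)}"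
      using D st by blast
  qed
  then show ?thesis
    unfolding finitely_separated_def
    by (rule finite_subset[OF _ finite_imageI[OF halftree_separating_finite]])
qed

text \<open>The final point f lies in c, so a non-straddling c at the end of the list decides just
  as f itself does.\<close>

lemma side_add_gen:
  assumes "f \<in> c"
  shows "side D (lst (w + gen c)) f = side D (lst w) f"
proof (cases "\<exists>l. lst w = l @ [c]")
  case True
  then obtain l where l: "lst w = l @ [c]" by blast
  obtain v v' where v: "lst v = l" "lst v' = [c]" "w = v + v'" using red_append[OF l] .
  have "v' = gen c" using v(2) lst_gen lst_eq_iff by metis
  then have "w + gen c = v" using v(3) by (simp add: add.assoc gen_set_double)
  then show ?thesis using side_snoc[OF assms] l v(1) by simp
next
  case False
  then have "lst w = [] \<or> last (lst w) \<noteq> c" by (metis append_butlast_last_id)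
  then have "lst (w + gen c) = lst w @ [c]"
    using lst_append[of w "gen c"] by (auto simp: successively_append_iff)
  then show ?thesis using side_snoc[OF assms] by simp
qed

lemma halfspace_add_t: "x + t \<in> halfspace s D \<longleftrightarrow> x \<in> halfspace s D"
proof -
  have "x + t = Lamp (stk x + gen (coset (loc x))) (loc x)"
    using Lamp_add_t[of "stk x" "loc x"] by simp
  then show ?thesis
    using side_add_gen[OF coset_self, of D "- s + stk x" "loc x"] by (simp add: halfspace_def add.assoc)
qed

lemma finitely_separated_t: "x \<in> Full \<Longrightarrow> finitely_separated x (x + t)"
proof -
  assume x: "x \<in> Full"
  then have "x + t \<in> Full" using t_Full Full_add by blast
  then have "{M. (\<exists>s D. halftree D \<and> M = Full \<inter> halfspace s D) \<and> (x \<in> M) \<noteq> (x + t \<in> M)} = {}"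
    using x halfspace_add_t by auto
  then show ?thesis by (simp only: finitely_separated_def finite.emptyI)
qed

lemma finitely_separated_0: "x \<in> Full \<Longrightarrow> finitely_separated 0 x"
proof -
  have "finitely_separated 0 (Lamp (of_lst w) f)" if "reduced w" "set w \<subseteq> range coset" for w f
    using that
  proof (induction w arbitrary: f rule: rev_induct)
    case Nil
    have "of_lst [] = (0 :: 'a red set red)" using of_lst_lst[of 0] by simp
    then show ?case using finitely_separated_lt[OF Full_zero, of f] by (simp add: lt_def)
  next
    case (snoc c w)
    then have w: "reduced w" "set w \<subseteq> range coset" by (auto simp: successively_append_iff)
    obtain r where c: "c = coset r" using snoc.prems by auto
    have "lst (of_lst w + gen c) = w @ [c]"
      using lst_append[of "of_lst w" "gen c"] w snoc.prems(1) by simp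
    then have wc: "of_lst w + gen c = of_lst (w @ [c])" by (metis of_lst_lst)
    let ?y = "Lamp (of_lst w) r"
    have y: "?y \<in> Full" using w by (simp add: Full_def)
    have "finitely_separated 0 ?y" using snoc.IH w by blast
    moreover have "finitely_separated ?y (?y + t)" using y by (rule finitely_separated_t)
    moreover have "finitely_separated (?y + t) (?y + t + lt (- r + f))"
      using y t_Full Full_add by (intro finitely_separated_lt) blast
    moreover have "?y + t + lt (- r + f) = Lamp (of_lst (w @ [c])) f"
      using c wc by (simp add: Lamp_add_t Lamp_add_lt add.assoc[symmetric])
    ultimately show ?case using finitely_separated_trans by metis
  qed
  from this[of "lst (stk x)" "loc x"] show "x \<in> Full \<Longrightarrow> finitely_separated 0 x"
    by (simp add: Full_def)
qed

lemma finitely_separated: "x \<in> Full \<Longrightarrow> y \<in> Full \<Longrightarrow> finitely_separated x y"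
  by (rule finitely_separated_trans[OF finitely_separated_sym[OF finitely_separated_0] finitely_separated_0])

end

section \<open>Axes of elements of the free factor\<close>

lemma cst_split_last:
  assumes "{} \<notin> set U"
  obtains p \<alpha> where "U = [] \<and> p = b \<or> U \<noteq> [] \<and> p \<in> hd U"
    "cst b (rev U @ V) q = \<alpha> + cst p V q" "\<And>v. cst b (rev U) v \<le> \<alpha> + len (- p + v)"
proof (cases U)
  case Nil
  then show ?thesis using that[of b 0] by simp
next
  case (Cons c U')
  have "c \<noteq> {}" "{} \<notin> set (rev U')" using assms Cons by auto
  from cst_append_ex[OF this, of b V q]
  obtain r where r: "r \<in> c" "cst b (rev U' @ c # V) q = cst b (rev U') r + cst r V q" by blast
  have "cst b (rev U' @ [c]) v \<le> cst b (rev U') r + cst r [] v" for v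
    using r \<open>{} \<notin> set (rev U')\<close> by (intro cst_append_le)
  then show ?thesis using that[of r "cst b (rev U') r"] r Cons by simp
qed

text \<open>Together with \<open>cst_split_last\<close> this cuts an optimal path on both sides of
  the wall. The remainders \<alpha> and \<beta> still give upper bounds when the path is ended or
  begun at another point v.\<close>

lemma cst_split_first:
  assumes "{} \<notin> set V"
  obtains q \<beta> where "V = [] \<and> q = e \<or> V \<noteq> [] \<and> q \<in> hd V"
    "cst p V e = len (- p + q) + \<beta>" "\<And>v. cst v V e \<le> len (- v + q) + \<beta>"
proof (cases V)
  case Nil
  then show ?thesis using that[of e 0] by simp
next
  case (Cons c V')
  have "c \<noteq> {}" using assms Cons by auto
  then obtain r where r: "r \<in> c" "cst p (c # V') e = len (- p + r) + cst r V' e"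
    using cst_Cons_ex by blast
  then show ?thesis using that[of r "cst r V' e"] cst_Cons_le[OF r(1)] Cons by simp
qed

lemma reduced_appendD: "reduced (u @ v) \<Longrightarrow> reduced u" "reduced (u @ v) \<Longrightarrow> reduced v"
  by (simp_all add: successively_append_iff)

context contracting_double begin

lemma nmul_lt: "nmul n (lt f) = lt (nmul n f)"
  by (induction n) (simp_all add: lt_0 lt_add)

lemma lt_mem_halfspace: "- lt h + x \<in> halfspace 0 D \<longleftrightarrow> x \<in> halfspace 0 ((+) h ` D)"
  using translate_halfspace[of "lt h" x D] by (simp add: lt_def)

lemma mem_halfspace_0: "x \<in> halfspace 0 D \<longleftrightarrow> side D (lst (stk x)) (loc x)"
  by (simp add: halfspace_def)

text \<open>The half-space is grown from the half-tree at the first letter of f in the base sheet.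
  Once the one coset that may leak is stripped from both stacks, the parts of a path towards x and
  towards y are attached on opposite sides of the middle wall, so the path passes the vertex
  \<open>v0\<close> of that wall in one of at most two sheets.\<close>

lemma elliptic_axis:
  assumes f: "f \<noteq> 0" "last (lst f) \<noteq> flip (hd (lst f))"
  shows "\<exists>E. full_axis (lt f) E"
proof -
  define a where "a = hd (lst f)"
  define D where "D = cyl [a]"
  define Dn where "Dn i = (+) (nmul i f) ` D" for i
  have hD: "halftree D" by (simp add: D_def halftree_cyl)
  have app: "lst (f + x) = lst f @ lst x" if "x \<in> D" for x
  proof (rule lst_append)
    have "hd (lst x) = a" "x \<noteq> 0" using that by (auto simp: D_def mem_cyl1)
    moreover have "a \<noteq> flip (last (lst f))" using f(2) unfolding a_def by (metis flip_flip)
    ultimately show "reduced (lst f @ lst x)" using f(1) by (simp add: successively_append_iff)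
  qed
  have shrink: "(+) f ` D \<subseteq> D"
  proof
    fix y assume "y \<in> (+) f ` D"
    then obtain x where "x \<in> D" "y = f + x" by blast
    then have "lst y = lst f @ lst x" using app by simp
    then have "hd (lst y) = a" "lst y \<noteq> []" using f by (simp_all add: a_def)
    then show "y \<in> D" unfolding D_def mem_cyl1 by simp
  qed
  have Dn_0: "Dn 0 = D" by (auto simp: Dn_def)
  have Dn_Suc: "Dn (Suc n) \<subseteq> Dn n" for n
  proof -
    have "Dn (Suc n) = (+) (nmul n f) ` (+) f ` D" by (simp add: Dn_def image_image add.assoc)
    then show ?thesis using shrink unfolding Dn_def by blast
  qed
  have Dn_mono: "Dn j \<subseteq> Dn i" if "i \<le> j" for i j
    using that by (induction rule: dec_induct) (use Dn_Suc in blast)+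
  from periodic_coset[OF f, folded a_def, folded D_def, folded Dn_def]
  obtain n where n0: "\<forall>c\<in>range coset. \<forall>c'\<in>range coset. \<not> c \<subseteq> D \<longrightarrow> c \<inter> Dn n \<noteq> {} \<longrightarrow>
      \<not> c' \<subseteq> D \<longrightarrow> c' \<inter> Dn n \<noteq> {} \<longrightarrow> c = c' \<and> (+) f ` c = c" ..
  note n = n0[rule_format]
  define v0 where "v0 = nmul n f"
  have Dn_n: "Dn n = (+) v0 ` cyl [a]" by (simp add: Dn_def v0_def D_def)
  have Dn_2n: "Dn (2 * n) = (+) v0 ` Dn n"
  proof -
    have "nmul (i + j) f = nmul i f + nmul j f" for i j
      by (induction j) (simp_all add: add.assoc)
    then show ?thesis by (simp add: Dn_def v0_def image_image add.assoc mult_2)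
  qed
  \<comment> \<open>The slab is \<open>2 * n\<close> translates thick: its first half keeps the
    non-leaking cosets towards x out of \<open>Dn n\<close>, and its second half forces those
    towards y into \<open>Dn n\<close>.\<close>
  define bad where "bad c \<longleftrightarrow> c \<in> range coset \<and> \<not> c \<subseteq> D \<and> c \<inter> Dn (2 * n) \<noteq> {}" for c
  have sub: "Dn (2 * n) \<subseteq> Dn n" "Dn n \<subseteq> D" using Dn_mono[of n "2 * n"] Dn_mono[of 0 n] Dn_0 by auto
  have bad_unique: "c = c'" if "bad c" "bad c'" for c c'
    using n[of c c'] that sub unfolding bad_def by blast
  \<comment> \<open>A coset crossing the first half of the slab is invariant under f, so it also
    reaches the end of the second half.\<close>
  have crossing1: "bad c" if c: "c \<in> range coset" "\<not> c \<subseteq> D" "c \<inter> Dn n \<noteq> {}" for c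
  proof -
    have "(+) f ` c = c" using n[of c c] c by simp
    then have "(+) (nmul k f) ` c = c" for k
    proof (induction k)
      case (Suc k)
      have "(+) (nmul (Suc k) f) ` c = (+) (nmul k f) ` (+) f ` c" by (simp add: image_image add.assoc)
      then show ?case using Suc by simp
    qed simp
    then have "(+) v0 ` c = c" by (simp add: v0_def)
    moreover obtain x where "x \<in> c" "x \<in> Dn n" using c by blast
    ultimately have "v0 + x \<in> c \<inter> Dn (2 * n)" unfolding Dn_2n by blast
    then show ?thesis using c unfolding bad_def by blast
  qed
  \<comment> \<open>The second half of the slab is the first half translated by
    \<open>v0\<close>.\<close>
  have crossing2: "bad c" if c: "c \<in> range coset" "\<not> c \<subseteq> Dn n" "c \<inter> Dn (2 * n) \<noteq> {}" for c
  proof -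
    define c' where "c' = (+) (- v0) ` c"
    have cc': "c = (+) v0 ` c'" unfolding c'_def by (auto simp: image_image add.assoc[symmetric])
    have c'r: "c' \<in> range coset" using c(1) coset_translate unfolding c'_def by force
    have "\<not> c' \<subseteq> D" using c(2) unfolding cc' Dn_def v0_def by blast
    moreover have "c' \<inter> Dn n \<noteq> {}"
    proof -
      obtain z where z: "z \<in> (+) v0 ` c'" "z \<in> (+) v0 ` Dn n" using c(3) unfolding cc' Dn_2n by blast
      from z(1) obtain x where "x \<in> c'" "z = v0 + x" by blast
      moreover from z(2) obtain y where "y \<in> Dn n" "z = v0 + y" by blast
      ultimately show ?thesis by auto
    qed
    ultimately have b: "bad c'" "(+) f ` c' = c'" using crossing1[of c'] n[of c' c'] c'r by simp_all
    then have "(+) (nmul k f) ` c' = c'" for k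
    proof (induction k)
      case (Suc k)
      have "(+) (nmul (Suc k) f) ` c' = (+) (nmul k f) ` (+) f ` c'" by (simp add: image_image add.assoc)
      then show ?case using Suc by simp
    qed simp
    then show ?thesis using b cc' by (simp add: v0_def)
  qed
  let ?E = "halfspace 0 D"
  have "full_axis (lt f) ?E"
    unfolding full_axis_def
  proof (intro conjI)
    have ne: "{} \<notin> set (lst (stk x))" if "x \<in> Full" for x
      using Full_legal_stk[OF that] by (simp add: legal_stk_def)
    show "\<forall>x\<in>Full. x \<in> ?E \<longrightarrow> lt f + x \<in> ?E"
    proof (intro ballI impI)
      fix x assume x: "x \<in> Full" "x \<in> ?E"
      have "D \<subseteq> (+) (- f) ` D"
      proof
        fix y assume "y \<in> D"
        then have "f + y \<in> D" using shrink by blast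
        then show "y \<in> (+) (- f) ` D" by (intro image_eqI[of _ _ "f + y"]) (simp_all add: add.assoc[symmetric])
      qed
      from side_mono[OF this ne[OF x(1)], of "loc x"] have "x \<in> halfspace 0 ((+) (- f) ` D)"
        using x(2) by (simp only: mem_halfspace_0)
      then show "lt f + x \<in> ?E" using lt_mem_halfspace[of "- f" x D] by (simp add: lt_uminus)
    qed
    show "\<forall>b. \<exists>x\<in>Full. x \<in> ?E \<and> - lt f + x \<notin> ?E \<and> even (len (stk x)) = b"
    proof
      fix b
      have ga: "gen a \<in> D" by (simp add: D_def mem_cyl)
      have "gen a \<notin> (+) f ` D"
      proof
        assume "gen a \<in> (+) f ` D"
        then obtain x where x: "x \<in> D" "gen a = f + x" by blast
        then have "length (lst f @ lst x) = 1" using app[OF x(1)] by (metis lst_gen One_nat_def length_Cons list.size(3))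
        moreover have "lst x \<noteq> []" using x by (auto simp: D_def mem_cyl)
        moreover have "lst f \<noteq> []" using f by simp
        ultimately show False by (cases "lst f"; cases "lst x") auto
      qed
      then have 1: "lt (gen a) \<in> ?E" "- lt f + lt (gen a) \<notin> ?E"
        using ga unfolding lt_mem_halfspace by (simp_all add: mem_halfspace_0 lt_def)
      have e: "even (len (stk (lt (gen a))))" "odd (len (stk (lt (gen a) + t)))"
        using even_stk_add[of "lt (gen a)" t] by (simp_all add: lt_def t_def)
      show "\<exists>x\<in>Full. x \<in> ?E \<and> - lt f + x \<notin> ?E \<and> even (len (stk x)) = b"
      proof (cases b)
        case True
        then show ?thesis using 1 e lt_Full by blast
      next
        case False
        have "- lt f + (lt (gen a) + t) \<notin> ?E"
          using halfspace_add_t[of "- lt f + lt (gen a)"] 1 by (simp only: add.assoc) simp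
        moreover have "lt (gen a) + t \<in> Full" using lt_Full t_Full Full_add by blast
        ultimately show ?thesis using 1 e False halfspace_add_t by blast
      qed
    qed
    show "\<forall>h\<in>Full. (\<forall>x\<in>Full. - h + x \<in> ?E \<longrightarrow> x \<in> ?E) \<or> (\<forall>x\<in>Full. x \<in> ?E \<longrightarrow> - h + x \<in> ?E) \<or>
       (\<forall>x\<in>Full. x \<in> ?E \<longrightarrow> - h + x \<notin> ?E) \<or> (\<forall>x\<in>Full. x \<in> ?E \<or> - h + x \<in> ?E)"
    proof
      fix h assume h: "h \<in> Full"
      have "halftree ((+) (loc h) ` D)" unfolding D_def by (rule halftree_translate_cyl1)
      from halfspace_related[OF hD this Full_legal_stk[OF h]]
      show "(\<forall>x\<in>Full. - h + x \<in> ?E \<longrightarrow> x \<in> ?E) \<or> (\<forall>x\<in>Full. x \<in> ?E \<longrightarrow> - h + x \<in> ?E) \<or>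
       (\<forall>x\<in>Full. x \<in> ?E \<longrightarrow> - h + x \<notin> ?E) \<or> (\<forall>x\<in>Full. x \<in> ?E \<or> - h + x \<in> ?E)"
        unfolding translate_halfspace related_def .
    qed
    show "\<forall>x\<in>Full. \<forall>y\<in>Full. finite {{z \<in> Full. - h + z \<in> ?E} | h. h \<in> Full \<and> (- h + x \<in> ?E) \<noteq> (- h + y \<in> ?E)}"
    proof (intro ballI)
      fix x y assume xy: "x \<in> Full" "y \<in> Full"
      have "{{z \<in> Full. - h + z \<in> ?E} | h. h \<in> Full \<and> (- h + x \<in> ?E) \<noteq> (- h + y \<in> ?E)}
        \<subseteq> {M. (\<exists>s D. halftree D \<and> M = Full \<inter> halfspace s D) \<and> (x \<in> M) \<noteq> (y \<in> M)}"
      proof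
        fix M assume "M \<in> {{z \<in> Full. - h + z \<in> ?E} | h. h \<in> Full \<and> (- h + x \<in> ?E) \<noteq> (- h + y \<in> ?E)}"
        then obtain h where h: "M = {z \<in> Full. - h + z \<in> ?E}" "(- h + x \<in> ?E) \<noteq> (- h + y \<in> ?E)" by auto
        have "M = Full \<inter> halfspace (stk h) ((+) (loc h) ` D)" unfolding h(1) translate_halfspace by blast
        moreover have "halftree ((+) (loc h) ` D)" unfolding D_def by (rule halftree_translate_cyl1)
        moreover have "(x \<in> M) \<noteq> (y \<in> M)" using h xy by simp
        ultimately show "M \<in> {M. (\<exists>s D. halftree D \<and> M = Full \<inter> halfspace s D) \<and> (x \<in> M) \<noteq> (y \<in> M)}"
          by blast
      qed
      then show "finite {{z \<in> Full. - h + z \<in> ?E} | h. h \<in> Full \<and> (- h + x \<in> ?E) \<noteq> (- h + y \<in> ?E)}"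
        using finitely_separated[OF xy] unfolding finitely_separated_def by (rule finite_subset)
    qed
    \<comment> \<open>The vertex \<open>v0\<close> in all sheets whose stack consists of leaking
      cosets. There is at most one such coset and stacks are reduced, so there are at most two
      sheets.\<close>
    define Z where "Z = {z. loc z = v0 \<and> (stk z = 0 \<or> (\<exists>c. bad c \<and> stk z = gen c))}"
    have finZ: "finite Z"
    proof (cases "\<exists>c. bad c")
      case True
      then obtain c where c: "bad c" by blast
      have "Z \<subseteq> {Lamp 0 v0, Lamp (gen c) v0}"
        unfolding Z_def using bad_unique[OF c] by (auto intro: lamp.expand)
      then show ?thesis using finite_subset by blast
    next
      case False
      then have "Z \<subseteq> {Lamp 0 v0}" unfolding Z_def by (auto intro: lamp.expand)
      then show ?thesis using finite_subset by blast
    qed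
    have all_bad_short: "stk z = 0 \<or> (\<exists>c. bad c \<and> stk z = gen c)" if zb: "\<forall>c\<in>set (lst (stk z)). bad c" for z
    proof (cases "lst (stk z)")
      case (Cons c l)
      show ?thesis
      proof (cases l)
        case Nil
        then have "lst (stk z) = lst (gen c)" using Cons by simp
        then have "stk z = gen c" by (rule lst_eq_iff[THEN iffD1])
        moreover have "bad c" using zb Cons by simp
        ultimately show ?thesis by blast
      next
        case (Cons c' l')
        then have "c' \<noteq> c" using \<open>lst (stk z) = c # l\<close> reduced_lst[of "stk z"] by (simp add: successively_Cons)
        moreover have "bad c" "bad c'" using zb Cons \<open>lst (stk z) = c # l\<close> by simp_all
        ultimately show ?thesis using bad_unique by metis
      qed
    qed simp
    have "\<exists>C. \<forall>x\<in>Full. \<forall>y\<in>Full. (x \<notin> ?E \<and> - nmul (2 * n) (lt f) + y \<in> ?E) \<longrightarrow> dst x 0 + dst 0 y \<le> dst x y + C"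
    proof (rule bottleneck_of_finite[OF finZ])
      show "Z \<subseteq> Full" unfolding Z_def bad_def Full_def by auto
      fix x y assume xy: "x \<in> Full" "y \<in> Full" and as: "x \<notin> ?E \<and> - nmul (2 * n) (lt f) + y \<in> ?E"
      define sx sy where "sx = lst (stk x)" and "sy = lst (stk y)"
      have nex: "{} \<notin> set sx" "{} \<notin> set sy" using ne xy by (auto simp: sx_def sy_def)
      have rng: "set sx \<subseteq> range coset" "set sy \<subseteq> range coset"
        using xy by (auto simp: Full_def sx_def sy_def)
      have x0: "\<not> side D sx (loc x)" using as by (simp add: mem_halfspace_0 sx_def)
      have y2: "side (Dn (2 * n)) sy (loc y)"
        using as unfolding nmul_lt lt_mem_halfspace by (simp add: mem_halfspace_0 sy_def Dn_def)
      have xn: "\<not> side (Dn n) sx (loc x)" using side_mono[OF sub(2) nex(1)] x0 by blast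
      have x2: "\<not> side (Dn (2 * n)) sx (loc x)" using side_mono[OF sub(1) nex(1)] xn by blast
      have yn: "side (Dn n) sy (loc y)" using side_mono[OF sub(1) nex(2)] y2 by blast
      have y0: "side D sy (loc y)" using side_mono[OF sub(2) nex(2)] yn by blast
      obtain l ux uy where d: "sx = l @ ux" "sy = l @ uy" "ux = [] \<or> uy = [] \<or> hd ux \<noteq> hd uy"
        "lst (- stk x + stk y) = rev (map flip ux) @ uy"
        unfolding sx_def sy_def by (rule lst_diff[of "stk x" "stk y"])
      have bad_str: "straddles D c" "straddles (Dn n) c" "straddles (Dn (2 * n)) c" if "bad c" for c
        using that sub unfolding bad_def by blast+
      \<comment> \<open>A non-leaking coset in the common part of both stacks would put x and y on
        the same side of D or of \<open>Dn (2 * n)\<close>.\<close>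
      have l_bad: "\<forall>c\<in>set l. bad c"
      proof (rule ccontr)
        assume "\<not> ?thesis"
        then obtain l1 c l2 where l: "l = l1 @ c # l2" "\<not> bad c" "\<forall>c\<in>set l1. bad c"
          using split_list_first_prop[of l "\<lambda>c. \<not> bad c"] by auto
        have c: "c \<in> range coset" "c \<noteq> {}" using rng d(1) l(1) nex by auto
        have same: "straddles M c" if M: "\<forall>c\<in>set l1. straddles M c" "\<not> side M sx (loc x)" "side M sy (loc y)" for M
        proof (rule ccontr)
          assume "\<not> straddles M c"
          from side_nonstraddle[OF M(1) this c(2)] show False using M(2,3) d(1,2) l(1) by simp
        qed
        have "straddles D c" using same[of D] l(3) bad_str x0 y0 by blast
        moreover have "straddles (Dn (2 * n)) c" using same[of "Dn (2 * n)"] l(3) bad_str x2 y2 by blast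
        ultimately show False using l(2) c unfolding bad_def by blast
      qed
      \<comment> \<open>A leaking coset directly after the common part is split off. Only one of the
        two stacks can have it, because they continue differently and the leaking coset is
        unique.\<close>
      define bx where "bx = (if ux \<noteq> [] \<and> bad (hd ux) then [hd ux] else [])"
      define by' where "by' = (if uy \<noteq> [] \<and> bad (hd uy) then [hd uy] else [])"
      define ux' where "ux' = drop (length bx) ux"
      define uy' where "uy' = drop (length by') uy"
      have ux: "ux = bx @ ux'" by (cases ux) (auto simp: bx_def ux'_def)
      have uy: "uy = by' @ uy'" by (cases uy) (auto simp: by'_def uy'_def)
      have bb: "\<forall>c\<in>set bx. bad c" "\<forall>c\<in>set by'. bad c" by (auto simp: bx_def by'_def)
      have one: "bx = [] \<or> by' = []" using d(3) bad_unique by (auto simp: bx_def by'_def)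
      have len1: "length bx \<le> 1" "length by' \<le> 1" by (auto simp: bx_def by'_def)
      have e: "l @ bx @ ux' = lst (stk x)" "l @ by' @ uy' = lst (stk y)"
        using d(1,2) ux uy by (simp_all add: sx_def sy_def)
      have rdx: "reduced (l @ bx @ ux')" "reduced (l @ by' @ uy')"
        by (simp_all only: e reduced_lst)
      have hux: "\<not> bad (hd ux')" if h: "ux' \<noteq> []"
      proof
        assume bad': "bad (hd ux')"
        show False
        proof (cases "bx = []")
          case True
          then have "ux = ux'" using ux by simp
          then have "bx = [hd ux]" unfolding bx_def using h bad' by simp
          then show False using True by simp
        next
          case False
          then have c: "bx = [hd ux]" unfolding bx_def by presburger
          then have "hd ux' \<noteq> hd ux" using rdx(1) h by (simp add: successively_append_iff successively_Cons)
          moreover have "bad (hd ux)" using bb(1) c by simp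
          ultimately show False using bad_unique bad' by blast
        qed
      qed
      have huy: "\<not> bad (hd uy')" if h: "uy' \<noteq> []"
      proof
        assume bad': "bad (hd uy')"
        show False
        proof (cases "by' = []")
          case True
          then have "uy = uy'" using uy by simp
          then have "by' = [hd uy]" unfolding by'_def using h bad' by simp
          then show False using True by simp
        next
          case False
          then have c: "by' = [hd uy]" unfolding by'_def by presburger
          then have "hd uy' \<noteq> hd uy" using rdx(2) h by (simp add: successively_append_iff successively_Cons)
          moreover have "bad (hd uy)" using bb(2) c by simp
          ultimately show False using bad_unique bad' by blast
        qed
      qed
      have preb: "\<forall>c\<in>set (l @ bx). bad c" "\<forall>c\<in>set (l @ by'). bad c" using l_bad bb by auto
      have sdx: "side M sx (loc x) = side M ux' (loc x)" if "M = D \<or> M = Dn n \<or> M = Dn (2 * n)" for M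
        using side_append[of "l @ bx" M ux' "loc x"] preb(1) bad_str that d(1) ux by auto
      have sdy: "side M sy (loc y) = side M uy' (loc y)" if "M = D \<or> M = Dn n \<or> M = Dn (2 * n)" for M
        using side_append[of "l @ by'" M uy' "loc y"] preb(2) bad_str that d(2) uy by auto
      have pout: "p \<notin> Dn n" if p: "ux' = [] \<and> p = loc x \<or> ux' \<noteq> [] \<and> p \<in> hd ux'" for p
      proof (cases ux')
        case Nil
        then show ?thesis using p xn sdx[of "Dn n"] by simp
      next
        case (Cons c k)
        have c: "c \<in> range coset" "c \<noteq> {}" "p \<in> c" "\<not> bad c" using rng nex d(1) ux Cons p hux by auto
        have s0: "\<not> side D (c # k) (loc x)" "\<not> side (Dn n) (c # k) (loc x)"
          using x0 xn sdx[of D] sdx[of "Dn n"] Cons by auto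
        have "c \<inter> Dn n = {}"
        proof (rule ccontr)
          assume ne': "c \<inter> Dn n \<noteq> {}"
          then have "c \<subseteq> D" using crossing1 c by blast
          then show False using s0(1) by simp
        qed
        then show ?thesis using c by blast
      qed
      have qin: "q \<in> Dn n" if q: "uy' = [] \<and> q = loc y \<or> uy' \<noteq> [] \<and> q \<in> hd uy'" for q
      proof (cases uy')
        case Nil
        then show ?thesis using q yn sdy[of "Dn n"] by simp
      next
        case (Cons c k)
        have c: "c \<in> range coset" "c \<noteq> {}" "q \<in> c" "\<not> bad c" using rng nex d(2) uy Cons q huy by auto
        have s0: "side (Dn (2 * n)) (c # k) (loc y)" using y2 sdy[of "Dn (2 * n)"] Cons by auto
        have "c \<subseteq> Dn n"
        proof (rule ccontr)
          assume ne': "\<not> c \<subseteq> Dn n"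
          then have "c \<inter> Dn (2 * n) = {}" using crossing2 c by blast
          then show False using s0 c(2) by (auto split: if_splits)
        qed
        then show ?thesis using c by blast
      qed
      have neu: "{} \<notin> set ux'" "{} \<notin> set uy'" "{} \<notin> set bx" "{} \<notin> set by'" using nex d(1,2) ux uy by auto
      have mapflip: "map flip k = k" for k :: "'a red set list" by (induction k) auto
      have zdist: "dst x (Lamp (of_lst k) v0) = cst (loc x) (rev kx @ ky) v0"
        if "sx = k0 @ kx" "k = k0 @ ky" "reduced (rev kx @ ky)" "reduced k" for k k0 kx ky
      proof -
        have "lst (- stk x + of_lst k) = foldr push (rev (k0 @ kx)) (k0 @ ky)"
          using that lst_of_lst[OF that(4)] by (simp add: lst_plus lst_uminus_set sx_def)
        also have "\<dots> = foldr push (rev kx) ky"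
          using foldr_push_inverse[of k0 ky] by (simp add: mapflip del: flip_set_def)
        also have "\<dots> = rev kx @ ky" using that(3) by (rule foldr_push_append)
        finally show ?thesis by (simp add: dst_def)
      qed
      have zdist': "dst (Lamp (of_lst k) v0) y = cst v0 (rev kz @ ky) (loc y)"
        if "sy = k0 @ ky" "k = k0 @ kz" "reduced (rev kz @ ky)" "reduced k" for k k0 kz ky
      proof -
        have "lst (- of_lst k + stk y) = foldr push (rev (k0 @ kz)) (k0 @ ky)"
          using that lst_of_lst[OF that(4)] by (simp add: lst_plus lst_uminus_set sy_def)
        also have "\<dots> = foldr push (rev kz) ky"
          using foldr_push_inverse[of k0 ky] by (simp add: mapflip del: flip_set_def)
        also have "\<dots> = rev kz @ ky" using that(3) by (rule foldr_push_append)
        finally show ?thesis by (simp add: dst_def)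
      qed
      have rx0: "reduced (l @ bx)" "reduced (l @ by')" "reduced ux'" "reduced uy'"
        using rdx reduced_appendD(1)[of "l @ bx" ux'] reduced_appendD(2)[of "l @ bx" ux']
          reduced_appendD(1)[of "l @ by'" uy'] reduced_appendD(2)[of "l @ by'" uy'] by simp_all
      then have "reduced (rev ux')" using reduced_rev_flip[of ux'] by (simp only: mapflip)
      note rx = rx0(1,2) this rx0(4)
      have inZ: "Lamp (of_lst k) v0 \<in> Z" if "reduced k" "\<forall>c\<in>set k. bad c" for k
        using all_bad_short[of "Lamp (of_lst k) v0"] that lst_of_lst[OF that(1)] by (simp add: Z_def)
      define mid where "mid = rev bx @ by'"
      have dxy: "dst x y = cst (loc x) (rev ux' @ mid @ uy') (loc y)"
        using d(4) ux uy by (simp add: dst_def mid_def mapflip del: flip_set_def)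
      have e2: "rev ux' @ mid @ uy' = lst (- stk x + stk y)"
        using d(4) ux uy by (simp add: mid_def mapflip del: flip_set_def)
      have rmid: "reduced (rev ux' @ mid @ uy')" by (simp only: e2 reduced_lst)
      have r1: "reduced (rev ux' @ mid)" "reduced (mid @ uy')"
        using rmid reduced_appendD(1)[of "rev ux' @ mid" uy'] reduced_appendD(2)[of "rev ux'" "mid @ uy'"]
        by simp_all
      obtain p \<alpha> where p: "ux' = [] \<and> p = loc x \<or> ux' \<noteq> [] \<and> p \<in> hd ux'"
        "cst (loc x) (rev ux' @ (mid @ uy')) (loc y) = \<alpha> + cst p (mid @ uy') (loc y)"
        "\<And>v. cst (loc x) (rev ux') v \<le> \<alpha> + len (- p + v)"
        using cst_split_last[OF neu(1), of "loc x" "mid @ uy'" "loc y"] by blast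
      show "\<exists>z\<in>Z. dst x z + dst z y \<le> dst x y"
      proof (cases mid)
        case Nil
        then have b0: "bx = []" "by' = []" by (auto simp: mid_def)
        obtain q \<beta> where q: "uy' = [] \<and> q = loc y \<or> uy' \<noteq> [] \<and> q \<in> hd uy'"
          "cst p uy' (loc y) = len (- p + q) + \<beta>" "\<And>v. cst v uy' (loc y) \<le> len (- v + q) + \<beta>"
          using cst_split_first[OF neu(2), of "loc y" p] by blast
        have between: "len (- p + q) = len (- p + v0) + len (- v0 + q)"
          by (rule between_halftree[OF pout[OF p(1), unfolded Dn_n] qin[OF q(1), unfolded Dn_n]])
        let ?z = "Lamp (of_lst l) v0"
        have "dst x ?z = cst (loc x) (rev ux') v0"
          using zdist[of l ux' l "[]"] d(1) ux b0 rx by simp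
        moreover have "dst ?z y = cst v0 uy' (loc y)"
          using zdist'[of l uy' l "[]"] d(2) uy b0 rx by simp
        moreover have "dst x y = \<alpha> + (len (- p + q) + \<beta>)"
          using p(2) q(2) Nil unfolding dxy by simp
        ultimately have "dst x ?z + dst ?z y \<le> dst x y"
          using p(3)[of v0] q(3)[of v0] between by linarith
        then show ?thesis using inZ[of l] rx b0 l_bad by auto
      next
        case (Cons c k)
        have k: "k = []" using Cons one len1 by (cases bx; cases by') (auto simp: mid_def)
        have mid: "mid = [c]" using Cons k by simp
        have "c \<in> set (rev bx @ by')" using mid unfolding mid_def by (metis list.set_intros(1))
        then have cne: "c \<noteq> {}" using neu(3,4) by auto
        obtain r where r: "r \<in> c" "cst p (c # uy') (loc y) = len (- p + r) + cst r uy' (loc y)"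
          using cst_Cons_ex[OF cne] by blast
        obtain q \<beta> where q: "uy' = [] \<and> q = loc y \<or> uy' \<noteq> [] \<and> q \<in> hd uy'"
          "cst r uy' (loc y) = len (- r + q) + \<beta>" "\<And>v. cst v uy' (loc y) \<le> len (- v + q) + \<beta>"
          using cst_split_first[OF neu(2), of "loc y" r] by blast
        have total: "dst x y = \<alpha> + len (- p + r) + (len (- r + q) + \<beta>)"
          using p(2) r(2) q(2) mid unfolding dxy by simp
        \<comment> \<open>If the leaking coset is crossed at a point r beyond the middle wall,
          \<open>v0\<close> is passed before the crossing, in a sheet on the side of x; otherwise it
          is passed after the crossing, on the side of y.\<close>
        show ?thesis
        proof (cases "r \<in> Dn n")
          case True
          have between: "len (- p + r) = len (- p + v0) + len (- v0 + r)"
            by (rule between_halftree[OF pout[OF p(1), unfolded Dn_n] True[unfolded Dn_n]])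
          let ?z = "Lamp (of_lst (l @ bx)) v0"
          have "dst x ?z = cst (loc x) (rev ux') v0"
            using zdist[of "l @ bx" ux' "l @ bx" "[]"] d(1) ux rx by simp
          moreover have "dst ?z y = cst v0 (mid @ uy') (loc y)"
            using zdist'[of l "by' @ uy'" "l @ bx" bx] d(2) uy rx r1 by (simp add: mid_def)
          moreover have "cst v0 (mid @ uy') (loc y) \<le> len (- v0 + r) + cst r uy' (loc y)"
            unfolding mid using cst_Cons_le[OF r(1)] by simp
          moreover have "cst (loc x) (rev ux') v0 \<le> \<alpha> + len (- p + v0)" by (rule p(3))
          ultimately have "dst x ?z + dst ?z y \<le> dst x y" using between total q(2) by linarith
          then show ?thesis using inZ[OF rx(1) preb(1)] by blast
        next
          case False
          have between: "len (- r + q) = len (- r + v0) + len (- v0 + q)"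
            by (rule between_halftree[OF False[unfolded Dn_n] qin[OF q(1), unfolded Dn_n]])
          let ?z = "Lamp (of_lst (l @ by')) v0"
          have "dst x ?z = cst (loc x) (rev ux' @ mid) v0"
            using zdist[of l "bx @ ux'" "l @ by'" by'] d(1) ux rx r1 by (simp add: mid_def)
          moreover have "cst (loc x) (rev ux' @ [c]) v0 \<le> cst (loc x) (rev ux') r + cst r [] v0"
            using neu(1) r(1) by (intro cst_append_le) auto
          moreover have "cst (loc x) (rev ux') r \<le> \<alpha> + len (- p + r)" by (rule p(3))
          moreover have "dst ?z y = cst v0 uy' (loc y)"
            using zdist'[of "l @ by'" uy' "l @ by'" "[]"] d(2) uy rx by simp
          moreover have "cst v0 uy' (loc y) \<le> len (- v0 + q) + \<beta>" by (rule q(3))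
          ultimately have "dst x ?z + dst ?z y \<le> dst x y" using between total mid by simp
          then show ?thesis using inZ[OF rx(2) preb(2)] by blast
        qed
      qed
    qed
    then obtain C where "\<forall>x\<in>Full. \<forall>y\<in>Full. (x \<notin> ?E \<and> - nmul (2 * n) (lt f) + y \<in> ?E) \<longrightarrow>
      dst x 0 + dst 0 y \<le> dst x y + C" ..
    then show "\<exists>N C. \<forall>x\<in>Full. \<forall>y\<in>Full. x \<notin> ?E \<longrightarrow> - nmul N (lt f) + y \<in> ?E \<longrightarrow> dst x 0 + dst 0 y \<le> dst x y + C"
      by - (rule exI[of _ "2 * n"], rule exI[of _ C], blast)
  qed
  then show ?thesis ..
qed

end

section \<open>Cyclic reduction\<close>

lemma red_conj_split:
  fixes u :: "'a::invol red"
  assumes "lst u = a # l" "l \<noteq> []"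
  obtains m where "u = gen a + m + gen (last l)" "len u = len m + 2"
proof -
  obtain v where v: "lst v = l" "u = gen a + v" using red_Cons[OF assms(1)] .
  have "lst v = butlast l @ [last l]" using v(1) assms(2) by simp
  then obtain m k where m: "lst m = butlast l" "lst k = [last l]" "v = m + k" by (rule red_append)
  have "lst k = lst (gen (last l))" using m(2) by simp
  then have "k = gen (last l)" by (rule lst_eq_iff[THEN iffD1])
  then show ?thesis using that[of m] v m assms by (simp add: add.assoc)
qed

context contracting_double begin

text \<open>A shortest conjugate is cyclically reduced; \<open>flip_neq\<close> excludes a
  one-letter word that is its own inverse.\<close>

lemma ex_cyclically_reduced:
  fixes f :: "'a red"
  assumes "f \<noteq> 0"
  obtains v h where "h \<noteq> 0" "f = v + h - v" "last (lst h) \<noteq> flip (hd (lst h))"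
proof -
  define v where "v = (ARG_MIN (\<lambda>v. len (- v + f + v)) v. True)"
  define h where "h = - v + f + v"
  have min: "len h \<le> len (- v' + f + v')" for v'
    unfolding h_def v_def by (rule arg_min_nat_le) simp
  have f: "f = v + h - v"
    by (simp add: h_def add.assoc diff_conv_add_uminus del: add_uminus_conv_diff)
  have h0: "h \<noteq> 0" using f assms by auto
  have "last (lst h) \<noteq> flip (hd (lst h))"
  proof
    assume eq: "last (lst h) = flip (hd (lst h))"
    obtain a l where al: "lst h = a # l" using h0 by (cases "lst h") simp_all
    have "l \<noteq> []" using eq al flip_neq[of a] by auto
    then obtain m where m: "h = gen a + m + gen (last l)" "len h = len m + 2"
      using red_conj_split[OF al] by blast
    have "last l = flip a" using eq al \<open>l \<noteq> []\<close> by simp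
    then have "- gen a + h + gen a = m"
      using m(1) by (simp add: uminus_gen[symmetric] add.assoc diff_conv_add_uminus del: add_uminus_conv_diff)
    moreover have "- gen a + h + gen a = - (v + gen a) + f + (v + gen a)"
      by (simp add: h_def add.assoc minus_add diff_conv_add_uminus del: add_uminus_conv_diff)
    ultimately show False using min[of "v + gen a"] m(2) by simp
  qed
  then show ?thesis using that h0 f by blast
qed

text \<open>Conjugation in \<open>Full\<close> minimises the stack. If it becomes empty, an element
  of F remains; otherwise it is cyclically reduced, since conjugation by the reflection in its first
  coset would remove two cosets. That reflection is odd, which is why axes are treated in
  \<open>Full\<close>.\<close>

lemma ex_full_axis:
  assumes g: "g \<in> GA" "g \<noteq> 0"
  shows "\<exists>E. full_axis g E"
proof -
  define u where "u = (ARG_MIN (\<lambda>u. len (stk (- u + g + u))) u. u \<in> Full)"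
  have u: "u \<in> Full" and min: "\<And>u'. u' \<in> Full \<Longrightarrow> len (stk (- u + g + u)) \<le> len (stk (- u' + g + u'))"
    unfolding u_def using arg_min_nat_lemma[of "\<lambda>u. u \<in> Full" 0 "\<lambda>u. len (stk (- u + g + u))"] Full_zero
    by auto
  define h where "h = - u + g + u"
  have gh: "g = u + h - u"
    by (simp add: h_def add.assoc diff_conv_add_uminus del: add_uminus_conv_diff)
  have hF: "h \<in> Full"
    unfolding h_def by (intro Full_add Full_uminus u GA_Full g)
  have "even (len (stk g))" using g by (simp add: GA_def)
  then have ev: "even (len (stk h))"
    unfolding h_def even_stk_add even_stk_uminus by simp
  have h0: "h \<noteq> 0" using gh g by auto
  have "\<exists>E. full_axis h E"
  proof (cases "stk h = 0")
    case True
    then have h: "h = lt (loc h)" by (simp add: lt_def lamp.expand)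
    then have "loc h \<noteq> 0" using h0 lt_0 by auto
    then obtain v k where k: "k \<noteq> 0" "loc h = v + k - v" "last (lst k) \<noteq> flip (hd (lst k))"
      by (rule ex_cyclically_reduced)
    obtain E where "full_axis (lt k) E" using elliptic_axis[OF k(1,3)] ..
    then have "full_axis (lt v + lt k - lt v) {x. - lt v + x \<in> E}" using full_axis_conj lt_Full by blast
    moreover have "lt v + lt k - lt v = lt (v + k - v)"
      by (simp add: diff_conv_add_uminus lt_uminus lt_add del: add_uminus_conv_diff)
    moreover have "lt (v + k - v) = h" using h k(2) by simp
    ultimately show ?thesis by auto
  next
    case False
    show ?thesis
    proof (rule loxodromic_axis[OF hF False ev], rule)
      assume eq: "last (lst (stk h)) = (+) (loc h) ` hd (lst (stk h))"
      obtain c l where cl: "lst (stk h) = c # l" using False by (cases "lst (stk h)") simp_all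
      have "l \<noteq> []" using ev cl by auto
      then obtain m where m: "stk h = gen c + m + gen (last l)" "len (stk h) = len m + 2"
        using red_conj_split[OF cl] by blast
      define z where "z = Lamp (gen c) (0 :: 'a red)"
      have zF: "z \<in> Full" using hF cl by (auto simp: z_def Full_def)
      have lastl: "last l = (+) (loc h) ` c" using eq cl \<open>l \<noteq> []\<close> by simp
      have "stk (- z + h + z) = - gen c + (stk h + gen (last l))"
        by (simp add: z_def act_gen lastl add.assoc)
      also have "\<dots> = m" by (simp add: m(1) add.assoc gen_set_double)
      finally have "len (stk (- z + h + z)) < len (stk h)" using m(2) by simp
      moreover have "- z + h + z = - (u + z) + g + (u + z)"
        by (simp add: h_def add.assoc minus_add diff_conv_add_uminus del: add_uminus_conv_diff lamp_simps)
      ultimately show False using min[of "u + z"] u zF Full_add unfolding h_def by (simp del: lamp_simps)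
    qed
  qed
  then obtain E where "full_axis h E" ..
  then show ?thesis using full_axis_conj[OF u] gh by auto
qed

theorem double_conclusions:
  "torsion_free NG"
  "\<forall>g\<in>carrier NG. g \<noteq> \<one>\<^bsub>NG\<^esub> \<longrightarrow> strongly_contracting NG (enc ` SG) (generate NG {g})"
  "HEC NG"
proof -
  have good: "\<exists>E. axis_half_space g E" if g: "g \<in> GA" "g \<noteq> 0" for g
  proof -
    obtain E where "full_axis g E" using ex_full_axis[OF g] ..
    then have "axis_half_space g E" by (rule axis_half_space_of_full)
    then show ?thesis ..
  qed
  show "torsion_free NG" by (rule NG_conclusions(1)[OF good])
  show "\<forall>g\<in>carrier NG. g \<noteq> \<one>\<^bsub>NG\<^esub> \<longrightarrow> strongly_contracting NG (enc ` SG) (generate NG {g})"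
    by (rule NG_conclusions(2)[OF good])
  show "HEC NG" by (rule NG_conclusions(3)[OF good])
qed

end

section \<open>Loops in a labelled line with rungs\<close>

text \<open>\<open>None\<close> labels the rungs and \<open>Some\<close> the edges of the line; the
  boolean is the direction of travel. The free group on these letters has rank five.\<close>

datatype letter = Letter "(bool \<times> bool) option" bool

instance letter :: finite
proof
  have "x \<in> (\<lambda>(l, b). Letter l b) ` UNIV" for x by (cases x) auto
  then show "finite (UNIV :: letter set)" by (rule finite_surj[OF finite, OF subsetI])
qed

instantiation letter :: invol
begin
primrec flip_letter where "flip (Letter l b) = Letter l (\<not> b)"
instance
proof
  show "flip (flip a) = a" for a :: letter by (cases a) simp
qed
end

lemma flip_letter_neq: "flip a \<noteq> (a :: letter)"
  by (cases a) simp

text \<open>The period doubling sequence.\<close>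

definition par :: "int \<Rightarrow> bool" where "par i = even (multiplicity 2 i)"

text \<open>Let k be the 2-adic valuation of d. Some t below \<open>2 ^ (k + 2)\<close> gives
  \<open>x + t + d\<close> the valuation \<open>k + 1\<close>, and then \<open>x + t\<close> has
  valuation k. The bound on t follows because \<open>2 ^ k\<close> is at most
  \<open>\<bar>d\<bar>\<close>.\<close>

lemma par_mismatch:
  assumes "d \<noteq> 0"
  shows "\<exists>t. 0 \<le> t \<and> t < 4 * \<bar>d\<bar> \<and> par (x + t) \<noteq> par (x + t + d)"
proof -
  define k where "k = multiplicity 2 d"
  obtain q where q: "d = 2 ^ k * q" "\<not> 2 dvd q"
    unfolding k_def using multiplicity_decompose'[of d 2] assms by auto
  define t where "t = (2 ^ (k + 1) - d - x) mod 2 ^ (k + 2)"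
  have t: "0 \<le> t" "t < 2 ^ (k + 2)" unfolding t_def by simp_all
  have "q \<noteq> 0" using q(2) by auto
  then have "1 * 2 ^ k \<le> \<bar>q\<bar> * 2 ^ k" by (intro mult_right_mono) auto
  then have "4 * 2 ^ k \<le> 4 * \<bar>d\<bar>" using q(1) by (simp add: abs_mult mult.commute)
  then have t4: "t < 4 * \<bar>d\<bar>" using t by (simp add: power_add)
  define z where "z = - ((2 ^ (k + 1) - d - x) div 2 ^ (k + 2))"
  have "t = (2 ^ (k + 1) - d - x) + 2 ^ (k + 2) * z"
    unfolding t_def z_def by (simp only: minus_mult_div_eq_mod[symmetric] mult_minus_right diff_conv_add_uminus)
  then have z: "x + t + d - 2 ^ (k + 1) = 2 ^ (k + 2) * z" by simp
  have 1: "x + t + d = 2 ^ (k + 1) * (1 + 2 * z)" using z by (simp add: algebra_simps)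
  have 2: "x + t = 2 ^ k * (2 + 4 * z - q)" using z q(1) by (simp add: algebra_simps)
  have odd: "multiplicity 2 (2 ^ m * r) = m" if "odd r" for m and r :: int
    using that by (intro multiplicity_eqI) auto
  have "multiplicity 2 (x + t + d) = k + 1" unfolding 1 by (rule odd) simp
  moreover have "multiplicity 2 (x + t) = k" unfolding 2 using q(2) by (intro odd) simp
  ultimately have "par (x + t) \<noteq> par (x + t + d)" by (simp add: par_def)
  then show ?thesis using t(1) t4 by blast
qed

text \<open>The sign distinguishes the two half-lines; it prevents a word from being read along two
  rungs in exchanged order.\<close>

definition lab :: "int \<Rightarrow> (bool \<times> bool) option" where "lab i = Some (0 \<le> i, par i)"

text \<open>The shift avoids the coincidence of \<open>fact 0\<close> and \<open>fact 1\<close>, so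
  consecutive values at least double. The growing ratios separate the scales when groups are
  compared.\<close>

definition ell_rung :: "nat \<Rightarrow> int" where "ell_rung n = int (fact (n + 1))"

text \<open>A partial automaton that is deterministic in both directions, hence a folded graph in
  the sense of Stallings: cancellation in a word does not destroy its reading.\<close>

fun stp :: "nat set \<Rightarrow> letter \<Rightarrow> int \<Rightarrow> int option" where
  "stp I (Letter (Some l) True) i = (if lab i = Some l then Some (i + 1) else None)"
| "stp I (Letter (Some l) False) i = (if lab (i - 1) = Some l then Some (i - 1) else None)"
| "stp I (Letter None True) i = (if \<exists>n\<in>I. i = - ell_rung n then Some (- i) else None)"
| "stp I (Letter None False) i = (if \<exists>n\<in>I. i = ell_rung n then Some (- i) else None)"

primrec run :: "nat set \<Rightarrow> letter list \<Rightarrow> int \<Rightarrow> int option" where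
  "run I [] i = Some i"
| "run I (a # w) i = (case stp I a i of None \<Rightarrow> None | Some j \<Rightarrow> run I w j)"

lemma run_Cons_Some: "run I (a # w) i = Some k \<longleftrightarrow> (\<exists>j. stp I a i = Some j \<and> run I w j = Some k)"
  by (simp split: option.splits)

lemma run_append_Some: "run I (u @ v) i = Some k \<longleftrightarrow> (\<exists>j. run I u i = Some j \<and> run I v j = Some k)"
  by (induction u arbitrary: i) (auto split: option.splits)

lemma stp_flip: "stp I a i = Some j \<Longrightarrow> stp I (flip a) j = Some i"
  by (induction I a i rule: stp.induct) (auto split: if_splits)

lemma run_rev_flip: "run I u i = Some j \<Longrightarrow> run I (rev (map flip u)) j = Some i"
proof (induction u arbitrary: i)
  case (Cons a u)
  then obtain k where k: "stp I a i = Some k" "run I u k = Some j" using run_Cons_Some by blast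
  have "run I [flip a] k = Some i" using stp_flip[OF k(1)] by simp
  moreover have "run I (rev (map flip u)) j = Some k" using Cons.IH[OF k(2)] .
  ultimately show ?case by (simp only: list.map rev.simps run_append_Some) blast
qed simp

lemma run_push: "stp I a i = Some j \<Longrightarrow> run I l j = Some k \<Longrightarrow> run I (push a l) i = Some k"
proof -
  assume a: "stp I a i = Some j" and l: "run I l j = Some k"
  show ?thesis
  proof (cases "l \<noteq> [] \<and> hd l = flip a")
    case True
    then obtain l' where l': "l = flip a # l'" by (cases l) auto
    then show ?thesis using l stp_flip[OF a] by simp
  next
    case False
    then have "push a l = a # l" by (cases l) auto
    then show ?thesis using a l by simp
  qed
qed

lemma run_foldr_push:
  "run I u i = Some j \<Longrightarrow> run I v j = Some k \<Longrightarrow> run I (foldr push u v) i = Some k"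
proof (induction u arbitrary: i)
  case (Cons a u)
  obtain i' where i': "stp I a i = Some i'" "run I u i' = Some j"
    using run_Cons_Some[of I a u i j] Cons.prems(1) by blast
  have "run I (foldr push u v) i' = Some k" by (rule Cons.IH[OF i'(2) Cons.prems(2)])
  then show ?case using run_push[OF i'(1)] by simp
qed simp

lemma run_plus: "run I (lst u) i = Some j \<Longrightarrow> run I (lst v) j = Some k \<Longrightarrow> run I (lst (u + v)) i = Some k"
  by (simp add: lst_plus run_foldr_push)

lemma run_uminus: "run I (lst u) i = Some j \<Longrightarrow> run I (lst (- u)) j = Some i"
  by (simp add: lst_uminus run_rev_flip)

lemma run_inj: "run I u i = Some k \<Longrightarrow> run I u j = Some k \<Longrightarrow> i = j"
  using run_rev_flip by (metis option.inject)

text \<open>The fundamental group of the labelled graph at the vertex 0, as a subgroup of the free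
  group on the labels.\<close>

definition loops :: "nat set \<Rightarrow> letter red set" where "loops I = {u. run I (lst u) 0 = Some 0}"

abbreviation is_rung :: "letter \<Rightarrow> bool" where "is_rung a \<equiv> (\<exists>b. a = Letter None b)"

text \<open>The line is folded, so a reduced word without rungs is read monotonically.\<close>
lemma line_run:
  assumes "reduced w" "\<not> (\<exists>a\<in>set w. is_rung a)" "run I w i = Some k" "w \<noteq> []"
  shows "\<exists>b. k = (if b then i + int (length w) else i - int (length w)) \<and>
    (\<forall>t<length w. w ! t = Letter (if b then lab (i + int t) else lab (i - 1 - int t)) b)"
  using assms
proof (induction w arbitrary: i)
  case (Cons a w)
  obtain l b where a: "a = Letter (Some l) b" using Cons.prems(2) by (cases a rule: letter.exhaust; cases "case a of Letter l _ \<Rightarrow> l") auto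
  obtain j where j: "stp I a i = Some j" "run I w j = Some k" using Cons.prems(3) run_Cons_Some by blast
  have j': "j = (if b then i + 1 else i - 1)" "Some l = (if b then lab i else lab (i - 1))"
    using j(1) a by (cases b; simp split: if_splits)+
  show ?case
  proof (cases "w = []")
    case True
    then show ?thesis using j j' a by (intro exI[of _ b]) auto
  next
    case False
    have r: "reduced w" "hd w \<noteq> flip a" using Cons.prems(1) False by (auto simp: successively_Cons)
    obtain b' where b': "k = (if b' then j + int (length w) else j - int (length w))"
      "\<forall>t<length w. w ! t = Letter (if b' then lab (j + int t) else lab (j - 1 - int t)) b'"
      using Cons.IH[OF r(1) _ j(2) False] Cons.prems(2) by auto
    have hd: "hd w = Letter (if b' then lab j else lab (j - 1)) b'"
      using b'(2) False by (auto simp: hd_conv_nth)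
    have "b' = b"
    proof (rule ccontr)
      assume "b' \<noteq> b"
      then have "hd w = flip a" using hd j' a by (cases b) auto
      then show False using r by blast
    qed
    then show ?thesis
      using b' j' a by (intro exI[of _ b]) (auto simp: nth_Cons' algebra_simps)
  qed
qed simp

lemma line_two:
  assumes "reduced w" "\<not> (\<exists>a\<in>set w. is_rung a)" "run I w i = Some k" "run I w j = Some m" "w \<noteq> []"
  obtains b where "k = (if b then i + int (length w) else i - int (length w))"
    "m = (if b then j + int (length w) else j - int (length w))"
    "\<And>t. t < length w \<Longrightarrow> (if b then lab (i + int t) = lab (j + int t) else lab (i - 1 - int t) = lab (j - 1 - int t))"
proof -
  obtain b where b: "k = (if b then i + int (length w) else i - int (length w))"
    "\<forall>t<length w. w ! t = Letter (if b then lab (i + int t) else lab (i - 1 - int t)) b"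
    using line_run[OF assms(1-3,5)] by blast
  obtain b' where b': "m = (if b' then j + int (length w) else j - int (length w))"
    "\<forall>t<length w. w ! t = Letter (if b' then lab (j + int t) else lab (j - 1 - int t)) b'"
    using line_run[OF assms(1,2,4,5)] by blast
  have eq: "Letter (if b then lab (i + int t) else lab (i - 1 - int t)) b
      = Letter (if b' then lab (j + int t) else lab (j - 1 - int t)) b'" if "t < length w" for t
    using b(2) b'(2) that by metis
  have bb: "b' = b" using eq[of 0] assms(5) by simp
  show ?thesis
  proof (rule that[of b])
    show "k = (if b then i + int (length w) else i - int (length w))" by (rule b(1))
    show "m = (if b then j + int (length w) else j - int (length w))" using b'(1) bb by simp
    show "if b then lab (i + int t) = lab (j + int t) else lab (i - 1 - int t) = lab (j - 1 - int t)"
      if "t < length w" for t using eq[OF that] bb by (auto split: if_splits)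
  qed
qed

text \<open>Both readings run monotonically in the same direction, since the letters record it. A
  long one would show equal labels at the constant shift \<open>j - i\<close>, against
  \<open>par_mismatch\<close>.\<close>

lemma line_two_length:
  assumes "reduced w" "\<not> (\<exists>a\<in>set w. is_rung a)" "run I w i = Some k" "run I w j = Some m" "i \<noteq> j"
  shows "int (length w) < 4 * \<bar>j - i\<bar>" "m - k = j - i"
proof -
  have "int (length w) < 4 * \<bar>j - i\<bar> \<and> m - k = j - i"
  proof (cases "w = []")
    case True
    then show ?thesis using assms by simp
  next
    case False
    obtain b where b: "k = (if b then i + int (length w) else i - int (length w))"
      "m = (if b then j + int (length w) else j - int (length w))"
      "\<And>t. t < length w \<Longrightarrow> (if b then lab (i + int t) = lab (j + int t) else lab (i - 1 - int t) = lab (j - 1 - int t))"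
      using line_two[OF assms(1-4) False] by blast
    have "int (length w) < 4 * \<bar>j - i\<bar>"
    proof (rule ccontr)
      assume *: "\<not> ?thesis"
      \<comment> \<open>The left end of the first reading, so that one window serves both
        directions.\<close>
      define x where "x = (if b then i else i - int (length w))"
      obtain t where t: "0 \<le> t" "t < 4 * \<bar>j - i\<bar>" "par (x + t) \<noteq> par (x + t + (j - i))"
        using par_mismatch[of "j - i" x] assms(5) by auto
      show False
      proof (cases b)
        case True
        have "lab (i + int (nat t)) = lab (j + int (nat t))" using b(3)[of "nat t"] True t * by auto
        then show False using t True by (simp add: x_def lab_def algebra_simps)
      next
        case False
        let ?s = "length w - 1 - nat t"
        have s: "int ?s = int (length w) - 1 - t" using t * by auto
        have "lab (i - 1 - int ?s) = lab (j - 1 - int ?s)" using b(3)[of ?s] False \<open>w \<noteq> []\<close> by auto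
        moreover have "i - 1 - int ?s = x + t" "j - 1 - int ?s = x + t + (j - i)"
          using s False by (simp_all add: x_def)
        ultimately have "lab (x + t) = lab (x + t + (j - i))" by (simp only:)
        then show False using t by (simp add: lab_def)
      qed
    qed
    then show ?thesis using b(1,2) by auto
  qed
  then show "int (length w) < 4 * \<bar>j - i\<bar>" "m - k = j - i" by auto
qed

lemma ell_rung_pos: "ell_rung n > 0"
  unfolding ell_rung_def by (simp only: of_nat_0_less_iff fact_gt_zero)

lemma ell_rung_Suc: "ell_rung (Suc n) \<ge> 2 * ell_rung n"
proof -
  have "ell_rung (Suc n) = int (n + 2) * ell_rung n" by (simp add: ell_rung_def algebra_simps)
  moreover have "2 * ell_rung n \<le> int (n + 2) * ell_rung n"
    using ell_rung_pos[of n] by (intro mult_right_mono) auto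
  ultimately show ?thesis by simp
qed

lemma ell_rung_double: "m < n \<Longrightarrow> 2 * ell_rung m \<le> ell_rung n"
proof (induction n)
  case (Suc n)
  then show ?case using ell_rung_Suc[of n] ell_rung_pos[of n] by (cases "m = n") auto
qed simp

lemma ell_rung_mono: "m \<le> n \<Longrightarrow> ell_rung m \<le> ell_rung n"
  using ell_rung_double[of m n] ell_rung_pos[of m] by (cases "m = n") auto

lemma ell_rung_inj: "ell_rung m = ell_rung n \<Longrightarrow> m = n"
  using ell_rung_double[of m n] ell_rung_double[of n m] ell_rung_pos[of m] ell_rung_pos[of n]
  by (cases m n rule: linorder_cases) auto

text \<open>By doubling, the size of a difference determines its larger index, and then the smaller
  one.\<close>

lemma ell_rung_diff:
  assumes "ell_rung n - ell_rung m = ell_rung n' - ell_rung m'" "m < n"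
  shows "n = n' \<and> m = m'"
proof -
  have "ell_rung m' < ell_rung n'" using assms ell_rung_double[of m n] ell_rung_pos[of m] by simp
  then have mn': "m' < n'" using ell_rung_mono[of n' m'] by (meson leD leI)
  have "n = n'"
  proof (cases n n' rule: linorder_cases)
    case less
    have "ell_rung n \<le> ell_rung n' - ell_rung m'"
      using ell_rung_double[OF less] ell_rung_double[OF mn'] by simp
    then show ?thesis using assms ell_rung_pos[of m] by simp
  next
    case greater
    have "ell_rung n' \<le> ell_rung n - ell_rung m"
      using ell_rung_double[OF greater] ell_rung_double[OF assms(2)] by simp
    then show ?thesis using assms ell_rung_pos[of m'] by simp
  qed
  then show ?thesis using assms ell_rung_inj by auto
qed

lemma ell_rung_diff':
  assumes "ell_rung n - ell_rung m = ell_rung n' - ell_rung m'" "m \<noteq> n"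
  shows "n = n' \<and> m = m'"
proof (cases "m < n")
  case True
  then show ?thesis using ell_rung_diff assms by blast
next
  case False
  then show ?thesis using ell_rung_diff[of m n m' n'] assms by auto
qed

lemma stp_rung:
  assumes "stp I (Letter None b) i = Some j"
  obtains n where "i = (if b then - ell_rung n else ell_rung n)" "j = - i" "n \<in> I"
  using assms by (cases b) (auto split: if_splits)

text \<open>The shift between the two readings is constant along w, so the rungs used have equal
  differences. Either one rung is used back and forth, against reducedness, or the two readings use
  the same two rungs in opposite order; then they pass 0 at different times and the signs in the
  labels disagree.\<close>

lemma no_two_rungs:
  assumes red: "reduced (Letter None b # w @ [Letter None b'])" and nr: "\<not> (\<exists>a\<in>set w. is_rung a)"
    and runs: "run I (Letter None b # w @ [Letter None b']) i = Some k"
      "run I (Letter None b # w @ [Letter None b']) j = Some m" and ij: "i \<noteq> j"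
  shows False
proof -
  have rw: "reduced w" using red by (auto simp: successively_Cons successively_append_iff)
  obtain i1 i2 where i: "stp I (Letter None b) i = Some i1" "run I w i1 = Some i2" "stp I (Letter None b') i2 = Some k"
    using runs(1) by (auto simp: run_append_Some run_Cons_Some simp del: run.simps(2) stp.simps)
  obtain j1 j2 where j: "stp I (Letter None b) j = Some j1" "run I w j1 = Some j2" "stp I (Letter None b') j2 = Some m"
    using runs(2) by (auto simp: run_append_Some run_Cons_Some simp del: run.simps(2) stp.simps)
  obtain n where n: "i = (if b then - ell_rung n else ell_rung n)" "i1 = - i" using stp_rung[OF i(1)] by metis
  obtain n' where n': "i2 = (if b' then - ell_rung n' else ell_rung n')" using stp_rung[OF i(3)] by metis
  obtain l where l: "j = (if b then - ell_rung l else ell_rung l)" "j1 = - j" using stp_rung[OF j(1)] by metis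
  obtain l' where l': "j2 = (if b' then - ell_rung l' else ell_rung l')" using stp_rung[OF j(3)] by metis
  have nl: "n \<noteq> l" using n l ij by auto
  have ij1: "i1 \<noteq> j1" using n l ij by simp
  have diff: "j2 - i2 = j1 - i1" using line_two_length(2)[OF rw nr i(2) j(2) ij1] .
  note pos = ell_rung_pos[of n] ell_rung_pos[of l]
  show False
  proof (cases "b' = b")
    case False
    then have "ell_rung l - ell_rung n = ell_rung l' - ell_rung n'"
      using diff n l n' l' by (cases b) auto
    then have "n' = n" using ell_rung_diff' nl by blast
    then have i12: "i2 = i1" using n n' False by (cases b) auto
    have "w = []"
    proof (rule ccontr)
      assume "w \<noteq> []"
      then show False using line_run[OF rw nr i(2)] i12 by (auto split: if_splits)
    qed
    then show False using red False by (cases b; cases b') auto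
  next
    case True
    then have "ell_rung l - ell_rung n = ell_rung n' - ell_rung l'"
      using diff n l n' l' by (cases b) auto
    then have nn: "n' = l" "l' = n" using ell_rung_diff' nl by blast+
    have i12: "i1 = (if b then ell_rung n else - ell_rung n)" "i2 = (if b then - ell_rung l else ell_rung l)"
      "j1 = (if b then ell_rung l else - ell_rung l)"
      using n n' l nn True by auto
    then have "w \<noteq> []" using i(2) pos by (auto split: if_splits)
    obtain c where c: "i2 = (if c then i1 + int (length w) else i1 - int (length w))"
      "\<And>t. t < length w \<Longrightarrow> (if c then lab (i1 + int t) = lab (j1 + int t) else lab (i1 - 1 - int t) = lab (j1 - 1 - int t))"
      using line_two[OF rw nr i(2) j(2) \<open>w \<noteq> []\<close>] by blast
    have cb: "c = (\<not> b)" and len: "int (length w) = ell_rung n + ell_rung l"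
      using c(1) i12 pos by (auto split: if_splits)
    \<comment> \<open>The step at which the reading that starts nearer to 0 passes it, while the
      other has not yet done so.\<close>
    define t where "t = nat (min (ell_rung n) (ell_rung l))"
    have t: "int t = min (ell_rung n) (ell_rung l)" "t < length w"
      using pos len unfolding t_def by auto
    have "ell_rung n \<noteq> ell_rung l" using ell_rung_inj nl by blast
    then show False using c(2)[OF t(2)] t(1) i12 cb pos by (cases b; cases "ell_rung n < ell_rung l") (auto simp: lab_def)
  qed
qed

lemma one_rung:
  assumes "reduced w" "run I w i = Some k" "run I w j = Some m" "i \<noteq> j"
    and w: "w = u @ r # v @ r' # x" "is_rung r" "is_rung r'" "\<not> (\<exists>a\<in>set v. is_rung a)"
  shows False
proof -
  have w': "w = u @ (r # v @ [r']) @ x" using w by simp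
  obtain b b' where b: "r = Letter None b" "r' = Letter None b'" using w by blast
  have "reduced (r # v @ [r'])" using assms(1) reduced_appendD(1)[OF reduced_appendD(2)] unfolding w' by blast
  moreover obtain i1 j1 where i1: "run I u i = Some i1" "run I u j = Some j1"
    using assms(2,3) unfolding w' run_append_Some by blast
  moreover obtain k1 where "run I (r # v @ [r']) i1 = Some k1"
    using assms(2) i1(1) unfolding w' run_append_Some by auto
  moreover obtain m1 where "run I (r # v @ [r']) j1 = Some m1"
    using assms(3) i1(2) unfolding w' run_append_Some by auto
  moreover have "i1 \<noteq> j1" using run_inj i1 assms(4) by blast
  ultimately show False using no_two_rungs[of b v b' I i1 k1 j1 m1] w(4) unfolding b by blast
qed

lemma split_rung:
  assumes "\<exists>a\<in>set w. is_rung a"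
  obtains u r v where "w = u @ r # v" "is_rung r" "\<not> (\<exists>a\<in>set u. is_rung a)"
proof -
  define Q where "Q a \<longleftrightarrow> is_rung a" for a
  have "\<exists>a\<in>set w. Q a" using assms by (simp add: Q_def)
  then obtain u r v where "w = u @ r # v" "Q r" "\<forall>a\<in>set u. \<not> Q a"
    using split_list_first_prop by metis
  then show ?thesis using that[of u r v] unfolding Q_def by blast
qed

text \<open>At most one rung is read, and the parts before and after it are bounded by
  \<open>line_two_length\<close>. A rung reflects the line, so it preserves the distance between the
  two readings.\<close>

lemma two_read_bound:
  assumes red: "reduced w" and i: "run I w i = Some k" and j: "run I w j = Some m" and ij: "i \<noteq> j"
  shows "int (length w) \<le> 8 * \<bar>j - i\<bar> + 1"
proof (cases "\<exists>a\<in>set w. is_rung a")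
  case False
  then show ?thesis using line_two_length(1)[OF red False i j ij] by simp
next
  case True
  then obtain u r v where w: "w = u @ r # v" "is_rung r" "\<not> (\<exists>a\<in>set u. is_rung a)" by (rule split_rung)
  have nv: "\<not> (\<exists>a\<in>set v. is_rung a)"
  proof
    assume "\<exists>a\<in>set v. is_rung a"
    then obtain v1 r' v2 where "v = v1 @ r' # v2" "is_rung r'" "\<not> (\<exists>a\<in>set v1. is_rung a)" by (rule split_rung)
    then show False using one_rung[OF red i j ij, of u r v1 r' v2] w by simp
  qed
  have ru: "reduced u" "reduced v" using red unfolding w(1) by (auto simp: successively_append_iff successively_Cons)
  obtain b where r: "r = Letter None b" using w by blast
  obtain i1 i2 where i': "run I u i = Some i1" "stp I r i1 = Some i2" "run I v i2 = Some k"
    using i unfolding w(1) run_append_Some run_Cons_Some by blast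
  obtain j1 j2 where j': "run I u j = Some j1" "stp I r j1 = Some j2" "run I v j2 = Some m"
    using j unfolding w(1) run_append_Some run_Cons_Some by blast
  have u: "int (length u) < 4 * \<bar>j - i\<bar>" "j1 - i1 = j - i"
    using line_two_length[OF ru(1) w(3) i'(1) j'(1) ij] by auto
  have n: "i2 = - i1" "j2 = - j1"
    using stp_rung[of I b i1 i2] stp_rung[of I b j1 j2] i'(2) j'(2) r by metis+
  have "i2 \<noteq> j2" using n u ij by simp
  then have "int (length v) < 4 * \<bar>j2 - i2\<bar>" using line_two_length(1)[OF ru(2) nv i'(3) j'(3)] by simp
  moreover have "\<bar>j2 - i2\<bar> = \<bar>j - i\<bar>" using n u by simp
  ultimately show ?thesis using u unfolding w(1) by simp
qed

lemma lst_nmul: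
  assumes "f \<noteq> 0" "last (lst f) \<noteq> flip (hd (lst f))"
  shows "lst (nmul n f) = concat (replicate n (lst f))"
proof (induction n)
  case (Suc n)
  have fl: "lst f \<noteq> []" using assms by simp
  have rot: "concat (replicate n (lst f)) @ lst f = concat (replicate (Suc n) (lst f))" for n
    by (induction n) simp_all
  have "reduced (concat (replicate n (lst f)) @ lst f)"
  proof (cases n)
    case (Suc n')
    have "concat (replicate n (lst f)) = concat (replicate n' (lst f)) @ lst f" using rot Suc by simp
    then have "last (concat (replicate n (lst f))) = last (lst f)" using fl by (metis last_appendR)
    moreover have "reduced (concat (replicate n (lst f)))" using reduced_lst[of "nmul n f"] Suc.IH by metis
    moreover have "hd (lst f) \<noteq> flip (last (lst f))" using assms(2) by (metis flip_flip)
    ultimately show ?thesis unfolding successively_append_iff by simp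
  qed simp
  then have "lst (nmul n f + f) = concat (replicate n (lst f)) @ lst f"
    using lst_append[of "nmul n f" f] Suc.IH by simp
  then show ?case using rot by simp
qed simp

text \<open>If f moved the vertex i, its fifth power would be readable from two vertices. It would
  then contain at most one rung, hence none by periodicity, and its length, five times that of f,
  would be less than four times the displacement, which is the length of f. This accounts for the
  exponents five and six.\<close>

lemma periodic_read:
  assumes f: "f \<noteq> 0" "last (lst f) \<noteq> flip (hd (lst f))" and r: "run I (lst (nmul 6 f)) i = Some k"
  shows "run I (lst f) i = Some i"
proof -
  define w where "w = lst (nmul 5 f)"
  define l where "l = lst f"
  have w: "w = concat (replicate 5 l)" unfolding w_def l_def by (rule lst_nmul[OF f])
  have e: "lst (nmul 6 f) = l @ w" "lst (nmul 6 f) = w @ l"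
    unfolding w lst_nmul[OF f] l_def by (simp_all add: numeral_eq_Suc)
  have w2: "w = l @ l @ l @ l @ l" unfolding w by (simp add: numeral_eq_Suc)
  obtain j where j: "run I l i = Some j" "run I w j = Some k" using r unfolding e(1) run_append_Some by blast
  obtain k' where k': "run I w i = Some k'" using r unfolding e(2) run_append_Some by blast
  have "j = i"
  proof (rule ccontr)
    assume ji: "j \<noteq> i"
    have redw: "reduced w" unfolding w_def by simp
    have lne: "l \<noteq> []" using f by (simp add: l_def)
    show False
    proof (cases "\<exists>a\<in>set l. is_rung a")
      case True
      then obtain u r v where l: "l = u @ r # v" "is_rung r" "\<not> (\<exists>a\<in>set u. is_rung a)" by (rule split_rung)
      show False
      proof (cases "\<exists>a\<in>set v. is_rung a")
        case True
        then obtain v1 r' v2 where "v = v1 @ r' # v2" "is_rung r'" "\<not> (\<exists>a\<in>set v1. is_rung a)" by (rule split_rung)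
        then show False using one_rung[OF redw j(2) k' ji, of u r v1 r' "v2 @ l @ l @ l @ l"] l w2 by simp
      next
        case False
        have "\<not> (\<exists>a\<in>set (v @ u). is_rung a)" using False l(3) by auto
        moreover have "w = u @ r # (v @ u) @ r # (v @ l @ l @ l)" using w2 l(1) by simp
        ultimately show False using one_rung[OF redw j(2) k' ji] l(2) by blast
      qed
    next
      case False
      have "set w = set l" unfolding w2 by auto
      then have "int (length w) < 4 * \<bar>i - j\<bar>"
        using line_two_length(1)[OF redw _ j(2) k' ji] False by simp
      moreover have "\<bar>i - j\<bar> = int (length l)"
        using line_run[OF _ False j(1) lne] by (auto simp: l_def split: if_splits)
      ultimately show False unfolding w2 by simp
    qed
  qed
  then show ?thesis using j(1) by (simp add: l_def)
qed

section \<open>Cosets of the loop group in the tree\<close>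

lemma finite_ball_red: "finite {u :: 'a::{invol,finite} red. len u \<le> n}"
proof -
  have "finite {l :: 'a list. set l \<subseteq> UNIV \<and> length l \<le> n}" by (rule finite_lists_length_le) simp
  moreover have "lst ` {u :: 'a red. len u \<le> n} \<subseteq> {l. set l \<subseteq> UNIV \<and> length l \<le> n}" by auto
  ultimately have "finite (lst ` {u :: 'a red. len u \<le> n})" using finite_subset by blast
  then show ?thesis by (rule finite_imageD) (auto simp: inj_on_def lst_eq_iff)
qed

interpretation loops: double_group "loops I" for I
proof
  show "0 \<in> loops I" by (simp add: loops_def)
  show "u + v \<in> loops I" if "u \<in> loops I" "v \<in> loops I" for u v
    using that run_plus unfolding loops_def by blast
  show "- u \<in> loops I" if "u \<in> loops I" for u
    using that run_uminus unfolding loops_def by blast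
qed

lemma lst_diff_cyl:
  assumes "p \<notin> cyl [a]" "r \<in> cyl [a]"
  shows "lst (- p + r) = lst (- p) @ lst r"
proof -
  obtain k u w where d: "lst p = k @ u" "lst r = k @ w" "lst (- p + r) = rev (map flip u) @ w"
    by (rule lst_diff[of p r])
  have "k = []"
  proof (cases k)
    case (Cons b k')
    then show ?thesis using assms d by (simp add: mem_cyl)
  qed simp
  then show ?thesis using d by (simp add: lst_uminus)
qed

lemma read_powers:
  assumes "run I (lst f) i = Some i"
  shows "run I (lst (nmul n f)) i = Some i"
  using assms by (induction n) (auto intro: run_plus)

text \<open>The geodesic between the two given points of c passes the identity and then reads six
  periods of f. It can be read in the graph because its ends lie in one coset; i is the vertex
  reached at the identity, and \<open>periodic_read\<close> makes f a loop there.\<close>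

lemma loops_periodic_coset:
  assumes f: "f \<noteq> 0" "last (lst f) \<noteq> flip (hd (lst f))"
    and c: "c \<in> range (loops.coset I)" "\<not> c \<subseteq> cyl [hd (lst f)]" "c \<inter> (+) (nmul 6 f) ` cyl [hd (lst f)] \<noteq> {}"
  obtains p i where "c = loops.coset I p" "run I (lst (- p)) 0 = Some i" "run I (lst f) i = Some i"
proof -
  define a where "a = hd (lst f)"
  obtain p where p: "p \<in> c" "p \<notin> cyl [a]" using c(2) by (auto simp: a_def)
  obtain x where x: "x \<in> cyl [a]" "nmul 6 f + x \<in> c" using c(3) by (auto simp: a_def)
  obtain c0 where "c = loops.coset I c0" using c(1) by blast
  then have cp: "c = loops.coset I p" using loops.coset_eq p(1) by blast
  have loop: "run I (lst (- p + (nmul 6 f + x))) 0 = Some 0"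
    using x(2) unfolding cp loops.mem_coset by (simp add: loops_def)
  have fl: "lst f \<noteq> []" "lst x \<noteq> []" "hd (lst x) = a" using f x by (auto simp: mem_cyl1)
  have n6: "lst (nmul 6 f) = concat (replicate 5 (lst f)) @ lst f" "lst (nmul 6 f) = lst f @ concat (replicate 5 (lst f))"
    unfolding lst_nmul[OF f] by (simp_all add: numeral_eq_Suc)
  have "reduced (lst (nmul 6 f) @ lst x)"
  proof -
    have "last (lst (nmul 6 f)) = last (lst f)" unfolding n6(1) using fl by simp
    moreover have "a \<noteq> flip (last (lst f))" using f(2) unfolding a_def by (metis flip_flip)
    ultimately show ?thesis using fl by (simp add: successively_append_iff)
  qed
  then have lx: "lst (nmul 6 f + x) = lst (nmul 6 f) @ lst x" by (rule lst_append)
  then have "hd (lst (nmul 6 f + x)) = a" "lst (nmul 6 f + x) \<noteq> []"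
    unfolding n6(2) using fl by (simp_all add: a_def)
  then have "nmul 6 f + x \<in> cyl [a]" unfolding mem_cyl1 by (simp del: lst_eq_Nil add: lst_eq_Nil[symmetric])
  then have "lst (- p + (nmul 6 f + x)) = lst (- p) @ lst (nmul 6 f) @ lst x"
    using lst_diff_cyl[OF p(2)] lx by simp
  then obtain i k where i: "run I (lst (- p)) 0 = Some i" "run I (lst (nmul 6 f)) i = Some k"
    using loop by (auto simp: run_append_Some)
  then show ?thesis using that cp periodic_read[OF f] by blast
qed

text \<open>All powers of f are loops at both vertices i and \<open>i'\<close>, so
  \<open>two_read_bound\<close> forces them to be equal. Two cosets that show the same vertex at the
  identity coincide, and a loop at that vertex preserves the coset.\<close>

lemma loops_periodic:
  assumes f: "f \<noteq> 0" "last (lst f) \<noteq> flip (hd (lst f))"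
    and c: "c \<in> range (loops.coset I)" "\<not> c \<subseteq> cyl [hd (lst f)]" "c \<inter> (+) (nmul 6 f) ` cyl [hd (lst f)] \<noteq> {}"
    and c': "c' \<in> range (loops.coset I)" "\<not> c' \<subseteq> cyl [hd (lst f)]" "c' \<inter> (+) (nmul 6 f) ` cyl [hd (lst f)] \<noteq> {}"
  shows "c = c' \<and> (+) f ` c = c"
proof -
  obtain p i where p: "c = loops.coset I p" "run I (lst (- p)) 0 = Some i" "run I (lst f) i = Some i"
    using loops_periodic_coset[OF f c] .
  obtain p' i' where p': "c' = loops.coset I p'" "run I (lst (- p')) 0 = Some i'" "run I (lst f) i' = Some i'"
    using loops_periodic_coset[OF f c'] .
  have pi: "run I (lst p) i = Some 0" "run I (lst p') i' = Some 0"
    using run_uminus[OF p(2)] run_uminus[OF p'(2)] by simp_all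
  have "i = i'"
  proof (rule ccontr)
    assume ne: "i \<noteq> i'"
    define n where "n = nat (8 * \<bar>i' - i\<bar> + 2)"
    have "int (len (nmul n f)) \<le> 8 * \<bar>i' - i\<bar> + 1"
      using two_read_bound[OF reduced_lst read_powers[OF p(3)] read_powers[OF p'(3)] ne] .
    moreover have "len (nmul n f) \<ge> n * 1"
    proof -
      have "len (nmul n f) = n * len f" unfolding lst_nmul[OF f] by (induction n) auto
      moreover have "1 \<le> len f" using f by (cases "lst f") auto
      ultimately show ?thesis by simp
    qed
    ultimately show False unfolding n_def by simp
  qed
  have "- p + p' \<in> loops I" using run_plus[OF p(2)] pi(2) \<open>i = i'\<close> by (simp add: loops_def)
  then have "c = c'" unfolding p(1) p'(1) loops.coset_eq_iff .
  moreover have "run I (lst (- p + (f + p))) 0 = Some 0"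
    by (rule run_plus[OF p(2) run_plus[OF p(3) pi(1)]])
  then have "- p + (f + p) \<in> loops I" by (simp add: loops_def)
  then have "(+) f ` c = c" unfolding p(1) loops.coset_translate by (simp only: loops.coset_eq_iff[symmetric])
  ultimately show ?thesis by blast
qed

lemma loops_hull:
  assumes "q \<in> loops.coset I p0" "run I (lst (- q + v)) 0 = Some i"
  shows "run I (lst (- p0 + v)) 0 = Some i"
proof -
  have "run I (lst (- p0 + q)) 0 = Some 0" using assms(1) unfolding loops.mem_coset unfolding loops_def by simp
  from run_plus[OF this assms(2)] show ?thesis by (simp add: add.assoc)
qed

text \<open>The hulls of two distinct cosets have bounded intersection, since a long common segment
  would be read from two vertices of the graph. The geodesic from p to q branches off those to
  \<open>p0\<close> and to \<open>q0\<close>. If it leaves the one to \<open>q0\<close> no later,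
  that branching point lies in both hulls; otherwise the branching point from the one to
  \<open>p0\<close> lies on the geodesic from \<open>p0\<close> to \<open>q0\<close>.\<close>

lemma loops_finite_bridge:
  assumes "c \<in> range (loops.coset I)" "c' \<in> range (loops.coset I)" "c \<noteq> c'"
  shows "\<exists>P. finite P \<and> (\<forall>p\<in>c. \<forall>q\<in>c'. \<exists>v\<in>P. len (- p + q) = len (- p + v) + len (- v + q))"
proof -
  obtain p0 q0 where pq: "c = loops.coset I p0" "c' = loops.coset I q0" using assms by blast
  define hul where "hul p v \<longleftrightarrow> (\<exists>i. run I (lst (- p + v)) 0 = Some i)" for p v
  have bounded: "\<exists>K. \<forall>v. hul p0 v \<longrightarrow> hul q0 v \<longrightarrow> len (- p0 + v) \<le> K"
  proof (cases "\<exists>v0. hul p0 v0 \<and> hul q0 v0")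
    case True
    then obtain v0 where v0: "hul p0 v0" "hul q0 v0" by blast
    obtain i where i: "run I (lst (- p0 + v0)) 0 = Some i" using v0(1) unfolding hul_def ..
    obtain j where j: "run I (lst (- q0 + v0)) 0 = Some j" using v0(2) unfolding hul_def ..
    note ij = i j
    have "i \<noteq> j"
    proof
      assume "i = j"
      have "run I (lst (- (- q0 + v0))) j = Some 0" using run_uminus[OF ij(2)] .
      then have "run I (lst ((- p0 + v0) + - (- q0 + v0))) 0 = Some 0"
        using run_plus[OF ij(1)] \<open>i = j\<close> by blast
      moreover have "(- p0 + v0) + - (- q0 + v0) = - p0 + q0"
        by (simp add: minus_add add.assoc diff_conv_add_uminus del: add_uminus_conv_diff)
      ultimately have "- p0 + q0 \<in> loops I" by (simp add: loops_def)
      then show False using assms(3) pq loops.coset_eq_iff by blast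
    qed
    have "len (- p0 + v) \<le> len (- p0 + v0) + nat (8 * \<bar>j - i\<bar> + 1)" if v: "hul p0 v" "hul q0 v" for v
    proof -
      obtain k where k: "run I (lst (- p0 + v)) 0 = Some k" using v(1) unfolding hul_def ..
      obtain l where l: "run I (lst (- q0 + v)) 0 = Some l" using v(2) unfolding hul_def ..
      note kl = k l
      have e: "- (- r + v0) + (- r + v) = - v0 + v" for r by (rule diff_cancel_left)
      have "run I (lst (- v0 + v)) i = Some k" "run I (lst (- v0 + v)) j = Some l"
        using run_plus[OF run_uminus[OF ij(1)] kl(1)] run_plus[OF run_uminus[OF ij(2)] kl(2)] unfolding e by auto
      from two_read_bound[OF reduced_lst this \<open>i \<noteq> j\<close>]
      have "len (- v0 + v) \<le> nat (8 * \<bar>j - i\<bar> + 1)" by simp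
      moreover have "len (- p0 + v) \<le> len (- p0 + v0) + len (- v0 + v)" by (rule len_triangle)
      ultimately show ?thesis by simp
    qed
    then show ?thesis by blast
  qed blast
  then obtain K where K: "\<And>v. hul p0 v \<Longrightarrow> hul q0 v \<Longrightarrow> len (- p0 + v) \<le> K" by blast
  define M where "M = max K (len (- p0 + q0))"
  define P where "P = (+) p0 ` {u. len u \<le> M}"
  have finP: "finite P" unfolding P_def by (intro finite_imageI finite_ball_red)
  have memP: "v \<in> P" if "len (- p0 + v) \<le> M" for v
    using that unfolding P_def by (intro image_eqI[of _ _ "- p0 + v"]) (simp_all add: add.assoc[symmetric])
  have "\<exists>v\<in>P. len (- p + q) = len (- p + v) + len (- v + q)" if p: "p \<in> c" and q: "q \<in> c'" for p q
  proof -
    define W where "W = - p + q"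
    define A where "A = - p + p0"
    define B where "B = - p + q0"
    have loopA: "run I (lst A) 0 = Some 0"
    proof -
      have "- p0 + p \<in> loops I" using p pq by (simp add: loops.mem_coset)
      then have "- (- p0 + p) \<in> loops I" by (rule loops.A_uminus)
      moreover have "- (- p0 + p) = A" by (simp add: A_def minus_add)
      ultimately show ?thesis by (simp add: loops_def)
    qed
    have loopB: "run I (lst (- W + B)) 0 = Some 0"
    proof -
      have "- q0 + q \<in> loops I" using q pq by (simp add: loops.mem_coset)
      then have "- (- q0 + q) \<in> loops I" by (rule loops.A_uminus)
      moreover have "- (- q0 + q) = - W + B" unfolding W_def B_def diff_cancel_left by (simp add: minus_add)
      ultimately show ?thesis by (simp add: loops_def)
    qed
    obtain k1 w1 a1 where d1: "lst W = k1 @ w1" "lst A = k1 @ a1" "w1 = [] \<or> a1 = [] \<or> hd w1 \<noteq> hd a1"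
      by (rule lst_diff[of W A])
    obtain k2 w2 b2 where d2: "lst W = k2 @ w2" "lst B = k2 @ b2" "lst (- W + B) = rev (map flip w2) @ b2"
      by (rule lst_diff[of W B])
    have pre: "\<exists>v. lst (- p + v) = k \<and> len (- p + q) = len (- p + v) + len (- v + q) \<and> lst (- v + q) = w"
      if kw: "lst W = k @ w" for k w
    proof -
      obtain x y where xy: "lst x = k" "lst y = w" "W = x + y" using red_append[OF kw] .
      have "- (p + x) + q = y" using xy(3) unfolding W_def
        by (metis add.assoc add_minus_cancel minus_add_cancel)
      then show ?thesis using xy kw by (intro exI[of _ "p + x"]) (simp add: add.assoc[symmetric] W_def)
    qed
    show ?thesis
    proof (cases "length k2 \<le> length k1")
      case True
      obtain v where v: "lst (- p + v) = k2" "len (- p + q) = len (- p + v) + len (- v + q)" "lst (- v + q) = w2"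
        using pre[OF d2(1)] by blast
      have "prefix k2 k1" using d1(1) d2(1) True by (metis prefixI prefix_length_prefix)
      then obtain k' where "k1 = k2 @ k'" by (auto simp: prefix_def)
      then obtain i where "run I (lst (- p + v)) 0 = Some i" using loopA d1(2) v(1) by (auto simp: run_append_Some)
      from loops_hull[OF p[unfolded pq(1)] this] have h1: "hul p0 v" unfolding hul_def ..
      have "lst (- q + v) = rev (map flip w2)"
        using lst_uminus[of "- v + q"] v(3) by (simp add: minus_add)
      then obtain j where "run I (lst (- q + v)) 0 = Some j" using loopB d2(3) by (auto simp: run_append_Some)
      from loops_hull[OF q[unfolded pq(2)] this] have h2: "hul q0 v" unfolding hul_def ..
      have "v \<in> P" using memP K[OF h1 h2] by (simp add: M_def)
      then show ?thesis using v by blast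
    next
      case False
      obtain v where v: "lst (- p + v) = k1" "len (- p + q) = len (- p + v) + len (- v + q)"
        using pre[OF d1(1)] by blast
      have "prefix k1 k2" using d1(1) d2(1) False by (metis nat_le_linear prefixI prefix_length_prefix)
      then obtain k' where k': "k2 = k1 @ k'" by (auto simp: prefix_def)
      have "k' \<noteq> []" using False k' by auto
      have w1: "w1 = k' @ w2" using d1(1) d2(1) k' by simp
      \<comment> \<open>After \<open>k1\<close> the geodesics from p to \<open>p0\<close> and to
        \<open>q0\<close> diverge, so the way back along \<open>a1\<close> is an initial part of the
        geodesic from \<open>p0\<close> to \<open>q0\<close>.\<close>
      have "a1 = [] \<or> hd a1 \<noteq> hd (k' @ b2)" using d1(3) w1 \<open>k' \<noteq> []\<close> by auto
      then have dd: "len (- A + B) = length a1 + length (k' @ b2)"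
      proof -
        obtain k u x where d: "lst A = k @ u" "lst B = k @ x" "u = [] \<or> x = [] \<or> hd u \<noteq> hd x"
          "lst (- A + B) = rev (map flip u) @ x" by (rule lst_diff[of A B])
        have AB: "k1 @ a1 = k @ u" "k1 @ (k' @ b2) = k @ x" using d d1(2) d2(2) k' by simp_all
        have "k = k1"
        proof (rule ccontr)
          assume kk: "k \<noteq> k1"
          from AB(1) consider z where "k = k1 @ z" "a1 = z @ u" | z where "k1 = k @ z" "u = z @ a1"
            by (auto simp: append_eq_append_conv2)
          then show False
          proof cases
            case 1
            then have "z \<noteq> []" using kk by simp
            moreover have "k' @ b2 = z @ x" using AB(2) 1 by simp
            ultimately show False using 1 \<open>a1 = [] \<or> hd a1 \<noteq> hd (k' @ b2)\<close> by simp
          next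
            case 2
            then have "z \<noteq> []" using kk by simp
            moreover have "x = z @ k' @ b2" using AB(2) 2 by simp
            ultimately show False using 2 d(3) by simp
          qed
        qed
        then show ?thesis using AB d(4) by simp
      qed
      have "len (- A + B) = len (- p0 + q0)" unfolding A_def B_def diff_cancel_left ..
      moreover have "len (- p0 + v) = length a1"
      proof -
        obtain x y where xy: "lst x = k1" "lst y = a1" "A = x + y" using red_append[OF d1(2)] .
        have "- p + v = x" using v(1) xy(1) lst_eq_iff by metis
        have "- p0 + v = - A + (- p + v)" unfolding A_def diff_cancel_left ..
        also have "\<dots> = - y" unfolding \<open>- p + v = x\<close> xy(3)
          by (simp add: minus_add add.assoc diff_conv_add_uminus del: add_uminus_conv_diff)
        finally show ?thesis using xy(2) by simp
      qed
      ultimately have "len (- p0 + v) \<le> M" using dd by (simp add: M_def)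
      then show ?thesis using memP v by blast
    qed
  qed
  then show ?thesis using finP by blast
qed

interpretation loops: contracting_double "loops I" for I
proof
  show "flip a \<noteq> a" for a :: letter by (rule flip_letter_neq)
  show "\<exists>n. \<forall>c\<in>range (loops.coset I). \<forall>c'\<in>range (loops.coset I).
      \<not> c \<subseteq> cyl [hd (lst f)] \<longrightarrow> c \<inter> (+) (nmul n f) ` cyl [hd (lst f)] \<noteq> {} \<longrightarrow>
      \<not> c' \<subseteq> cyl [hd (lst f)] \<longrightarrow> c' \<inter> (+) (nmul n f) ` cyl [hd (lst f)] \<noteq> {} \<longrightarrow>
      c = c' \<and> (+) f ` c = c" if f: "f \<noteq> 0" "last (lst f) \<noteq> flip (hd (lst f))" for f
    by (intro exI[of _ 6] ballI impI loops_periodic[OF f])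
  show "\<exists>P. finite P \<and> (\<forall>p\<in>c. \<forall>q\<in>c'. \<exists>v\<in>P. len (- p + q) = len (- p + v) + len (- v + q))"
    if "c \<in> range (loops.coset I)" "c' \<in> range (loops.coset I)" "c \<noteq> c'" for c c'
    by (rule loops_finite_bridge[OF that])
qed

section \<open>Words in the double\<close>

text \<open>Evaluation of words in two copies of the free group: a pair (ps, f) records the points, last
  one first, at which the copy was changed without the change being cancelled later, and the current point.\<close>
definition toggle :: "'a::invol red set \<Rightarrow> 'a red list \<times> 'a red \<Rightarrow> 'a red list \<times> 'a red" where
  "toggle A = (\<lambda>(ps, f). (case ps of [] \<Rightarrow> [f] | p # qs \<Rightarrow> if - p + f \<in> A then qs else f # ps, f))"

definition advance :: "'a::invol \<Rightarrow> 'a red list \<times> 'a red \<Rightarrow> 'a red list \<times> 'a red" where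
  "advance a = (\<lambda>(ps, f). (ps, f + gen a))"

definition process :: "'a::invol red set \<Rightarrow> bool \<times> 'a \<Rightarrow> 'a red list \<times> 'a red \<Rightarrow> 'a red list \<times> 'a red" where
  "process A s x = (if fst s then toggle A (advance (snd s) (toggle A x)) else advance (snd s) x)"

lemma toggle_simps [simp]:
  "toggle A ([], f) = ([f], f)"
  "toggle A (p # qs, f) = (if - p + f \<in> A then (qs, f) else (f # p # qs, f))"
  by (simp_all add: toggle_def)

lemma advance_simp [simp]: "advance a (ps, f) = (ps, f + gen a)"
  by (simp add: advance_def)

definition near :: "nat \<Rightarrow> 'a::invol red list \<times> 'a red \<Rightarrow> bool" where
  "near k x \<longleftrightarrow> (\<forall>p\<in>set (fst x). len (- p + snd x) \<le> k)"

lemma near_mono: "near k x \<Longrightarrow> k \<le> l \<Longrightarrow> near l x"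
  by (force simp: near_def)

lemma near_toggle: "near k x \<Longrightarrow> near k (toggle A x)"
  by (cases x; cases "fst x") (auto simp: near_def)

lemma near_advance:
  assumes "near k x"
  shows "near (Suc k) (advance a x)"
  unfolding near_def
proof
  fix p assume p: "p \<in> set (fst (advance a x))"
  obtain ps f where x: "x = (ps, f)" by (cases x)
  have "len (- p + f) \<le> k" using assms p x by (simp add: near_def)
  moreover have "len (- p + (f + gen a)) \<le> Suc (len (- p + f))"
    using len_plus[of "- p + f" "gen a"] by (simp add: add.assoc)
  ultimately show "len (- p + snd (advance a x)) \<le> Suc k" using x by simp
qed

lemma toggle_agree:
  assumes "\<And>u. len u \<le> N \<Longrightarrow> u \<in> A \<longleftrightarrow> u \<in> B" "near N x"
  shows "toggle A x = toggle B x"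
proof -
  obtain ps f where x: "x = (ps, f)" by (cases x)
  show ?thesis
  proof (cases ps)
    case (Cons p qs)
    then show ?thesis using assms(1)[of "- p + f"] assms(2) x by (simp add: near_def)
  qed (simp add: x)
qed

text \<open>A membership test concerns the way from a recorded point to the current one, and no more
  letters have been read since the recording than the word has. So evaluating a word of length at
  most N only consults the subgroup within the ball of radius N.\<close>

lemma process_agree:
  assumes AB: "\<And>u. len u \<le> N \<Longrightarrow> u \<in> A \<longleftrightarrow> u \<in> B" and "length w \<le> N"
  shows "fold (process A) w ([], 0) = fold (process B) w ([], 0) \<and> near (length w) (fold (process A) w ([], 0))"
  using assms(2)
proof (induction w rule: rev_induct)
  case (snoc s w)
  define x where "x = fold (process A) w ([], 0)"
  have x: "fold (process B) w ([], 0) = x" "near (length w) x" using snoc x_def by auto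
  note n1 = near_toggle[OF x(2), of A]
  note n2 = near_advance[OF n1, of "snd s"]
  have N: "length w \<le> N" "Suc (length w) \<le> N" using snoc.prems by auto
  have "toggle A x = toggle B x" by (rule toggle_agree[OF AB near_mono[OF x(2) N(1)]])
  moreover have "toggle A (advance (snd s) (toggle A x)) = toggle B (advance (snd s) (toggle A x))"
    by (rule toggle_agree[OF AB near_mono[OF n2 N(2)]])
  ultimately have "process A s x = process B s x \<and> near (Suc (length w)) (process A s x)"
    using near_toggle[OF n2, of A] near_advance[OF x(2)] by (simp add: process_def)
  then show ?case using x(1) x_def by auto
qed (simp add: near_def)

context double_group begin

definition symbol :: "bool \<times> 'a \<Rightarrow> 'a red lamp" where
  "symbol s = (if fst s then t + lt (gen (snd s)) + t else lt (gen (snd s)))"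

lemma SG_symbol: "SG = range symbol"
  by (auto simp: SG_def symbol_def image_iff)

definition state :: "'a red list \<times> 'a red \<Rightarrow> 'a red lamp" where
  "state x = Lamp (of_lst (rev (map coset (fst x)))) (snd x)"

definition proper :: "'a red list \<times> 'a red \<Rightarrow> bool" where
  "proper x \<longleftrightarrow> successively (\<lambda>c c'. c' \<noteq> c) (map coset (fst x))"

lemma proper_rev: "proper x \<Longrightarrow> reduced (rev (map coset (fst x)))"
  by (auto simp: proper_def successively_rev simp del: map_map rev_map elim: successively_mono)

lemma of_lst_snoc: "reduced (l @ [c]) \<Longrightarrow> of_lst (l @ [c]) = of_lst l + gen c" for c :: "'a red set"
proof -
  assume r: "reduced (l @ [c])"
  then have "reduced l" by (simp add: successively_append_iff)
  then have "lst (of_lst l + gen c) = l @ [c]" using lst_append[of "of_lst l" "gen c"] r by simp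
  then show ?thesis by (metis of_lst_lst)
qed

text \<open>Right multiplication by t stacks or cancels the coset of the current point; the record
  keeps representatives, and the test in \<open>toggle\<close> decides whether two of them name the
  same coset.\<close>

lemma toggle_state:
  assumes "proper x"
  shows "proper (toggle A x) \<and> state (toggle A x) = state x + t"
proof -
  obtain ps f where x: "x = (ps, f)" by (cases x)
  have push: "proper (f # ps, f) \<Longrightarrow> state (f # ps, f) = state (ps, f) + t"
    using of_lst_snoc[of "rev (map coset ps)" "coset f"] proper_rev[of "(f # ps, f)"]
    by (simp add: state_def Lamp_add_t)
  show ?thesis
  proof (cases ps)
    case Nil
    then show ?thesis using push x by (simp add: proper_def)
  next
    case (Cons p qs)
    show ?thesis
    proof (cases "- p + f \<in> A")
      case True
      then have "coset f = coset p" by (simp add: coset_eq_iff[symmetric])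
      moreover have "of_lst (rev (map coset ps)) = of_lst (rev (map coset qs)) + gen (coset p)"
        using of_lst_snoc[of "rev (map coset qs)" "coset p"] proper_rev[OF assms] x Cons by simp
      ultimately show ?thesis using True x Cons assms
        by (simp add: state_def Lamp_add_t add.assoc gen_set_double) (cases qs; simp add: proper_def)
    next
      case False
      then have "coset p \<noteq> coset f" by (simp add: coset_eq_iff)
      then have "proper (f # ps, f)" using assms x Cons by (simp add: proper_def)
      then show ?thesis using push False x Cons by simp
    qed
  qed
qed

lemma advance_state:
  assumes "proper x"
  shows "proper (advance a x) \<and> state (advance a x) = state x + lt (gen a)"
  using assms by (cases x) (simp add: proper_def state_def Lamp_add_lt)

lemma process_state:
  "proper (fold (process A) w ([], 0)) \<and> state (fold (process A) w ([], 0)) = sum_list (map symbol w)"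
proof (induction w rule: rev_induct)
  case Nil
  have "of_lst [] = (0 :: 'a red set red)" using of_lst_lst[of 0] by simp
  then show ?case by (simp add: proper_def state_def zero_lamp_def)
next
  case (snoc s w)
  then show ?case
    using toggle_state advance_state by (simp add: process_def symbol_def add.assoc[symmetric])
qed

lemma symbols_eq_0_iff: "sum_list (map symbol w) = 0 \<longleftrightarrow> fold (process A) w ([], 0) = ([], 0)"
proof -
  obtain ps f where x: "fold (process A) w ([], 0) = (ps, f)" by (rule prod.exhaust)
  have p: "proper (ps, f)" "sum_list (map symbol w) = state (ps, f)" using process_state[of w] x by auto
  have "lst (of_lst (rev (map coset ps))) = rev (map coset ps)" using proper_rev[OF p(1)] by simp
  then have "of_lst (rev (map coset ps)) = 0 \<longleftrightarrow> ps = []"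
    by (metis lst_eq_Nil rev_is_Nil_conv map_is_Nil_conv)
  then show ?thesis unfolding x p(2) by (simp add: state_def zero_lamp_def)
qed

text \<open>The universal property of the double as an amalgamated product.\<close>
lemma symbols_universal:
  fixes \<phi> :: "bool \<Rightarrow> 'a red \<Rightarrow> 'g::group_add"
  assumes add: "\<And>b u v. \<phi> b (u + v) = \<phi> b u + \<phi> b v" and agree: "\<And>u. u \<in> A \<Longrightarrow> \<phi> False u = \<phi> True u"
    and w: "sum_list (map symbol w) = 0"
  shows "sum_list (map (\<lambda>s. \<phi> (fst s) (gen (snd s))) w) = 0"
proof -
  have z: "\<phi> b 0 = 0" for b using add[of b 0 0] by (metis add.right_neutral add_left_imp_eq)
  have ag: "\<phi> b u = \<phi> c u" if "u \<in> A" for b c u using agree[OF that] by (cases b; cases c) auto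
  \<comment> \<open>Each stretch of a record is mapped by the homomorphism of the copy in which it
    is travelled; the copy is the parity of the number of open changes.\<close>
  define V where "V = rec_list (\<phi> False) (\<lambda>p qs r f. r p + \<phi> (odd (length (p # qs))) (- p + f))"
  have V: "V [] f = \<phi> False f" "V (p # qs) f = V qs p + \<phi> (odd (length (p # qs))) (- p + f)" for p qs f
    by (simp_all add: V_def)
  have Vadd: "V ps (f + g) = V ps f + \<phi> (odd (length ps)) g" for ps f g
  proof (cases ps)
    case (Cons p qs)
    have "\<phi> b (- p + (f + g)) = \<phi> b (- p + f) + \<phi> b g" for b using add[of b "- p + f" g] by (simp only: add.assoc)
    then show ?thesis unfolding Cons V by (simp only: add.assoc)
  qed (simp add: V add)
  define W where "W x = V (fst x) (snd x)" for x
  have tog: "W (toggle A x) = W x \<and> (even (length (fst (toggle A x))) \<longleftrightarrow> odd (length (fst x)))" for x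
  proof -
    obtain ps f where x: "x = (ps, f)" by (cases x)
    show ?thesis
    proof (cases ps)
      case Nil
      then show ?thesis using x by (simp add: W_def V z)
    next
      case (Cons p qs)
      \<comment> \<open>Cancelling a change of copy moves a stretch that lies in A from one copy to
        the other, where the two homomorphisms agree.\<close>
      have "V qs f = V (p # qs) f" if "- p + f \<in> A"
        using Vadd[of qs p "- p + f"] ag[OF that] by (simp add: V add.assoc[symmetric])
      then show ?thesis using x Cons by (simp add: W_def V(2)[of f] z)
    qed
  qed
  have adv: "W (advance a x) = W x + \<phi> (odd (length (fst x))) (gen a) \<and> fst (advance a x) = fst x" for a x
    by (cases x) (simp add: W_def Vadd)
  have "W (fold (process A) w ([], 0)) = sum_list (map (\<lambda>s. \<phi> (fst s) (gen (snd s))) w) \<and>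
     even (length (fst (fold (process A) w ([], 0))))"
  proof (induction w rule: rev_induct)
    case Nil
    then show ?case by (simp add: W_def V z)
  next
    case (snoc s w)
    have step: "W (process A s x) = W x + \<phi> (fst s) (gen (snd s)) \<and> even (length (fst (process A s x)))"
      if "even (length (fst x))" for x using that tog adv by (cases "fst s") (simp_all add: process_def)
    show ?case using step[of "fold (process A) w ([], 0)"] snoc by simp
  qed
  then show ?thesis using w unfolding symbols_eq_0_iff by (simp add: W_def V z)
qed

lemma symbols_const:
  "sum_list (map (\<lambda>a. symbol (False, a)) (lst u)) = lt u" "sum_list (map (\<lambda>a. symbol (True, a)) (lst u)) = t + lt u + t"
  using sum_list_lt[of u] sum_list_tlt[of u] by (simp_all add: symbol_def)

text \<open>The stack of the product is the coset of u followed by A; these cancel exactly when they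
  are equal.\<close>

lemma symbols_relator:
  "sum_list (map symbol (map (Pair False) (lst u) @ map (Pair True) (lst (- u)))) = 0 \<longleftrightarrow> u \<in> A"
proof -
  have "sum_list (map symbol (map (Pair False) (lst u) @ map (Pair True) (lst (- u)))) = Lamp 0 u + t + lt (- u) + t"
    using symbols_const[of u] symbols_const[of "- u"] by (simp add: comp_def add.assoc) (simp add: lt_def)
  also have "\<dots> = Lamp (gen (coset u) + gen (coset 0)) 0" by (simp add: Lamp_add_t Lamp_add_lt)
  also have "\<dots> = 0 \<longleftrightarrow> gen (coset u) = gen (coset 0)"
    using gen_set_double[of "coset 0"] by (simp add: zero_lamp_def eq_neg_iff_add_eq_0[symmetric] uminus_gen)
  also have "\<dots> \<longleftrightarrow> u \<in> A"
    unfolding lst_eq_iff[symmetric] lst_gen using coset_eq_iff[of 0 u] by auto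
  finally show ?thesis .
qed

lemma symbol_flip: "symbol (fst s, flip (snd s)) = - symbol s"
  by (auto simp: symbol_def minus_add uminus_t lt_uminus uminus_gen add.assoc simp del: add_uminus_conv_diff)

end

lemma symbols_agree:
  assumes "double_group A" "double_group B" "\<And>u. len u \<le> N \<Longrightarrow> u \<in> A \<longleftrightarrow> u \<in> B" "length w \<le> N"
  shows "sum_list (map (double_group.symbol A) w) = 0 \<longleftrightarrow> sum_list (map (double_group.symbol B) w) = 0"
  using process_agree[OF assms(3,4)] double_group.symbols_eq_0_iff[OF assms(1)] double_group.symbols_eq_0_iff[OF assms(2)]
  by simp

section \<open>Quasi-isometries and short relations\<close>

text \<open>Permutations serve as test groups for relations. Addition is composition in reading
  order, so the first letter of a word acts first.\<close>

typedef 'a bijection = "{f :: 'a \<Rightarrow> 'a. bij f}" morphisms app_bij Abs_bijection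
  by (intro exI[of _ id]) simp

setup_lifting type_definition_bijection

instantiation bijection :: (type) group_add
begin
lift_definition zero_bijection :: "'a bijection" is id by simp
lift_definition plus_bijection :: "'a bijection \<Rightarrow> 'a bijection \<Rightarrow> 'a bijection" is "\<lambda>f g. g \<circ> f" by (rule bij_comp)
lift_definition uminus_bijection :: "'a bijection \<Rightarrow> 'a bijection" is "inv_into UNIV" by (rule bij_imp_bij_inv)
definition minus_bijection :: "'a bijection \<Rightarrow> 'a bijection \<Rightarrow> 'a bijection" where "minus_bijection f g = f + - g"
instance
proof
  fix f g h :: "'a bijection"
  show "f + g + h = f + (g + h)" by transfer (simp add: comp_assoc)
  show "0 + f = f" by transfer simp
  show "f + 0 = f" by transfer simp
  show "- f + f = 0" by transfer (simp add: bij_is_surj surj_iff[symmetric])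
  show "f + - g = f - g" by (simp add: minus_bijection_def)
qed
end

abbreviation wval :: "('s \<Rightarrow> 'g::group_add) \<Rightarrow> 's list \<Rightarrow> 'g" where "wval E w \<equiv> sum_list (map E w)"

lemma wval_inverse:
  assumes "\<And>s. E (flip s) = - E s"
  shows "wval E (rev (map flip w)) = - wval E w"
  by (induction w) (simp_all add: assms minus_add)

text \<open>The letters act on \<open>'h \<times> 'k\<close> by moving the first component in the second group and
  multiplying the second component by the value of the word that the edge is mapped to; so each
  relation of the second group that bounds short relations acts trivially.\<close>
lemma wval_transfer:
  fixes E1 :: "'s::invol \<Rightarrow> 'g::group_add" and E1' :: "'s \<Rightarrow> 'k::group_add" and E2 :: "'s \<Rightarrow> 'h::group_add"
    and f :: "'g \<Rightarrow> 'h" and h :: "'h \<Rightarrow> 'g"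
  assumes flip: "\<And>s. E1 (flip s) = - E1 s" "\<And>s. E1' (flip s) = - E1' s" "\<And>s. E2 (flip s) = - E2 s"
    and short: "\<And>w. length w \<le> M \<Longrightarrow> wval E1 w = 0 \<Longrightarrow> wval E1' w = 0"
    and fill: "\<And>\<rho> :: 's \<Rightarrow> ('h \<times> 'k) bijection.
      (\<And>w. length w \<le> m \<Longrightarrow> wval E2 w = 0 \<Longrightarrow> wval \<rho> w = 0) \<Longrightarrow>
      (\<And>w. length w \<le> K \<Longrightarrow> wval E2 w = 0 \<Longrightarrow> wval \<rho> w = 0)"
    and \<theta>: "\<And>y s. length (\<theta> y s) \<le> R" "\<And>y s. wval E1 (\<theta> y s) = - h y + h (y + E2 s)"
    and \<phi>: "\<And>x s. x \<in> H \<Longrightarrow> length (\<phi> x s) \<le> B" "\<And>x s. x \<in> H \<Longrightarrow> wval E2 (\<phi> x s) = - f x + f (x + E1 s)"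
    and \<delta>: "\<And>x. x \<in> H \<Longrightarrow> length (\<delta> x) \<le> D" "\<And>x. x \<in> H \<Longrightarrow> wval E1 (\<delta> x) = - x + h (f x)"
    and H: "0 \<in> H" "\<And>x s. x \<in> H \<Longrightarrow> x + E1 s \<in> H"
    and sizes: "2 \<le> m" "R * m \<le> M" "2 * D + R * B + 1 \<le> M" "B * length r \<le> K"
    and r: "wval E1 r = 0"
  shows "wval E1' r = 0"
proof -
  \<comment> \<open>The image under h of the path spelled by w from y, each step being replaced by
    its short word over the first group.\<close>
  define \<Theta> where "\<Theta> = rec_list (\<lambda>y. []) (\<lambda>s w \<Theta> y. \<theta> y s @ \<Theta> (y + E2 s))"
  have \<Theta>: "\<Theta> [] y = []" "\<Theta> (s # w) y = \<theta> y s @ \<Theta> w (y + E2 s)" for s w y by (simp_all add: \<Theta>_def)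
  have \<Theta>_val: "wval E1 (\<Theta> w y) = - h y + h (y + wval E2 w)" for w y
    by (induction w arbitrary: y) (simp_all add: \<Theta> \<theta>(2) add.assoc)
  have \<Theta>_length: "length (\<Theta> w y) \<le> R * length w" for w y
  proof (induction w arbitrary: y)
    case (Cons s w)
    show ?case using \<theta>(1)[of y s] Cons[of "y + E2 s"] by (simp add: \<Theta>)
  qed (simp add: \<Theta>)
  \<comment> \<open>Only loops of length at most m have images short enough for
    \<open>short\<close>; longer loops are reached through \<open>fill\<close>.\<close>
  have \<Theta>_loop: "wval E1' (\<Theta> w y) = 0" if "length w \<le> m" "wval E2 w = 0" for w y
  proof (rule short)
    have "R * length w \<le> R * m" using that(1) by simp
    then show "length (\<Theta> w y) \<le> M" using \<Theta>_length[of w y] sizes(2) by linarith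
    show "wval E1 (\<Theta> w y) = 0" using \<Theta>_val[of w y] that(2) by simp
  qed
  define \<tau> where "\<tau> s z = (fst z + E2 s, snd z + wval E1' (\<theta> (fst z) s))" for s and z :: "'h \<times> 'k"
  have \<tau>_flip: "\<tau> (flip s) (\<tau> s z) = z" for s z
  proof -
    have "wval E1' (\<theta> (fst z) s @ \<theta> (fst z + E2 s) (flip s)) = 0"
      using \<Theta>_loop[of "[s, flip s]" "fst z"] sizes(1) by (simp add: \<Theta> flip(3))
    then show ?thesis by (cases z) (simp add: \<tau>_def flip(3) add.assoc)
  qed
  have bij: "bij (\<tau> s)" for s
    using \<tau>_flip[of s] \<tau>_flip[of "flip s"] by (intro bij_betw_byWitness[where f' = "\<tau> (flip s)"]) auto
  define \<rho> where "\<rho> s = Abs_bijection (\<tau> s)" for s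
  have \<rho>: "app_bij (\<rho> s) = \<tau> s" for s by (simp add: \<rho>_def Abs_bijection_inverse bij)
  have \<rho>_val: "app_bij (wval \<rho> w) z = (fst z + wval E2 w, snd z + wval E1' (\<Theta> w (fst z)))" for w z
    by (induction w arbitrary: z) (simp_all add: zero_bijection.rep_eq plus_bijection.rep_eq \<rho> \<tau>_def \<Theta> add.assoc)
  have "wval \<rho> w = 0" if "length w \<le> m" "wval E2 w = 0" for w
    unfolding app_bij_inject[symmetric] using \<Theta>_loop[OF that]
    by (intro ext) (simp add: \<rho>_val that zero_bijection.rep_eq)
  \<comment> \<open>\<open>fill\<close> expresses that short relations imply the longer ones, stated
    for this one target type since a hypothesis cannot range over all types.\<close>
  from fill[of \<rho>, OF this] have trivial: "wval E1' (\<Theta> w y) = 0" if "length w \<le> K" "wval E2 w = 0" for w y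
    using \<rho>_val[of w "(y, 0)"] that by (simp add: zero_bijection.rep_eq)

  define \<Phi> where "\<Phi> = rec_list (\<lambda>x. []) (\<lambda>s w \<Phi> x. \<phi> x s @ \<Phi> (x + E1 s))"
  have \<Phi>: "\<Phi> [] x = []" "\<Phi> (s # w) x = \<phi> x s @ \<Phi> w (x + E1 s)" for s w x by (simp_all add: \<Phi>_def)
  have \<Theta>_append: "\<Theta> (u @ v) y = \<Theta> u y @ \<Theta> v (y + wval E2 u)" for u v y
    by (induction u arbitrary: y) (simp_all add: \<Theta> add.assoc)
  have \<Phi>_val: "wval E2 (\<Phi> w x) = - f x + f (x + wval E1 w)" if "x \<in> H" for w x
    using that by (induction w arbitrary: x) (simp_all add: \<Phi> \<phi>(2) H(2) add.assoc)
  have \<Phi>_length: "length (\<Phi> w x) \<le> B * length w" if "x \<in> H" for w x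
    using that
  proof (induction w arbitrary: x)
    case (Cons s w)
    show ?case using \<phi>(1)[of x s] Cons.IH[of "x + E1 s"] Cons.prems H(2) by (simp add: \<Phi>)
  qed (simp add: \<Phi>)
  \<comment> \<open>A path in the first group and its image under f followed by h form a ladder with
    cross-pieces \<delta>. Each square is a short loop, so both sides of the ladder have conjugate
    values.\<close>
  have square: "wval E1' (\<Theta> (\<phi> x s) (f x)) = - wval E1' (\<delta> x) + E1' s + wval E1' (\<delta> (x + E1 s))"
    if x: "x \<in> H" for x s
  proof -
    have len: "length (\<delta> x) \<le> D" "length (\<delta> (x + E1 s)) \<le> D" using \<delta>(1) x H(2) by auto
    have "R * length (\<phi> x s) \<le> R * B" using \<phi>(1)[OF x] by simp
    then have l: "length (\<Theta> (\<phi> x s) (f x)) \<le> R * B" using \<Theta>_length[of "\<phi> x s" "f x"] by linarith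
    have "wval E1' (\<delta> x @ \<Theta> (\<phi> x s) (f x) @ rev (map flip (\<delta> (x + E1 s))) @ [flip s]) = 0"
    proof (rule short)
      show "length (\<delta> x @ \<Theta> (\<phi> x s) (f x) @ rev (map flip (\<delta> (x + E1 s))) @ [flip s]) \<le> M"
        using len l sizes(3) by simp
      show "wval E1 (\<delta> x @ \<Theta> (\<phi> x s) (f x) @ rev (map flip (\<delta> (x + E1 s))) @ [flip s]) = 0"
        using x H(2)[OF x] wval_inverse[of E1, OF flip(1)]
        by (simp add: \<delta>(2) \<Theta>_val \<phi>(2) flip minus_add add.assoc diff_conv_add_uminus del: add_uminus_conv_diff)
    qed
    then have z: "wval E1' (\<delta> x) + (wval E1' (\<Theta> (\<phi> x s) (f x)) + (- wval E1' (\<delta> (x + E1 s)) + - E1' s)) = 0"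
      using wval_inverse[of E1', OF flip(2)] by (simp add: flip)
    have solve: "b = - a + d + c" if "a + (b + (- c + - d)) = 0" for a b c d :: 'k
    proof -
      have "b + - (d + c) = - a" using minus_unique[OF that] by (simp only: minus_add)
      then have "b = - a + (d + c)" by (simp only: diff_conv_add_uminus[symmetric] diff_eq_eq)
      then show ?thesis by (simp only: add.assoc)
    qed
    show ?thesis by (rule solve[OF z])
  qed
  have "wval E1' (\<Theta> (\<Phi> w x) (f x)) = - wval E1' (\<delta> x) + wval E1' w + wval E1' (\<delta> (x + wval E1 w))"
    if "x \<in> H" for w x
    using that
  proof (induction w arbitrary: x)
    case Nil
    then show ?case by (simp add: \<Phi> \<Theta>)
  next
    case (Cons s w)
    have "f x + wval E2 (\<phi> x s) = f (x + E1 s)" using \<phi>(2)[OF Cons.prems] by (simp add: add.assoc[symmetric])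
    then show ?case using Cons.IH[OF H(2)[OF Cons.prems]] square[OF Cons.prems, of s]
      by (simp add: \<Phi> \<Theta>_append add.assoc)
  qed
  note this[OF H(1), of r]
  moreover have "wval E1' (\<Theta> (\<Phi> r 0) (f 0)) = 0"
  proof (rule trivial)
    show "length (\<Phi> r 0) \<le> K" using \<Phi>_length[OF H(1), of r] sizes(4) by linarith
    show "wval E2 (\<Phi> r 0) = 0" using \<Phi>_val[OF H(1), of r] r by simp
  qed
  ultimately have "- wval E1' (\<delta> 0) + wval E1' r + wval E1' (\<delta> 0) = 0" using r by simp
  then have "- wval E1' (\<delta> 0) + (wval E1' r + wval E1' (\<delta> 0)) = - wval E1' (\<delta> 0) + (0 + wval E1' (\<delta> 0))"
    by (simp only: add.assoc add_0 left_minus)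
  then show ?thesis by (simp only: add_left_cancel add_right_cancel)
qed

instantiation prod :: (type, invol) invol
begin
definition flip_prod :: "'a \<times> 'b \<Rightarrow> 'a \<times> 'b" where "flip_prod s = (fst s, flip (snd s))"
instance by standard (simp add: flip_prod_def)
end

lemma flip_Pair [simp]: "flip (b, a) = (b, flip a)"
  by (simp add: flip_prod_def)

lemma wval_push:
  assumes "\<And>a. E (flip a) = - E a"
  shows "wval E (push a l) = E a + wval E l"
proof (cases "l \<noteq> [] \<and> hd l = flip a")
  case True
  then obtain l' where "l = flip a # l'" by (cases l) auto
  then show ?thesis by (simp add: assms)
next
  case False
  then show ?thesis by (cases l) auto
qed

lemma wval_plus:
  assumes "\<And>a. E (flip a) = - E a"
  shows "wval E (lst (u + v)) = wval E (lst u) + wval E (lst v)"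
proof -
  have "wval E (foldr push k l) = wval E k + wval E l" for k l
    by (induction k) (simp_all add: wval_push[of E, OF assms] add.assoc)
  then show ?thesis by (simp add: lst_plus)
qed

lemma stp_Some_bound: "stp I a i = Some j \<Longrightarrow> \<bar>j\<bar> \<le> \<bar>i\<bar> + 1"
  by (induction I a i rule: stp.induct) (auto split: if_splits)

text \<open>A reading that starts at i and takes \<open>length w\<close> steps only meets rungs at
  distance less than N from 0.\<close>

lemma run_agree:
  assumes "\<And>k. ell_rung k < N \<Longrightarrow> k \<in> I \<longleftrightarrow> k \<in> J" "\<bar>i\<bar> + int (length w) \<le> N"
  shows "run I w i = run J w i"
  using assms(2)
proof (induction w arbitrary: i)
  case (Cons a w)
  have "k \<in> I \<longleftrightarrow> k \<in> J" if "\<bar>i\<bar> = ell_rung k" for k using assms(1)[of k] Cons.prems that by simp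
  then have "(\<exists>n\<in>I. i = - ell_rung n) \<longleftrightarrow> (\<exists>n\<in>J. i = - ell_rung n)"
    "(\<exists>n\<in>I. i = ell_rung n) \<longleftrightarrow> (\<exists>n\<in>J. i = ell_rung n)"
    by (metis abs_minus_cancel abs_of_pos ell_rung_pos)+
  then have eq: "stp I a i = stp J a i"
    by (cases a rule: letter.exhaust; cases "case a of Letter l b \<Rightarrow> l"; cases "case a of Letter l b \<Rightarrow> b") auto
  have "run I w j = run J w j" if "stp J a i = Some j" for j
    using Cons.IH[of j] stp_Some_bound[OF that] Cons.prems by simp
  then show ?case by (simp add: eq split: option.splits)
qed simp

lemma loops_agree:
  assumes "\<And>k. ell_rung k < int N \<Longrightarrow> k \<in> I \<longleftrightarrow> k \<in> J" "len u \<le> N"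
  shows "u \<in> loops I \<longleftrightarrow> u \<in> loops J"
  using run_agree[of "int N" I J 0 "lst u"] assms by (simp add: loops_def)

section \<open>Relators of the rungs\<close>

definition walk :: "int \<Rightarrow> letter list" where
  "walk i = (if 0 \<le> i then map (\<lambda>k. Letter (lab (int k)) True) [0..<nat i]
     else map (\<lambda>k. Letter (lab (- 1 - int k)) False) [0..<nat (- i)])"

lemma walk_0 [simp]: "walk 0 = []" by (simp add: walk_def)

lemma walk_right: "0 \<le> i \<Longrightarrow> walk (i + 1) = walk i @ [Letter (lab i) True]"
  by (simp add: walk_def nat_add_distrib)

lemma walk_left: "i < 0 \<Longrightarrow> walk i = walk (i + 1) @ [Letter (lab i) False]"
proof -
  assume i: "i < 0"
  then have "nat (- i) = Suc (nat (- (i + 1)))" by simp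
  then show ?thesis using i by (simp add: walk_def)
qed

lemma length_walk: "int (length (walk i)) = \<bar>i\<bar>"
  by (simp add: walk_def)

lemma stp_line: "stp I (Letter (lab i) True) i = Some (i + 1)" "stp I (Letter (lab i) False) (i + 1) = Some i"
  by (simp_all add: lab_def)

lemma run_walk: "run I (walk i) 0 = Some i"
proof -
  have r: "run I (walk (int n)) 0 = Some (int n)" for n
  proof (induction n)
    case (Suc n)
    then show ?case using walk_right[of "int n"] stp_line(1)[of I "int n"]
      by (simp add: run_append_Some add.commute)
  qed simp
  have l: "run I (walk (- int n)) 0 = Some (- int n)" for n
  proof (induction n)
    case (Suc n)
    then show ?case using walk_left[of "- int (Suc n)"] stp_line(2)[of I "- int (Suc n)"]
      by (simp add: run_append_Some)
  qed simp
  show ?thesis using r[of "nat i"] l[of "nat (- i)"] by (cases "0 \<le> i") auto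
qed

text \<open>The loop that walks left to one end of the rung, crosses it and returns from the other
  end. All its line letters point left, so nothing cancels.\<close>

definition rung_word :: "nat \<Rightarrow> letter list" where
  "rung_word n = walk (- ell_rung n) @ [Letter None True] @ rev (map flip (walk (ell_rung n)))"

lemma run_rung_word: "run I (rung_word n) 0 = Some 0 \<longleftrightarrow> n \<in> I"
proof
  assume "n \<in> I"
  then show "run I (rung_word n) 0 = Some 0"
    using run_walk[of I "- ell_rung n"] run_rev_flip[OF run_walk[of I "ell_rung n"]]
    by (auto simp: rung_word_def run_append_Some)
next
  assume "run I (rung_word n) 0 = Some 0"
  then obtain j where "stp I (Letter None True) (- ell_rung n) = Some j"
    using run_walk[of I "- ell_rung n"] by (auto simp: rung_word_def run_append_Some split: option.splits)
  then show "n \<in> I" using ell_rung_inj by (auto split: if_splits)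
qed

lemma reduced_rung_word: "reduced (rung_word n)"
proof -
  have all: "\<forall>a\<in>set (rung_word n). (\<exists>l. a = Letter (Some l) False) \<or> a = Letter None True"
    using ell_rung_pos[of n] by (auto simp: rung_word_def walk_def lab_def)
  have "b \<noteq> flip a" if "(\<exists>l. a = Letter (Some l) False) \<or> a = Letter None True"
    "(\<exists>l. b = Letter (Some l) False) \<or> b = Letter None True" for a b
    using that by auto
  then have "successively (\<lambda>a b. b \<noteq> flip a) w" if "\<forall>a\<in>set w. (\<exists>l. a = Letter (Some l) False) \<or> a = Letter None True" for w
    using that by (induction w rule: induct_list012) auto
  then show ?thesis using all by blast
qed

lemma length_rung_word: "length (rung_word n) = 2 * fact (n + 1) + 1"
proof -
  have "int (length (rung_word n)) = 2 * ell_rung n + 1"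
    using length_walk[of "- ell_rung n"] length_walk[of "ell_rung n"] ell_rung_pos[of n] by (simp add: rung_word_def)
  also have "\<dots> = int (2 * fact (n + 1) + 1)" unfolding ell_rung_def by (simp only: of_nat_add of_nat_mult of_nat_numeral of_nat_1)
  finally show ?thesis by (simp only: of_nat_eq_iff)
qed

text \<open>The relation that identifies the two copies of the rung loop in the double.\<close>

definition relator :: "nat \<Rightarrow> (bool \<times> letter) list" where
  "relator n = map (Pair False) (rung_word n) @ map (Pair True) (rev (map flip (rung_word n)))"

lemma length_relator: "length (relator n) = 4 * fact (n + 1) + 2"
  by (simp add: relator_def length_rung_word)

lemma symbols_relator_iff: "wval (loops.symbol I) (relator n) = 0 \<longleftrightarrow> n \<in> I"
proof -
  have "lst (of_lst (rung_word n)) = rung_word n" by (rule lst_of_lst[OF reduced_rung_word])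
  then show ?thesis
    using loops.symbols_relator[of I "of_lst (rung_word n)"] run_rung_word[of I n]
    by (simp only: relator_def lst_uminus loops_def mem_Collect_eq)
qed

text \<open>The line is a spanning tree of the graph, so the rung loops generate the loop group. If
  their two copies have equal values, the homomorphisms on the two copies of F agree on the loop
  group and the universal property applies.\<close>

lemma relators_fill:
  fixes \<rho> :: "bool \<times> letter \<Rightarrow> 'g::group_add"
  assumes flip: "\<And>s. \<rho> (flip s) = - \<rho> s" and rel: "\<And>n. n \<in> I \<Longrightarrow> wval \<rho> (relator n) = 0"
    and w: "wval (loops.symbol I) w = 0"
  shows "wval \<rho> w = 0"
proof -
  define W where "W b l = wval (\<lambda>a. \<rho> (b, a)) l" for b l
  have W: "W b [] = 0" "W b (a # l) = \<rho> (b, a) + W b l" "W b (k @ l) = W b k + W b l" for b a k l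
    by (simp_all add: W_def)
  have fl: "\<rho> (b, flip a) = - \<rho> (b, a)" for a b using flip[of "(b, a)"] by simp
  have W_rev: "W b (rev (map flip l)) = - W b l" for b l
    unfolding W_def by (rule wval_inverse) (rule fl)
  \<comment> \<open>The generator of the fundamental group that belongs to the edge a, with the line
    as spanning tree: trivial for line edges, the rung loop for a rung.\<close>
  define Q where "Q b i a j = W b (walk i) + \<rho> (b, a) - W b (walk j)" for b i a j
  have Q_flip: "Q b j (flip a) i = - Q b i a j" for b i a j
    by (simp add: Q_def fl minus_add diff_conv_add_uminus add.assoc del: add_uminus_conv_diff)
  have forward: "Q False i a j = Q True i a j" if s: "stp I a i = Some j" "a = Letter l True" for i a j l
  proof (cases l)
    case (Some l')
    then have a: "a = Letter (lab i) True" "j = i + 1" using s by (auto split: if_splits)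
    have "Q b i a j = 0" for b
    proof (cases "0 \<le> i")
      case True
      then show ?thesis by (simp add: Q_def a walk_right W)
    next
      case False
      then show ?thesis using walk_left[of i] fl[of b "Letter (lab i) False"] by (simp add: Q_def a W)
    qed
    then show ?thesis by simp
  next
    case None
    then obtain n where n: "n \<in> I" "i = - ell_rung n" "j = ell_rung n" "a = Letter None True"
      using s by (auto split: if_splits)
    have "Q b i a j = W b (rung_word n)" for b
      unfolding Q_def rung_word_def by (simp add: W n W_rev add.assoc diff_conv_add_uminus del: add_uminus_conv_diff)
    moreover have "W False (rung_word n) - W True (rung_word n) = 0"
      using rel[OF n(1)] W_rev[of True "rung_word n"] unfolding relator_def
      by (simp add: W_def comp_def)
    ultimately show ?thesis by simp
  qed
  have step: "Q False i a j = Q True i a j" if s: "stp I a i = Some j" for i a j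
  proof (cases a)
    case (Letter l b)
    show ?thesis
    proof (cases b)
      case False
      then have "Q False j (flip a) i = Q True j (flip a) i"
        using forward[OF stp_flip[OF s]] Letter by simp
      then show ?thesis by (simp add: Q_flip)
    qed (use forward[OF s] Letter in simp)
  qed
  have path: "W False (walk i) + W False l - W False (walk j) = W True (walk i) + W True l - W True (walk j)"
    if "run I l i = Some j" for l i j
    using that
  proof (induction l arbitrary: i)
    case (Cons a l)
    obtain k where k: "stp I a i = Some k" "run I l k = Some j" using Cons.prems run_Cons_Some by blast
    have "W b (walk i) + W b (a # l) - W b (walk j) = Q b i a k + (W b (walk k) + W b l - W b (walk j))" for b
      by (simp add: Q_def W add.assoc diff_conv_add_uminus del: add_uminus_conv_diff)
    then show ?case using step[OF k(1)] Cons.IH[OF k(2)] by simp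
  qed (simp add: W)
  have "sum_list (map (\<lambda>s. W (fst s) (lst (gen (snd s)))) w) = 0"
  proof (rule loops.symbols_universal[of "\<lambda>b u. W b (lst u)"])
    show "W b (lst (u + v)) = W b (lst u) + W b (lst v)" for b u v
      unfolding W_def by (rule wval_plus) (rule fl)
    show "W False (lst u) = W True (lst u)" if "u \<in> loops I" for u
      using path[of "lst u" 0 0] that by (simp add: loops_def W)
    show "wval (loops.symbol I) w = 0" by (rule w)
  qed
  then show ?thesis by (simp add: W)
qed

section \<open>Quasi-isometries between groups of the family\<close>

lemma quasi_isometric_coarse_inverse:
  assumes "generated_group G1 S1" "generated_group G2 S2" "quasi_isometric G1 S1 G2 S2"
  obtains f h and C :: nat where "f \<in> carrier G1 \<rightarrow> carrier G2" "h \<in> carrier G2 \<rightarrow> carrier G1"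
    "\<forall>x\<in>carrier G1. \<forall>y\<in>carrier G1. cay_dist G1 S1 x y \<le> 1 \<longrightarrow> cay_dist G2 S2 (f x) (f y) \<le> C"
    "\<forall>x\<in>carrier G2. \<forall>y\<in>carrier G2. cay_dist G2 S2 x y \<le> 1 \<longrightarrow> cay_dist G1 S1 (h x) (h y) \<le> C"
    "\<forall>x\<in>carrier G1. cay_dist G1 S1 x (h (f x)) \<le> C"
proof -
  interpret G1: generated_group G1 S1 by fact
  interpret G2: generated_group G2 S2 by fact
  obtain f L c where f: "f \<in> carrier G1 \<rightarrow> carrier G2" and L: "L \<ge> 1" and c: "c \<ge> (0::real)"
    and lower: "\<And>x y. x \<in> carrier G1 \<Longrightarrow> y \<in> carrier G1 \<Longrightarrow> real (G1.d x y) / L - c \<le> real (G2.d (f x) (f y))"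
    and upper: "\<And>x y. x \<in> carrier G1 \<Longrightarrow> y \<in> carrier G1 \<Longrightarrow> real (G2.d (f x) (f y)) \<le> L * real (G1.d x y) + c"
    and dense: "\<And>z. z \<in> carrier G2 \<Longrightarrow> \<exists>x\<in>carrier G1. real (G2.d z (f x)) \<le> c"
    using assms(3) unfolding quasi_isometric_def by blast
  obtain h where h: "\<And>z. z \<in> carrier G2 \<Longrightarrow> h z \<in> carrier G1" "\<And>z. z \<in> carrier G2 \<Longrightarrow> real (G2.d z (f (h z))) \<le> c"
    using dense by metis
  have fc: "f x \<in> carrier G2" if "x \<in> carrier G1" for x using f that by auto
  \<comment> \<open>The sum \<open>3 * c + 1\<close> consists of c for each of two points moved by
    coarse surjectivity, c from the lower bound, and 1 for an edge.\<close>
  define C where "C = nat \<lceil>L * (3 * c + 1)\<rceil>"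
  have C: "m \<le> C" if "real m \<le> L * (3 * c + 1)" for m
    unfolding C_def using that by linarith
  have Lc: "c \<le> L * c" using mult_right_mono[OF L c] by simp
  have mono: "L * real m \<le> L" if "m \<le> 1" for m using L that by (cases "m = 0") auto
  have lower': "real (G1.d x y) \<le> L * (real (G2.d (f x) (f y)) + c)" if xy: "x \<in> carrier G1" "y \<in> carrier G1" for x y
  proof -
    have "real (G1.d x y) / L \<le> real (G2.d (f x) (f y)) + c" using lower[OF xy] by simp
    then show ?thesis using L by (simp add: pos_divide_le_eq mult.commute)
  qed
  show thesis
  proof (rule that[of f h C]; (intro ballI impI)?)
    show "f \<in> carrier G1 \<rightarrow> carrier G2" by fact
    show "h \<in> carrier G2 \<rightarrow> carrier G1" using h(1) by simp
    show "G2.d (f x) (f y) \<le> C" if xy: "x \<in> carrier G1" "y \<in> carrier G1" "G1.d x y \<le> 1" for x y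
    proof (rule C)
      have "0 \<le> L * c" using L c by simp
      then show "real (G2.d (f x) (f y)) \<le> L * (3 * c + 1)"
        using upper[OF xy(1,2)] mono[OF xy(3)] Lc by (simp add: algebra_simps)
    qed
    show "G1.d (h x) (h y) \<le> C" if xy: "x \<in> carrier G2" "y \<in> carrier G2" "G2.d x y \<le> 1" for x y
    proof (rule C)
      have "G2.d (f (h x)) (f (h y)) \<le> G2.d (f (h x)) x + (G2.d x y + G2.d y (f (h y)))"
        using G2.d_triangle[of "f (h x)" x "f (h y)"] G2.d_triangle[of x y "f (h y)"] xy h(1) fc
        by (meson add_le_mono le_refl order_trans)
      moreover have "G2.d (f (h x)) x = G2.d x (f (h x))" using G2.d_sym xy h(1) fc by blast
      ultimately have "real (G2.d (f (h x)) (f (h y))) + c \<le> 3 * c + 1"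
        using h(2)[OF xy(1)] h(2)[OF xy(2)] xy(3) by linarith
      then have "L * (real (G2.d (f (h x)) (f (h y))) + c) \<le> L * (3 * c + 1)" using L by (intro mult_left_mono) auto
      then show "real (G1.d (h x) (h y)) \<le> L * (3 * c + 1)" using lower'[of "h x" "h y"] h(1) xy by fastforce
    qed
    show "G1.d x (h (f x)) \<le> C" if x: "x \<in> carrier G1" for x
    proof (rule C)
      have "real (G1.d x (h (f x))) \<le> L * (real (G2.d (f x) (f (h (f x)))) + c)"
        using lower'[of x "h (f x)"] x fc h(1) by blast
      also have "\<dots> \<le> L * (3 * c + 1)"
        using h(2)[OF fc[OF x]] L c by (intro mult_left_mono) auto
      finally show "real (G1.d x (h (f x))) \<le> L * (3 * c + 1)" .
    qed
  qed
qed

abbreviation NGI :: "nat set \<Rightarrow> nat monoid" where "NGI I \<equiv> nat_copy (loops.GA I)"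
abbreviation SGI :: "nat set \<Rightarrow> nat set" where "SGI I \<equiv> to_nat_on (loops.GA I) ` loops.SG I"

lemma symbol_GA: "loops.symbol I s \<in> loops.GA I"
  using loops.SG_GA[of I] loops.SG_symbol[of I] by blast

lemma symbol_word:
  assumes "x \<in> loops.GA I"
  shows "\<exists>w. length w = nrm x \<and> wval (loops.symbol I) w = x"
proof -
  obtain ws where ws: "set ws \<subseteq> range (loops.symbol I)" "length ws = nrm x" "sum_list ws = x"
    using loops.ell_word[OF assms] unfolding loops.SG_symbol by blast
  then have "ws \<in> lists (range (loops.symbol I))" by (simp add: in_lists_conv_set subset_iff)
  then obtain w where "ws = map (loops.symbol I) w" unfolding lists_image by blast
  then show ?thesis using ws by (intro exI[of _ w]) simp
qed

lemma ell_rung_less: "ell_rung k < ell_rung n \<Longrightarrow> k < n"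
  using ell_rung_mono[of n k] by (meson not_le)

text \<open>Words of length up to \<open>fact (n + 1)\<close> do not see the rungs of I from n on,
  and since n is missing from J, the relations of J up to length \<open>fact (n + 2)\<close> come
  from rungs below n. A quasi-isometry would then derive the relator of n from relations of I too
  short to involve it, although it fails once the rungs from n on are removed.\<close>

lemma not_quasi_isometric:
  assumes "infinite (I - J)"
  shows "\<not> quasi_isometric (NGI I) (SGI I) (NGI J) (SGI J)"
proof
  assume qi: "quasi_isometric (NGI I) (SGI I) (NGI J) (SGI J)"
  obtain f h C where f: "f \<in> carrier (NGI I) \<rightarrow> carrier (NGI J)" and h: "h \<in> carrier (NGI J) \<rightarrow> carrier (NGI I)"
    and f1: "\<forall>x\<in>carrier (NGI I). \<forall>y\<in>carrier (NGI I). cay_dist (NGI I) (SGI I) x y \<le> 1 \<longrightarrow>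
      cay_dist (NGI J) (SGI J) (f x) (f y) \<le> C"
    and h1: "\<forall>x\<in>carrier (NGI J). \<forall>y\<in>carrier (NGI J). cay_dist (NGI J) (SGI J) x y \<le> 1 \<longrightarrow>
      cay_dist (NGI I) (SGI I) (h x) (h y) \<le> C"
    and hf: "\<forall>x\<in>carrier (NGI I). cay_dist (NGI I) (SGI I) x (h (f x)) \<le> C"
    by (rule quasi_isometric_coarse_inverse[OF loops.generated_group_NG loops.generated_group_NG qi])
  define F where "F x = from_nat_into (loops.GA J) (f (to_nat_on (loops.GA I) x))" for x
  \<comment> \<open>\<open>wval_transfer\<close> lets the letters act over the whole ambient type of
    the second group, so the coarse inverse is extended by 0 outside the group, where the empty word
    serves as \<theta>.\<close>
  define G where "G y = (if y \<in> loops.GA J then from_nat_into (loops.GA I) (h (to_nat_on (loops.GA J) y)) else 0)" for y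
  have F: "F x \<in> loops.GA J" "f (to_nat_on (loops.GA I) x) = to_nat_on (loops.GA J) (F x)" if "x \<in> loops.GA I" for x
  proof -
    have "f (to_nat_on (loops.GA I) x) \<in> to_nat_on (loops.GA J) ` loops.GA J"
      using f that by (auto simp: nat_copy_def)
    then show "F x \<in> loops.GA J" "f (to_nat_on (loops.GA I) x) = to_nat_on (loops.GA J) (F x)"
      unfolding F_def by auto
  qed
  have G: "G y \<in> loops.GA I" "h (to_nat_on (loops.GA J) y) = to_nat_on (loops.GA I) (G y)" if y: "y \<in> loops.GA J" for y
  proof -
    have "h (to_nat_on (loops.GA J) y) \<in> to_nat_on (loops.GA I) ` loops.GA I"
      using h y by (auto simp: nat_copy_def)
    then show "G y \<in> loops.GA I" "h (to_nat_on (loops.GA J) y) = to_nat_on (loops.GA I) (G y)"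
      unfolding G_def using y by auto
  qed
  have carI: "to_nat_on (loops.GA I) x \<in> carrier (NGI I)" if "x \<in> loops.GA I" for x I using that by (simp add: nat_copy_def)
  have one: "nrm (- x + (x + loops.symbol I s)) \<le> 1" for I x s
    using loops.nrm_SG[of "loops.symbol I s" I] loops.SG_symbol[of I] by (simp add: add.assoc[symmetric])
  have GA_symbol: "x + loops.symbol I s \<in> loops.GA I \<longleftrightarrow> x \<in> loops.GA I" for x I s
  proof
    assume "x + loops.symbol I s \<in> loops.GA I"
    then have "(x + loops.symbol I s) + - loops.symbol I s \<in> loops.GA I"
      using loops.add_H loops.uminus_H symbol_GA by blast
    then show "x \<in> loops.GA I" by (simp add: add.assoc)
  qed (use loops.add_H symbol_GA in blast)

  have "\<exists>w. length w \<le> C \<and> wval (loops.symbol I) w = - G y + G (y + loops.symbol J s)" for y s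
  proof (cases "y \<in> loops.GA J")
    case True
    then have ys: "y + loops.symbol J s \<in> loops.GA J" using GA_symbol by blast
    have "nrm (- G y + G (y + loops.symbol J s)) \<le> C"
      using h1[rule_format, OF carI[OF True] carI[OF ys]] one[of y J s]
      by (simp only: G(2)[OF True] G(2)[OF ys] loops.cay_dist_NG[OF True ys] loops.cay_dist_NG[OF G(1)[OF True] G(1)[OF ys]])
    moreover have "- G y + G (y + loops.symbol J s) \<in> loops.GA I" using G(1) True ys loops.add_H loops.uminus_H by blast
    ultimately show ?thesis using symbol_word by metis
  next
    case False
    then have "y + loops.symbol J s \<notin> loops.GA J" using GA_symbol by blast
    then show ?thesis using False by (intro exI[of _ "[]"]) (simp add: G_def)
  qed
  then obtain \<theta> where \<theta>: "\<And>y s. length (\<theta> y s) \<le> C" "\<And>y s. wval (loops.symbol I) (\<theta> y s) = - G y + G (y + loops.symbol J s)"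
    by metis
  have "\<exists>w. length w \<le> C \<and> wval (loops.symbol J) w = - F x + F (x + loops.symbol I s)" if x: "x \<in> loops.GA I" for x s
  proof -
    have xs: "x + loops.symbol I s \<in> loops.GA I" using GA_symbol x by blast
    have "nrm (- F x + F (x + loops.symbol I s)) \<le> C"
      using f1[rule_format, OF carI[OF x] carI[OF xs]] one[of x I s]
      by (simp only: F(2)[OF x] F(2)[OF xs] loops.cay_dist_NG[OF x xs] loops.cay_dist_NG[OF F(1)[OF x] F(1)[OF xs]])
    moreover have "- F x + F (x + loops.symbol I s) \<in> loops.GA J" using F(1) x xs loops.add_H loops.uminus_H by blast
    ultimately show ?thesis using symbol_word by metis
  qed
  then obtain \<phi> where \<phi>: "\<And>x s. x \<in> loops.GA I \<Longrightarrow> length (\<phi> x s) \<le> C"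
      "\<And>x s. x \<in> loops.GA I \<Longrightarrow> wval (loops.symbol J) (\<phi> x s) = - F x + F (x + loops.symbol I s)"
    by metis
  have "\<exists>w. length w \<le> C \<and> wval (loops.symbol I) w = - x + G (F x)" if x: "x \<in> loops.GA I" for x
  proof -
    have GF: "G (F x) \<in> loops.GA I" using F(1) G(1) x by blast
    have "nrm (- x + G (F x)) \<le> C"
      using hf[rule_format, OF carI[OF x]] by (simp only: F(2)[OF x] G(2)[OF F(1)[OF x]] loops.cay_dist_NG[OF x GF])
    moreover have "- x + G (F x) \<in> loops.GA I" using GF x loops.add_H loops.uminus_H by blast
    ultimately show ?thesis using symbol_word by metis
  qed
  then obtain \<delta> where \<delta>: "\<And>x. x \<in> loops.GA I \<Longrightarrow> length (\<delta> x) \<le> C"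
      "\<And>x. x \<in> loops.GA I \<Longrightarrow> wval (loops.symbol I) (\<delta> x) = - x + G (F x)"
    by metis

  \<comment> \<open>The bound makes the factors \<open>n + 1\<close> and \<open>n + 2\<close>
    between neighbouring factorials exceed both \<open>6 * C\<close> and the size
    \<open>2 * C + C * C + 1\<close> of a square of the ladder.\<close>
  obtain n where n: "n \<in> I - J" "n > C * C + 6 * C + 1"
    using assms unfolding infinite_nat_iff_unbounded by blast
  define I' where "I' = I \<inter> {..<n}"
  define J' where "J' = J \<inter> {..<n}"
  have flip: "loops.symbol I (flip s) = - loops.symbol I s" for I s
    using loops.symbol_flip[of I s] by (simp add: flip_prod_def)
  have "wval (loops.symbol I') (relator n) = 0"
  \<comment> \<open>m bounds the relators of rungs below n; M is a length up to which I and
    \<open>I'\<close> have the same relations, and K is one for J and \<open>J'\<close>.\<close>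
  proof (rule wval_transfer[where ?E1.0 = "loops.symbol I" and E1' = "loops.symbol I'" and ?E2.0 = "loops.symbol J"
        and h = G and f = F and \<theta> = \<theta> and \<phi> = \<phi> and \<delta> = \<delta> and H = "loops.GA I"
        and M = "fact (n + 1)" and m = "4 * fact n + 2" and K = "fact (n + 2)" and R = C and B = C and D = C])
    show "wval (loops.symbol I') w = 0" if w: "length w \<le> fact (n + 1)" "wval (loops.symbol I) w = 0" for w
    proof -
      have "u \<in> loops I \<longleftrightarrow> u \<in> loops I'" if u: "len u \<le> fact (n + 1)" for u
      proof (rule loops_agree[OF _ u])
        fix k assume "ell_rung k < int (fact (n + 1))"
        then have "k < n" unfolding ell_rung_def[of n, symmetric] by (rule ell_rung_less)
        then show "k \<in> I \<longleftrightarrow> k \<in> I'" by (simp add: I'_def)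
      qed
      from symbols_agree[OF loops.double_group_axioms loops.double_group_axioms this w(1)] w(2) show ?thesis by simp
    qed
    show "wval \<rho> w = 0"
      if short: "\<And>w. length w \<le> 4 * fact n + 2 \<Longrightarrow> wval (loops.symbol J) w = 0 \<Longrightarrow> wval \<rho> w = 0"
        and w: "length w \<le> fact (n + 2)" "wval (loops.symbol J) w = 0"
      for \<rho> :: "bool \<times> letter \<Rightarrow> (letter red lamp \<times> letter red lamp) bijection" and w
    proof (rule relators_fill)
      \<comment> \<open>Inverse letters form a relation of length two, so \<rho> respects
        \<open>flip\<close>.\<close>
      have "\<rho> s + \<rho> (flip s) = 0" for s using short[of "[s, flip s]"] flip[of J s] by simp
      then show "\<rho> (flip s) = - \<rho> s" for s by (metis minus_unique)
      have "u \<in> loops J \<longleftrightarrow> u \<in> loops J'" if u: "len u \<le> fact (n + 2)" for u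
      proof (rule loops_agree[OF _ u])
        fix k assume "ell_rung k < int (fact (n + 2))"
        then have "ell_rung k < ell_rung (Suc n)" unfolding ell_rung_def by simp
        then have "k < Suc n" by (rule ell_rung_less)
        then show "k \<in> J \<longleftrightarrow> k \<in> J'" using n(1) by (auto simp: J'_def less_Suc_eq)
      qed
      from symbols_agree[OF loops.double_group_axioms loops.double_group_axioms this w(1)] w(2)
      show "wval (loops.symbol J') w = 0" by simp
      show "wval \<rho> (relator k) = 0" if k: "k \<in> J'" for k
      proof (rule short)
        have "fact (k + 1) \<le> (fact n :: nat)" using k by (intro fact_mono) (simp add: J'_def)
        then show "length (relator k) \<le> 4 * fact n + 2" unfolding length_relator by linarith
        show "wval (loops.symbol J) (relator k) = 0" using k by (simp add: symbols_relator_iff J'_def)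
      qed
    qed
    have f0: "(1::nat) \<le> fact n" "(1::nat) \<le> fact (n + 1)" by (simp_all add: Suc_le_eq del: fact_Suc)
    have Cn: "C * 6 \<le> n + 1" "C * 6 \<le> n + 2" "2 * C + C * C + 1 \<le> n + 1" using n(2) by auto
    have "C * (4 * fact n + 2) \<le> C * (6 * fact n)" using f0 by (intro mult_left_mono) auto
    also have "\<dots> = (C * 6) * fact n" by simp
    also have "\<dots> \<le> (n + 1) * fact n" using Cn by (intro mult_right_mono) auto
    finally show "C * (4 * fact n + 2) \<le> fact (n + 1)" by simp
    have "C * length (relator n) \<le> C * (6 * fact (n + 1))"
      unfolding length_relator using f0 by (intro mult_left_mono) auto
    also have "\<dots> = (C * 6) * fact (n + 1)" by (simp only: mult.assoc)
    also have "\<dots> \<le> (n + 2) * fact (n + 1)" using Cn by (intro mult_right_mono) auto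
    finally show "C * length (relator n) \<le> fact (n + 2)" by simp
    show "2 * C + C * C + 1 \<le> fact (n + 1)" using Cn(3) fact_ge_self[of "n + 1"] by linarith
    show "wval (loops.symbol I) (relator n) = 0" using n(1) by (simp add: symbols_relator_iff)
    show "0 \<in> loops.GA I" by (rule loops.zero_H)
    show "x + loops.symbol I s \<in> loops.GA I" if "x \<in> loops.GA I" for x s using that GA_symbol by blast
  qed (use \<theta> \<phi> \<delta> flip in auto)
  then show False by (simp add: symbols_relator_iff I'_def)
qed

text \<open>The codes of the initial segments of distinct sets agree only finitely often.\<close>
definition segments :: "nat set \<Rightarrow> nat set" where
  "segments A = range (\<lambda>k. prod_encode (k, set_encode (A \<inter> {..<k})))"

lemma segments_infinite:
  assumes "A \<noteq> B"
  shows "infinite (segments A - segments B)"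
proof -
  obtain m where m: "m \<in> A \<longleftrightarrow> m \<notin> B" using assms by blast
  define c where "c k = prod_encode (k, set_encode (A \<inter> {..<k}))" for k
  have "c k \<notin> segments B" if "m < k" for k
  proof
    assume "c k \<in> segments B"
    then have "set_encode (A \<inter> {..<k}) = set_encode (B \<inter> {..<k})" by (auto simp: segments_def c_def)
    then have "A \<inter> {..<k} = B \<inter> {..<k}" by (simp add: set_encode_eq)
    then show False using m that by blast
  qed
  then have "c ` {m<..} \<subseteq> segments A - segments B" by (auto simp: segments_def c_def)
  moreover have "infinite (c ` {m<..})"
    by (subst finite_image_iff) (auto simp: inj_on_def c_def infinite_Ioi)
  ultimately show ?thesis using infinite_super by blast
qed

text \<open>The subsets of the naturals supply continuum many indices, and passing to
  \<open>segments\<close> turns mere distinctness into an infinite difference for every ordered pair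
  of indices.\<close>

theorem theorem6p1:
  shows "\<exists>(G :: nat set \<Rightarrow> nat monoid) (S :: nat set \<Rightarrow> nat set).
    (\<forall>A. group (G A) \<and> finite (S A) \<and> S A \<subseteq> carrier (G A) \<and>
         generate (G A) (S A) = carrier (G A) \<and> torsion_free (G A) \<and>
         (\<forall>g\<in>carrier (G A). g \<noteq> \<one>\<^bsub>G A\<^esub> \<longrightarrow>
            strongly_contracting (G A) (S A) (generate (G A) {g})) \<and>
         HEC (G A)) \<and>
    (\<forall>A B. A \<noteq> B \<longrightarrow> \<not> quasi_isometric (G A) (S A) (G B) (S B))"
proof (intro exI conjI allI impI)
  fix A
  show "group (NGI (segments A))" by (rule loops.group_NG)
  show "finite (SGI (segments A))" using loops.finite_S by simp
  show "SGI (segments A) \<subseteq> carrier (NGI (segments A))" using loops.S_H by auto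
  show "generate (NGI (segments A)) (SGI (segments A)) = carrier (NGI (segments A))" by (rule loops.generate_NG)
  show "torsion_free (NGI (segments A))" by (rule loops.double_conclusions(1))
  show "\<forall>g\<in>carrier (NGI (segments A)). g \<noteq> \<one>\<^bsub>NGI (segments A)\<^esub> \<longrightarrow>
      strongly_contracting (NGI (segments A)) (SGI (segments A)) (generate (NGI (segments A)) {g})"
    by (rule loops.double_conclusions(2))
  show "HEC (NGI (segments A))" by (rule loops.double_conclusions(3))
next
  fix A B :: "nat set" assume "A \<noteq> B"
  then show "\<not> quasi_isometric (NGI (segments A)) (SGI (segments A)) (NGI (segments B)) (SGI (segments B))"
    by (intro not_quasi_isometric segments_infinite)
qed

end
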